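(* Let $d\in\{2,3\}$ and let $L=-\sum_{i=1}^d\frac{\partial^2}{\partial x_i^2}$ be the operator in $L^2(\mathbb{R}^d)$ with domain $C_c^\infty(\mathbb{R}^d\setminus\{0\})$. The self-adjoint extensions of $L$ can be parametrized by a circle $\theta\in[-\pi,\pi)$ (each $\theta$ giving one self-adjoint extension $L_\theta$, distinct $\theta$ giving distinct extensions, and every self-adjoint extension of $L$ being some $L_\theta$), with \[D(L_\theta)=\Big\{\varphi+\beta\,\mathcal{F}^{-1}\Big(\frac{1}{|\xi|^2-i}\Big)+e^{i\theta}\beta\,\mathcal{F}^{-1}\Big(\frac{1}{|\xi|^2+i}\Big):\ \varphi\in W^{2,2}(\mathbb{R}^d),\ \varphi(0)=0,\ \beta\in\mathbb{C}\Big\},\] and \[L_\theta\Big(\varphi+\beta\,\mathcal{F}^{-1}\Big(\frac{1}{|\xi|^2-i}\Big)+e^{i\theta}\beta\,\mathcal{F}^{-1}\Big(\frac{1}{|\xi|^2+i}\Big)\Big)=\overline{L}\varphi+i\beta\,\mathcal{F}^{-1}\Big(\frac{1}{|\xi|^2-i}\Big)-ie^{i\theta}\beta\,\mathcal{F}^{-1}\Big(\frac{1}{|\xi|^2+i}\Big).\]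
   Context: All functions are complex-valued. $\overline{L}$ denotes the closure of the symmetric operator $L$ in $L^2(\mathbb{R}^d)$. $W^{2,2}(\mathbb{R}^d)$ is the $L^2$-based Sobolev space of order 2; for $d=2,3$ its elements have continuous representatives, so $\varphi(0)$ makes sense. $\mathcal{F}^{-1}$ is the inverse Fourier transform on $L^2(\mathbb{R}^d)$, normalized as $\mathcal{F}^{-1}(g)(x)=(2\pi)^{-d}\int_{\mathbb{R}^d} e^{ix\cdot\xi}g(\xi)\,d\xi$ (in the $L^2$ sense), under which $\mathcal{F}L\mathcal{F}^{-1}$ is multiplication by $|\xi|^2$; the functions $\frac{1}{|\xi|^2\pm i}$ belong to $L^2(\mathbb{R}^d)$ for $d=2,3$. *)

theory Defs
  imports "HOL-Analysis.Analysis"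
begin

section \<open>The complex Hilbert space \<open>L\<^sup>2\<close>\<close>

definition square_integrable :: "('a::euclidean_space \<Rightarrow> complex) \<Rightarrow> bool" where
  "square_integrable f \<longleftrightarrow>
     f \<in> borel_measurable lborel \<and> integrable lborel (\<lambda>x. (cmod (f x))\<^sup>2)"

definition L2_rel :: "('a::euclidean_space \<Rightarrow> complex) \<Rightarrow> ('a \<Rightarrow> complex) \<Rightarrow> bool" where
  "L2_rel f g \<longleftrightarrow> square_integrable f \<and> square_integrable g \<and> (AE x in lborel. f x = g x)"

lemma borel_measurable_cnj_comp [measurable (raw)]:
  assumes "f \<in> borel_measurable M" shows "(\<lambda>x. cnj (f x)) \<in> borel_measurable M"
  using borel_measurable_continuous_on[OF _ assms, of cnj] by (simp add: continuous_on_cnj)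

lemma square_integrable_zero: "square_integrable (\<lambda>_. 0)"
  by (simp add: square_integrable_def)

lemma square_integrable_scale:
  assumes "square_integrable f" shows "square_integrable (\<lambda>x. c * f x)"
  using assms unfolding square_integrable_def norm_mult power_mult_distrib by auto

lemma square_integrable_add:
  assumes "square_integrable f" "square_integrable g"
  shows "square_integrable (\<lambda>x. f x + g x)"
proof -
  have m[measurable]: "f \<in> borel_measurable lborel" "g \<in> borel_measurable lborel"
    using assms by (auto simp: square_integrable_def)
  have "integrable lborel (\<lambda>x. 2 * (cmod (f x))\<^sup>2 + 2 * (cmod (g x))\<^sup>2)"
    using assms by (simp add: square_integrable_def)
  moreover have "(cmod (f x + g x))\<^sup>2 \<le> 2 * (cmod (f x))\<^sup>2 + 2 * (cmod (g x))\<^sup>2" for x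
  proof -
    have "(cmod (f x + g x))\<^sup>2 \<le> (cmod (f x) + cmod (g x))\<^sup>2"
      by (intro power_mono norm_triangle_ineq) simp
    also have "\<dots> \<le> 2 * (cmod (f x))\<^sup>2 + 2 * (cmod (g x))\<^sup>2"
      using zero_le_power2[of "cmod (f x) - cmod (g x)"] by (simp add: power2_eq_square algebra_simps)
    finally show ?thesis .
  qed
  moreover have "(\<lambda>x. (cmod (f x + g x))\<^sup>2) \<in> borel_measurable lborel" by measurable
  ultimately have "integrable lborel (\<lambda>x. (cmod (f x + g x))\<^sup>2)"
    by (elim Bochner_Integration.integrable_bound) auto
  then show ?thesis by (simp add: square_integrable_def)
qed

lemma square_integrable_uminus:
  assumes "square_integrable f" shows "square_integrable (\<lambda>x. - f x)"
  using square_integrable_scale[OF assms, of "-1"] by simp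

lemma square_integrable_diff:
  assumes "square_integrable f" "square_integrable g"
  shows "square_integrable (\<lambda>x. f x - g x)"
  using square_integrable_add[OF assms(1) square_integrable_uminus[OF assms(2)]] by simp

lemma square_integrable_mult_cnj:
  assumes "square_integrable f" "square_integrable g"
  shows "integrable lborel (\<lambda>x. f x * cnj (g x))"
proof -
  have m[measurable]: "f \<in> borel_measurable lborel" "g \<in> borel_measurable lborel"
    using assms by (auto simp: square_integrable_def)
  have "integrable lborel (\<lambda>x. (cmod (f x))\<^sup>2 + (cmod (g x))\<^sup>2)"
    using assms by (simp add: square_integrable_def)
  moreover have "cmod (f x) * cmod (g x) \<le> (cmod (f x))\<^sup>2 + (cmod (g x))\<^sup>2" for x
    using sum_squares_bound[of "cmod (f x)" "cmod (g x)"]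
      mult_nonneg_nonneg[OF norm_ge_zero[of "f x"] norm_ge_zero[of "g x"]] by linarith
  ultimately show ?thesis
    by (elim Bochner_Integration.integrable_bound) (measurable, auto intro!: AE_I2 simp: norm_mult)
qed

quotient_type (overloaded) 'a L2 = "'a::euclidean_space \<Rightarrow> complex" / partial: L2_rel
proof (rule part_equivpI)
  show "\<exists>f :: 'a \<Rightarrow> complex. L2_rel f f"
    by (rule exI[of _ "\<lambda>_. 0"]) (simp add: L2_rel_def square_integrable_zero)
  show "symp L2_rel" by (auto simp: symp_def L2_rel_def)
  show "transp L2_rel"
    unfolding transp_def L2_rel_def by (auto elim: AE_mp)
qed

text \<open>
  The class of a function in \<open>L\<^sup>2\<close>. Functions that are not square integrable are sent to \<open>0\<close>;
  this is a dummy value.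
\<close>
lift_definition to_L2 :: "('a::euclidean_space \<Rightarrow> complex) \<Rightarrow> 'a L2" is
  "\<lambda>f. if square_integrable f then f else (\<lambda>_. 0)"
  by (auto simp: L2_rel_def square_integrable_zero)

lift_definition scaleC :: "complex \<Rightarrow> 'a::euclidean_space L2 \<Rightarrow> 'a L2" (infixr \<open>*\<^sub>C\<close> 75) is
  "\<lambda>c f x. c * f x"
  by (auto simp: L2_rel_def square_integrable_scale)

text \<open>The inner product is linear in the first argument.\<close>
lift_definition cinner :: "'a::euclidean_space L2 \<Rightarrow> 'a L2 \<Rightarrow> complex" is
  "\<lambda>f g. LINT x|lborel. f x * cnj (g x)"
proof -
  fix f f' g g' :: "'a \<Rightarrow> complex"
  assume *: "L2_rel f f'" "L2_rel g g'"
  then have [measurable]: "f \<in> borel_measurable lborel" "f' \<in> borel_measurable lborel"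
      "g \<in> borel_measurable lborel" "g' \<in> borel_measurable lborel"
    by (auto simp: L2_rel_def square_integrable_def)
  show "(LINT x|lborel. f x * cnj (g x)) = (LINT x|lborel. f' x * cnj (g' x))"
    using * by (intro integral_cong_AE) (measurable, auto simp: L2_rel_def)
qed

text \<open>
  The real inner product \<open>Re (cinner u v)\<close> induces the \<open>L\<^sup>2\<close> norm, so this instance makes the
  library's notions of limit and closure those of \<open>L\<^sup>2\<close>.
\<close>
instantiation L2 :: (euclidean_space) real_inner
begin

lift_definition zero_L2 :: "'a L2" is "\<lambda>_. 0"
  by (simp add: L2_rel_def square_integrable_zero)

lift_definition plus_L2 :: "'a L2 \<Rightarrow> 'a L2 \<Rightarrow> 'a L2" is "\<lambda>f g x. f x + g x"
  by (auto simp: L2_rel_def square_integrable_add)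

lift_definition uminus_L2 :: "'a L2 \<Rightarrow> 'a L2" is "\<lambda>f x. - f x"
  by (auto simp: L2_rel_def square_integrable_uminus)

lift_definition minus_L2 :: "'a L2 \<Rightarrow> 'a L2 \<Rightarrow> 'a L2" is "\<lambda>f g x. f x - g x"
  by (auto simp: L2_rel_def square_integrable_diff)

definition scaleR_L2 :: "real \<Rightarrow> 'a L2 \<Rightarrow> 'a L2" where
  "scaleR_L2 r u = complex_of_real r *\<^sub>C u"

definition inner_L2 :: "'a L2 \<Rightarrow> 'a L2 \<Rightarrow> real" where
  "inner_L2 u v = Re (cinner u v)"

definition norm_L2 :: "'a L2 \<Rightarrow> real" where
  "norm_L2 u = sqrt (inner u u)"

definition sgn_L2 :: "'a L2 \<Rightarrow> 'a L2" where
  "sgn_L2 u = inverse (norm u) *\<^sub>R u"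

definition dist_L2 :: "'a L2 \<Rightarrow> 'a L2 \<Rightarrow> real" where
  "dist_L2 u v = norm (u - v)"

definition uniformity_L2 :: "('a L2 \<times> 'a L2) filter" where
  "uniformity_L2 = (INF e\<in>{0<..}. principal {(u, v). dist u v < e})"

definition open_L2 :: "'a L2 set \<Rightarrow> bool" where
  "open_L2 U \<longleftrightarrow> (\<forall>u\<in>U. eventually (\<lambda>(u', v). u' = u \<longrightarrow> v \<in> U) uniformity)"

instance
proof
  fix u v w :: "'a L2" and a b r :: real
  show "u + v + w = u + (v + w)"
    by transfer (simp add: L2_rel_def square_integrable_add add.assoc)
  show "u + v = v + u"
    by transfer (simp add: L2_rel_def square_integrable_add add.commute)
  show "0 + u = u"
    by transfer (simp add: L2_rel_def)
  show "- u + u = 0"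
    by transfer (simp add: L2_rel_def square_integrable_zero)
  show "u - v = u + - v"
    by transfer (simp add: L2_rel_def square_integrable_diff)
  show "a *\<^sub>R (u + v) = a *\<^sub>R u + a *\<^sub>R v"
    unfolding scaleR_L2_def
    by transfer (auto simp: L2_rel_def distrib_left
        intro!: square_integrable_add square_integrable_scale)
  show "(a + b) *\<^sub>R u = a *\<^sub>R u + b *\<^sub>R u"
    unfolding scaleR_L2_def
    by transfer (auto simp: L2_rel_def distrib_right
        intro!: square_integrable_add square_integrable_scale)
  show "a *\<^sub>R b *\<^sub>R u = (a * b) *\<^sub>R u"
    unfolding scaleR_L2_def
    by transfer (simp add: L2_rel_def square_integrable_scale mult.assoc)
  show "1 *\<^sub>R u = u"
    unfolding scaleR_L2_def by transfer (simp add: L2_rel_def)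
  show "dist u v = norm (u - v)" by (rule dist_L2_def)
  show "sgn u = inverse (norm u) *\<^sub>R u" by (rule sgn_L2_def)
  show "uniformity = (INF e\<in>{0<..}. principal {(u :: 'a L2, v). dist u v < e})"
    by (rule uniformity_L2_def)
  show "open U \<longleftrightarrow> (\<forall>u\<in>U. \<forall>\<^sub>F (u', v) in uniformity. u' = u \<longrightarrow> v \<in> U)" for U :: "'a L2 set"
    by (rule open_L2_def)
  have "cinner v u = cnj (cinner u v)"
    by transfer (simp add: mult.commute flip: Bochner_Integration.integral_cnj)
  then show "inner u v = inner v u" by (simp add: inner_L2_def)
  have "cinner (u + v) w = cinner u w + cinner v w"
    by transfer (simp add: L2_rel_def square_integrable_mult_cnj distrib_right)
  then show "inner (u + v) w = inner u w + inner v w" by (simp add: inner_L2_def)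
  have "cinner (of_real r *\<^sub>C u) v = of_real r * cinner u v"
    by transfer (simp add: mult.assoc)
  then show "inner (r *\<^sub>R u) v = r * inner u v" by (simp add: inner_L2_def scaleR_L2_def)
  have *: "cinner u u = of_real (inner u u) \<and> 0 \<le> inner u u \<and> (inner u u = 0 \<longleftrightarrow> u = 0)"
    unfolding inner_L2_def
  proof transfer
    fix f :: "'a \<Rightarrow> complex"
    assume "L2_rel f f"
    then have f: "square_integrable f" and i: "integrable lborel (\<lambda>x. (cmod (f x))\<^sup>2)"
      by (auto simp: L2_rel_def square_integrable_def)
    have eq: "(LINT x|lborel. f x * cnj (f x)) = of_real (LINT x|lborel. (cmod (f x))\<^sup>2)"
      by (simp only: complex_norm_square flip: integral_complex_of_real)
    have "(LINT x|lborel. (cmod (f x))\<^sup>2) = 0 \<longleftrightarrow> (AE x in lborel. (cmod (f x))\<^sup>2 = 0)"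
      by (rule integral_nonneg_eq_0_iff_AE[OF i]) simp
    then show "(LINT x|lborel. f x * cnj (f x)) = of_real (Re (LINT x|lborel. f x * cnj (f x))) \<and>
        0 \<le> Re (LINT x|lborel. f x * cnj (f x)) \<and>
        (Re (LINT x|lborel. f x * cnj (f x)) = 0 \<longleftrightarrow> L2_rel f (\<lambda>_. 0))"
      unfolding eq using f by (simp add: L2_rel_def square_integrable_zero)
  qed
  then show "0 \<le> inner u u" "inner u u = 0 \<longleftrightarrow> u = 0" by auto
  show "norm u = sqrt (inner u u)" by (rule norm_L2_def)
qed

end


section \<open>Unbounded operators\<close>

text \<open>Operators in \<open>L\<^sup>2\<close> are identified with their graphs; an extension is then a superset.\<close>

type_synonym 'a operator = "('a L2 \<times> 'a L2) set"

definition linear_operator :: "'a::euclidean_space operator \<Rightarrow> bool" where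
  "linear_operator T \<longleftrightarrow>
     single_valued T \<and> (0, 0) \<in> T \<and>
     (\<forall>(u, v)\<in>T. \<forall>(u', v')\<in>T. (u + u', v + v') \<in> T) \<and>
     (\<forall>c. \<forall>(u, v)\<in>T. (c *\<^sub>C u, c *\<^sub>C v) \<in> T)"

definition op_apply :: "'a::euclidean_space operator \<Rightarrow> 'a L2 \<Rightarrow> 'a L2" where
  "op_apply T u = (THE v. (u, v) \<in> T)"

definition op_closure :: "'a::euclidean_space operator \<Rightarrow> 'a operator" where
  "op_closure T = closure T"

definition densely_defined :: "'a::euclidean_space operator \<Rightarrow> bool" where
  "densely_defined T \<longleftrightarrow> closure (Domain T) = UNIV"

definition adjoint_op :: "'a::euclidean_space operator \<Rightarrow> 'a operator" where
  "adjoint_op T = {(v, w). \<forall>(x, y)\<in>T. cinner y v = cinner x w}"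

definition self_adjoint :: "'a::euclidean_space operator \<Rightarrow> bool" where
  "self_adjoint T \<longleftrightarrow> linear_operator T \<and> densely_defined T \<and> adjoint_op T = T"


section \<open>Test functions and Sobolev spaces\<close>

definition partial_deriv :: "'n::finite \<Rightarrow> (real^'n \<Rightarrow> complex) \<Rightarrow> real^'n \<Rightarrow> complex" where
  "partial_deriv i f x = vector_derivative (\<lambda>t. f (x + t *\<^sub>R axis i 1)) (at 0)"

text \<open>A list of indices \<open>[i, j, \<dots>]\<close> stands for the iterated derivative \<open>\<partial>\<^sub>i \<partial>\<^sub>j \<dots>\<close>.\<close>
primrec partial_derivs :: "'n::finite list \<Rightarrow> (real^'n \<Rightarrow> complex) \<Rightarrow> real^'n \<Rightarrow> complex" where
  "partial_derivs [] f = f"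
| "partial_derivs (i # is) f = partial_deriv i (partial_derivs is f)"

definition smooth :: "(real^'n::finite \<Rightarrow> complex) \<Rightarrow> bool" where
  "smooth f \<longleftrightarrow>
     (\<forall>is. continuous_on UNIV (partial_derivs is f) \<and>
        (\<forall>i x. (\<lambda>t. partial_derivs is f (x + t *\<^sub>R axis i 1)) differentiable at 0))"

text \<open>\<open>C\<^sub>c\<^sup>\<infinity>(U)\<close> for open \<open>U\<close>, its elements being extended by zero to the whole space.\<close>
definition test_functions :: "(real^'n::finite) set \<Rightarrow> (real^'n \<Rightarrow> complex) set" where
  "test_functions U =
     {f. smooth f \<and> compact (closure {x. f x \<noteq> 0}) \<and> closure {x. f x \<noteq> 0} \<subseteq> U}"

definition weak_deriv ::
  "'n::finite list \<Rightarrow> (real^'n \<Rightarrow> complex) \<Rightarrow> (real^'n \<Rightarrow> complex) \<Rightarrow> bool" where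
  "weak_deriv is u w \<longleftrightarrow>
     (\<forall>f\<in>test_functions UNIV.
        (LINT x|lborel. u x * partial_derivs is f x) =
        (-1) ^ length is * (LINT x|lborel. w x * f x))"

text \<open>The space \<open>W\<^sup>k\<^sup>,\<^sup>2\<close> on the whole of \<open>\<real>\<^sup>n\<close>.\<close>
definition sobolev :: "nat \<Rightarrow> (real^'n::finite) L2 set" where
  "sobolev k =
     {to_L2 u | u. square_integrable u \<and>
        (\<forall>is. length is \<le> k \<longrightarrow> (\<exists>w. square_integrable w \<and> weak_deriv is u w))}"

text \<open>The value at \<open>x\<close> of the continuous representative.\<close>
definition point_value :: "'a::euclidean_space L2 \<Rightarrow> 'a \<Rightarrow> complex" where
  "point_value u x =
     (THE f. continuous_on UNIV f \<and> square_integrable f \<and> to_L2 f = u) x"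


section \<open>The Fourier transform and the punctured Laplacian\<close>

lift_definition inv_fourier_ball :: "real \<Rightarrow> 'a::euclidean_space L2 \<Rightarrow> 'a \<Rightarrow> complex" is
  "\<lambda>R g x. (LINT \<xi>:cball 0 R|lborel. exp (\<i> * of_real (x \<bullet> \<xi>)) * g \<xi>) / of_real ((2 * pi) ^ DIM('a))"
proof -
  fix R :: real and g g' :: "'a \<Rightarrow> complex"
  assume *: "L2_rel g g'"
  then have [measurable]: "g \<in> borel_measurable borel" "g' \<in> borel_measurable borel"
    by (auto simp: L2_rel_def square_integrable_def)
  have [measurable]: "(\<lambda>\<xi>. exp (\<i> * of_real (x \<bullet> \<xi>))) \<in> borel_measurable borel"
    "cball 0 R \<in> sets borel" for x :: 'a
    by (auto intro!: borel_measurable_continuous_onI continuous_intros)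
  have "(LINT \<xi>:cball 0 R|lborel. exp (\<i> * of_real (x \<bullet> \<xi>)) * g \<xi>) =
        (LINT \<xi>:cball 0 R|lborel. exp (\<i> * of_real (x \<bullet> \<xi>)) * g' \<xi>)" for x
    unfolding set_lebesgue_integral_def
  proof (rule integral_cong_AE)
    show "AE \<xi> in lborel. indicat_real (cball 0 R) \<xi> *\<^sub>R (exp (\<i> * of_real (x \<bullet> \<xi>)) * g \<xi>) =
        indicat_real (cball 0 R) \<xi> *\<^sub>R (exp (\<i> * of_real (x \<bullet> \<xi>)) * g' \<xi>)"
      using * by (auto simp: L2_rel_def)
  qed measurable
  then show "(\<lambda>x. (LINT \<xi>:cball 0 R|lborel. exp (\<i> * of_real (x \<bullet> \<xi>)) * g \<xi>) / of_real ((2 * pi) ^ DIM('a))) =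
        (\<lambda>x. (LINT \<xi>:cball 0 R|lborel. exp (\<i> * of_real (x \<bullet> \<xi>)) * g' \<xi>) / of_real ((2 * pi) ^ DIM('a)))"
    by simp
qed

text \<open>
  The defining integral need not converge absolutely for \<open>g\<close> in \<open>L\<^sup>2\<close>; it is taken as the
  \<open>L\<^sup>2\<close>-limit of the integrals over balls of increasing radius.
\<close>
definition inv_fourier :: "'a::euclidean_space L2 \<Rightarrow> 'a L2" where
  "inv_fourier g = Lim at_top (\<lambda>R. to_L2 (inv_fourier_ball R g))"

definition punctured_laplacian :: "(real^'n::finite) operator" where
  "punctured_laplacian =
     {(to_L2 f, to_L2 (\<lambda>x. - (\<Sum>i\<in>UNIV. partial_derivs [i, i] f x))) | f.
        f \<in> test_functions (- {0})}"

end

theory Submission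
  imports Defs "HOL-Probability.Characteristic_Functions"
begin

text \<open>
  On the Fourier side the closure of the punctured Laplacian is multiplication by \<open>|\<xi>|\<^sup>2\<close> on the
  functions of vanishing integral, the integral being a multiple of the value at the origin, and its
  adjoint is \<open>p \<mapsto> |\<xi>|\<^sup>2p - c\<close>, where the constant \<open>c\<close> is the symbol of a Dirac measure at the puncture.
  The adjoint is found by cutting off test functions near the origin, which costs a bounded amount
  in \<open>L\<^sup>2\<close> on shrinking balls since the dimension is at least 2; the resolvents \<open>1/(|\<xi>|\<^sup>2 \<mp> \<i>)\<close> are
  square integrable since it is at most 3. Hence the domain of the adjoint is that of the closure
  plus the span of \<open>g\<^sub>1\<close> and \<open>g\<^sub>2\<close>, and on the coefficients \<open>(\<beta>, \<gamma>)\<close> the boundary form is a multiple of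
  \<open>\<beta> cnj \<beta>' - \<gamma> cnj \<gamma>'\<close>, whose Lagrangian subspaces are the lines \<open>\<gamma> = z\<beta>\<close> with \<open>|z| = 1\<close>.
  Plancherel's theorem is obtained from explicit computations with Gaussians, whose span is dense.
\<close>

section \<open>The Hilbert space \<open>L\<^sup>2\<close>\<close>

text \<open>The operator closure is never approximated directly: the closure of a linear graph is
  its double adjoint, so two adjoint computations suffice. Each ends in showing that a symbol K
  vanishes almost everywhere, where K contains the factor |\<xi>|^2 and possibly a constant, hence
  is square integrable only after division by 1 + |\<xi>|^2. Separation by test functions is
  therefore proved in that weighted form, through cut-off Gaussians whose transforms are explicit.
  Since \<open>inv_fourier\<close> is defined as a limit and says nothing until that limit is known
  to exist, transforms are handled through a relation tested against Gaussians. The relation passes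
  to limits in L2 and either member determines the other, which afterwards identifies the limit. The
  normalization (2 pi)^(-d) makes the transform isometric only up to the constant
  \<open>fourier_norm\<close>. Unitary maps between deficiency spaces do not appear: taking adjoints
  places a self-adjoint extension between the closure and the adjoint, and only two complex
  coordinates remain to be compared.\<close>

lemma square_integrable_measurable:
  "square_integrable f \<Longrightarrow> f \<in> borel_measurable borel"
  by (simp add: square_integrable_def)

lemma square_integrable_AE_bound:
  assumes "square_integrable g" "f \<in> borel_measurable borel" "AE x in lborel. cmod (f x) \<le> cmod (g x)"
  shows "square_integrable f"
  unfolding square_integrable_def
proof
  have [measurable]: "f \<in> borel_measurable borel" by fact
  show "integrable lborel (\<lambda>x. (cmod (f x))\<^sup>2)"
  proof (rule Bochner_Integration.integrable_bound)
    show "integrable lborel (\<lambda>x. (cmod (g x))\<^sup>2)"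
      using assms(1) by (simp add: square_integrable_def)
    show "(\<lambda>x. (cmod (f x))\<^sup>2) \<in> borel_measurable lborel" by measurable
    show "AE x in lborel. norm ((cmod (f x))\<^sup>2) \<le> norm ((cmod (g x))\<^sup>2)"
      using assms(3) by eventually_elim (simp add: power_mono)
  qed
qed (use assms in simp)

lemmas square_integrable_bound = square_integrable_AE_bound[OF _ _ AE_I2]

lemma square_integrable_cnj:
  "square_integrable f \<Longrightarrow> square_integrable (\<lambda>x. cnj (f x))"
  by (rule square_integrable_bound, assumption) (auto simp: square_integrable_def)

lemma square_integrable_mult:
  assumes "square_integrable f" "square_integrable g"
  shows "integrable lborel (\<lambda>x. f x * g x)"
  using square_integrable_mult_cnj[OF assms(1) square_integrable_cnj[OF assms(2)]] by simp

lemma L2_cases: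
  obtains f where "square_integrable f" "u = to_L2 f"
proof -
  have "\<exists>f. square_integrable f \<and> u = to_L2 f"
    by transfer (auto simp: L2_rel_def)
  then show ?thesis using that by blast
qed

lemma to_L2_eq_iff:
  "square_integrable f \<Longrightarrow> square_integrable g \<Longrightarrow>
    to_L2 f = to_L2 g \<longleftrightarrow> (AE x in lborel. f x = g x)"
  by transfer (simp add: L2_rel_def)

lemma to_L2_add:
  "square_integrable f \<Longrightarrow> square_integrable g \<Longrightarrow>
    to_L2 (\<lambda>x. f x + g x) = to_L2 f + to_L2 g"
  by transfer (simp add: L2_rel_def square_integrable_add)

lemma to_L2_diff:
  "square_integrable f \<Longrightarrow> square_integrable g \<Longrightarrow>
    to_L2 (\<lambda>x. f x - g x) = to_L2 f - to_L2 g"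
  by transfer (simp add: L2_rel_def square_integrable_diff)

lemma to_L2_scale:
  "square_integrable f \<Longrightarrow> to_L2 (\<lambda>x. c * f x) = c *\<^sub>C to_L2 f"
  by transfer (simp add: L2_rel_def square_integrable_scale)

lemma to_L2_zero: "to_L2 (\<lambda>x. 0) = 0"
  by transfer (simp add: L2_rel_def square_integrable_zero)

lemma cinner_to_L2:
  "square_integrable f \<Longrightarrow> square_integrable g \<Longrightarrow>
    cinner (to_L2 f) (to_L2 g) = (LINT x|lborel. f x * cnj (g x))"
  by transfer simp

lemma norm_to_L2:
  assumes "square_integrable f"
  shows "(norm (to_L2 f))\<^sup>2 = (LINT x|lborel. (cmod (f x))\<^sup>2)"
proof -
  have "(norm (to_L2 f))\<^sup>2 = Re (cinner (to_L2 f) (to_L2 f))"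
    by (simp add: power2_norm_eq_inner inner_L2_def)
  also have "\<dots> = Re (LINT x|lborel. of_real ((cmod (f x))\<^sup>2))"
    unfolding cinner_to_L2[OF assms assms]
    by (simp only: complex_norm_square flip: integral_complex_of_real)
  also have "\<dots> = (LINT x|lborel. (cmod (f x))\<^sup>2)"
    by (simp only: integral_complex_of_real Re_complex_of_real)
  finally show ?thesis .
qed

section \<open>Complex scalars and the complex inner product\<close>

lemma scaleC_simps [simp]:
  "1 *\<^sub>C u = u" "0 *\<^sub>C u = 0" "c *\<^sub>C (0 :: 'a::euclidean_space L2) = 0"
  by (transfer, simp add: L2_rel_def square_integrable_zero)+

lemma scaleC_scaleC [simp]: "a *\<^sub>C b *\<^sub>C u = (a * b) *\<^sub>C u"
  by transfer (simp add: L2_rel_def square_integrable_scale mult.assoc)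

lemma scaleC_add_right: "c *\<^sub>C (u + v) = c *\<^sub>C u + c *\<^sub>C v"
  by transfer (auto simp: L2_rel_def distrib_left intro!: square_integrable_add square_integrable_scale)

lemma scaleC_add_left: "(a + b) *\<^sub>C u = a *\<^sub>C u + b *\<^sub>C u"
  by transfer (auto simp: L2_rel_def distrib_right intro!: square_integrable_add square_integrable_scale)

lemma scaleC_minus_left: "(- a) *\<^sub>C u = - (a *\<^sub>C u)"
  by transfer (auto simp: L2_rel_def intro!: square_integrable_uminus square_integrable_scale)

lemma scaleC_minus_right: "a *\<^sub>C (- u) = - (a *\<^sub>C u)"
  by transfer (auto simp: L2_rel_def intro!: square_integrable_uminus square_integrable_scale)

lemma scaleC_diff_left: "(a - b) *\<^sub>C u = a *\<^sub>C u - b *\<^sub>C u"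
  using scaleC_add_left[of a "- b" u] by (simp add: scaleC_minus_left)

lemma scaleC_diff_right: "c *\<^sub>C (u - v) = c *\<^sub>C u - c *\<^sub>C v"
  using scaleC_add_right[of c u "- v"] by (simp add: scaleC_minus_right)

lemma cinner_commute: "cinner v u = cnj (cinner u v)"
  by transfer (simp add: mult.commute flip: Bochner_Integration.integral_cnj)

lemma cinner_add_left: "cinner (u + v) w = cinner u w + cinner v w"
  by transfer (simp add: L2_rel_def square_integrable_mult_cnj distrib_right)

lemma cinner_scaleC_left: "cinner (c *\<^sub>C u) v = c * cinner u v"
  by transfer (simp add: mult.assoc)

lemma cinner_add_right: "cinner w (u + v) = cinner w u + cinner w v"
  using cinner_add_left[of u v w] by (metis cinner_commute complex_cnj_add)

lemma cinner_scaleC_right: "cinner u (c *\<^sub>C v) = cnj c * cinner u v"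
  using cinner_scaleC_left[of c v u] by (metis cinner_commute complex_cnj_mult)

lemma cinner_minus_left: "cinner (- u) v = - cinner u v"
  using cinner_scaleC_left[of "-1" u v] by (simp add: scaleC_minus_left)

lemma cinner_minus_right: "cinner u (- v) = - cinner u v"
  using cinner_scaleC_right[of u "-1" v] by (simp add: scaleC_minus_left)

lemma cinner_diff_left: "cinner (u - v) w = cinner u w - cinner v w"
  using cinner_add_left[of u "- v" w] by (simp add: cinner_minus_left)

lemma cinner_diff_right: "cinner w (u - v) = cinner w u - cinner w v"
  using cinner_add_right[of w u "- v"] by (simp add: cinner_minus_right)

lemmas cinner_simps = cinner_add_left cinner_add_right cinner_diff_left cinner_diff_right
  cinner_scaleC_left cinner_scaleC_right cinner_minus_left cinner_minus_right

lemma cinner_zero [simp]: "cinner 0 u = 0" "cinner u 0 = 0"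
  using cinner_scaleC_left[of 0 u u] cinner_scaleC_right[of u 0 u] by simp_all

lemma cinner_eq_norm: "cinner u u = of_real ((norm u)\<^sup>2)"
proof (rule complex_eqI)
  show "Re (cinner u u) = Re (of_real ((norm u)\<^sup>2))"
    by (simp add: power2_norm_eq_inner inner_L2_def)
  show "Im (cinner u u) = Im (of_real ((norm u)\<^sup>2))"
    using cinner_commute[of u u] by (metis Reals_cnj_iff complex_is_Real_iff Im_complex_of_real)
qed

text \<open>Recovers the complex inner product from the real one of the class instance, so that real
  Cauchy-Schwarz and polarization also control imaginary parts.\<close>

lemma Im_cinner: "Im (cinner u v) = inner u (\<i> *\<^sub>C v)"
  by (simp add: inner_L2_def cinner_scaleC_right)

lemma norm_scaleC: "norm (c *\<^sub>C u) = cmod c * norm u"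
proof -
  have "complex_of_real ((norm (c *\<^sub>C u))\<^sup>2) = (c * cnj c) * of_real ((norm u)\<^sup>2)"
    by (simp only: cinner_eq_norm[symmetric]) (simp add: cinner_scaleC_left cinner_scaleC_right)
  also have "\<dots> = of_real ((cmod c * norm u)\<^sup>2)"
    by (simp add: complex_norm_square[symmetric] power_mult_distrib)
  finally have "(norm (c *\<^sub>C u))\<^sup>2 = (cmod c * norm u)\<^sup>2"
    by (simp only: of_real_eq_iff)
  then show ?thesis by (simp add: power2_eq_iff_nonneg)
qed

lemma scaleR_eq_scaleC: "r *\<^sub>R u = of_real r *\<^sub>C u"
  by (rule scaleR_L2_def)

lemma bounded_bilinear_cinner: "bounded_bilinear cinner"
proof
  fix u v u' v' :: "'a L2" and r :: real
  show "cinner (u + u') v = cinner u v + cinner u' v" "cinner u (v + v') = cinner u v + cinner u v'"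
    by (simp_all add: cinner_simps)
  show "cinner (r *\<^sub>R u) v = r *\<^sub>R cinner u v" "cinner u (r *\<^sub>R v) = r *\<^sub>R cinner u v"
    by (simp_all add: cinner_simps scaleR_eq_scaleC scaleR_conv_of_real)
  show "\<exists>K. \<forall>u v :: 'a L2. cmod (cinner u v) \<le> norm u * norm v * K"
  \<comment> \<open>The crude constant 2 comes from bounding real and imaginary part separately by
    the real Cauchy-Schwarz inequality.\<close>
  proof (intro exI[of _ 2] allI)
    fix u v :: "'a L2"
    have "cmod (cinner u v) \<le> \<bar>Re (cinner u v)\<bar> + \<bar>Im (cinner u v)\<bar>" by (rule cmod_le)
    also have "\<dots> \<le> norm u * norm v + norm u * norm (\<i> *\<^sub>C v)"
      unfolding Im_cinner unfolding inner_L2_def[symmetric]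
      by (intro add_mono Cauchy_Schwarz_ineq2)
    finally show "cmod (cinner u v) \<le> norm u * norm v * 2" by (simp add: norm_scaleC)
  qed
qed

lemmas tendsto_cinner = bounded_bilinear.tendsto[OF bounded_bilinear_cinner]
  and continuous_on_cinner [continuous_intros] =
    bounded_bilinear.continuous_on[OF bounded_bilinear_cinner]

section \<open>Dominated convergence and completeness of L2\<close>

text \<open>Scalar dominated convergence applied to |f n - g|^2: both terms are bounded by |h|, so 4
  |h|^2 is a majorant.\<close>

lemma L2_dominated_convergence:
  fixes f :: "nat \<Rightarrow> 'a::euclidean_space \<Rightarrow> complex"
  assumes "\<And>n. f n \<in> borel_measurable borel" "g \<in> borel_measurable borel"
    and h: "square_integrable h" and bound: "\<And>n. AE x in lborel. cmod (f n x) \<le> cmod (h x)"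
    and lim: "AE x in lborel. (\<lambda>n. f n x) \<longlonglongrightarrow> g x"
  shows "(\<And>n. square_integrable (f n))" "square_integrable g" "(\<lambda>n. to_L2 (f n)) \<longlonglongrightarrow> to_L2 g"
proof -
  have [measurable]: "\<And>n. f n \<in> borel_measurable borel" "g \<in> borel_measurable borel"
    by fact+
  have hi: "integrable lborel (\<lambda>x. (cmod (h x))\<^sup>2)"
    using h by (simp add: square_integrable_def)
  show f: "square_integrable (f n)" for n
    by (rule square_integrable_AE_bound[OF h _ bound]) measurable
  have bound_all: "AE x in lborel. \<forall>n. cmod (f n x) \<le> cmod (h x)"
    using bound by (simp add: AE_all_countable)
  have gb: "AE x in lborel. cmod (g x) \<le> cmod (h x)"
    using lim bound_all
  proof eventually_elim
    case (elim x)
    have "(\<lambda>n. cmod (f n x)) \<longlonglongrightarrow> cmod (g x)" using elim(1) by (rule tendsto_norm)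
    then show ?case by (rule LIMSEQ_le_const2) (use elim(2) in auto)
  qed
  show g: "square_integrable g"
    by (rule square_integrable_AE_bound[OF h _ gb]) measurable
  have "(\<lambda>n. LINT x|lborel. (cmod (f n x - g x))\<^sup>2) \<longlonglongrightarrow> (LINT x|(lborel::'a measure). (0::real))"
  proof (rule integral_dominated_convergence)
    show "integrable lborel (\<lambda>x. 4 * (cmod (h x))\<^sup>2)" using hi by simp
    show "AE x in lborel. (\<lambda>n. (cmod (f n x - g x))\<^sup>2) \<longlonglongrightarrow> 0"
      using lim by eventually_elim (auto intro!: tendsto_eq_intros simp: LIM_zero_iff)
    show "AE x in lborel. norm ((cmod (f n x - g x))\<^sup>2) \<le> 4 * (cmod (h x))\<^sup>2" for n
      using bound[of n] gb
    proof eventually_elim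
      case (elim x)
      have "cmod (f n x - g x) \<le> cmod (f n x) + cmod (g x)" by (rule norm_triangle_ineq4)
      then have "cmod (f n x - g x) \<le> 2 * cmod (h x)" using elim by linarith
      then have "(cmod (f n x - g x))\<^sup>2 \<le> (2 * cmod (h x))\<^sup>2" by (rule power_mono) simp
      then show ?case by simp
    qed
  qed simp_all
  then have "(\<lambda>n. (norm (to_L2 (f n) - to_L2 g))\<^sup>2) \<longlonglongrightarrow> 0"
    using f g by (simp add: norm_to_L2 square_integrable_diff flip: to_L2_diff)
  then have "(\<lambda>n. norm (to_L2 (f n) - to_L2 g)) \<longlonglongrightarrow> 0"
    using tendsto_real_sqrt by fastforce
  then show "(\<lambda>n. to_L2 (f n)) \<longlonglongrightarrow> to_L2 g"
    by (simp add: LIM_zero_iff tendsto_norm_zero_iff)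
qed

text \<open>
  The weights \<open>2\<^sup>n\<close> make the almost everywhere convergence of a fast Cauchy sequence follow from
  monotone convergence alone, without Minkowski's inequality for infinite sums.
\<close>
lemma L2_fast_Cauchy_convergent:
  fixes X :: "nat \<Rightarrow> 'a::euclidean_space L2"
  assumes fast: "\<And>n m. n \<le> m \<Longrightarrow> norm (X m - X n) \<le> (1/2) ^ n"
  shows "convergent X"
proof -
  have "\<exists>f. square_integrable f \<and> X n = to_L2 f" for n
    by (rule L2_cases[of "X n"]) blast
  then obtain f where f: "\<And>n. square_integrable (f n)" and X: "\<And>n. X n = to_L2 (f n)"
    by metis
  have [measurable]: "f n \<in> borel_measurable borel" for n
    using f by (rule square_integrable_measurable)
  have ndiff: "(\<integral>\<^sup>+x. ennreal ((cmod (f m x - f n x))\<^sup>2) \<partial>lborel) = ennreal ((norm (X m - X n))\<^sup>2)" for n m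
  proof -
    have d: "square_integrable (\<lambda>x. f m x - f n x)" using f by (intro square_integrable_diff)
    then have "(\<integral>\<^sup>+x. ennreal ((cmod (f m x - f n x))\<^sup>2) \<partial>lborel) =
        ennreal (LINT x|lborel. (cmod (f m x - f n x))\<^sup>2)"
      by (intro nn_integral_eq_integral) (auto simp: square_integrable_def)
    also have "(LINT x|lborel. (cmod (f m x - f n x))\<^sup>2) = (norm (X m - X n))\<^sup>2"
      using d f by (simp add: X norm_to_L2 flip: to_L2_diff)
    finally show ?thesis .
  qed
  \<comment> \<open>The weight 2^n costs only part of the decay (1/2)^(2n) of the squared
    differences, so \<open>G\<close> still has integral at most 2; finiteness of \<open>G x\<close>
    then makes the increments at x decay geometrically.\<close>
  define G where "G x = (\<Sum>n. ennreal (2 ^ n * (cmod (f (Suc n) x - f n x))\<^sup>2))" for x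
  have "(\<integral>\<^sup>+x. G x \<partial>lborel) = (\<Sum>n. \<integral>\<^sup>+x. ennreal (2 ^ n * (cmod (f (Suc n) x - f n x))\<^sup>2) \<partial>lborel)"
    unfolding G_def by (rule nn_integral_suminf) measurable
  also have "\<dots> = (\<Sum>n. ennreal (2 ^ n * (norm (X (Suc n) - X n))\<^sup>2))"
    by (simp add: ennreal_mult nn_integral_cmult ndiff)
  also have "\<dots> \<le> (\<Sum>n. ennreal ((1/2) ^ n))"
  proof (rule suminf_le)
    fix n
    have "(norm (X (Suc n) - X n))\<^sup>2 \<le> ((1/2) ^ n)\<^sup>2" by (rule power_mono[OF fast]) auto
    then have "2 ^ n * (norm (X (Suc n) - X n))\<^sup>2 \<le> 2 ^ n * ((1/2) ^ n)\<^sup>2" by simp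
    also have "\<dots> = (1/2) ^ n" by (simp add: power_divide power2_eq_square)
    finally show "ennreal (2 ^ n * (norm (X (Suc n) - X n))\<^sup>2) \<le> ennreal ((1/2) ^ n)"
      by (rule ennreal_leI)
  qed simp_all
  also have "\<dots> = ennreal 2"
  proof -
    have "(\<lambda>n. (1/2::real) ^ n) sums 2"
      using geometric_sums[of "1/2::real"] by simp
    then show ?thesis by (intro sums_unique[symmetric] sums_ennreal[THEN iffD2]) auto
  qed
  finally have "(\<integral>\<^sup>+x. G x \<partial>lborel) \<noteq> \<infinity>"
    by (metis ennreal_less_top le_less_trans less_irrefl infinity_ennreal_def)
  then have "AE x in lborel. G x \<noteq> \<infinity>"
    by (intro nn_integral_noteq_infinite) (auto simp: G_def)
  then have conv: "AE x in lborel. convergent (\<lambda>n. f n x)"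
  proof eventually_elim
    case (elim x)
    define c where "c = enn2real (G x)"
    have term_le: "cmod (f (Suc n) x - f n x) \<le> sqrt c * (sqrt (1/2)) ^ n" for n
    proof -
      have "(\<Sum>k\<in>{n}. ennreal (2 ^ k * (cmod (f (Suc k) x - f k x))\<^sup>2)) \<le> G x"
        unfolding G_def by (rule sum_le_suminf) auto
      also have "G x = ennreal c" using elim by (simp add: c_def less_top)
      finally have "2 ^ n * (cmod (f (Suc n) x - f n x))\<^sup>2 \<le> c"
        using c_def enn2real_nonneg ennreal_le_iff by simp
      then have "(cmod (f (Suc n) x - f n x))\<^sup>2 \<le> c * (1/2) ^ n"
        by (simp add: field_simps power_divide)
      then have "sqrt ((cmod (f (Suc n) x - f n x))\<^sup>2) \<le> sqrt (c * (1/2) ^ n)"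
        by (rule real_sqrt_le_mono)
      then show ?thesis by (simp add: real_sqrt_mult real_sqrt_power)
    qed
    have "summable (\<lambda>n. sqrt c * (sqrt (1/2)) ^ n)"
      by (intro summable_mult summable_geometric) (simp add: real_sqrt_divide)
    then have "summable (\<lambda>n. f (Suc n) x - f n x)"
      by (rule summable_comparison_test'[where N=0]) (use term_le in simp)
    then have "convergent (\<lambda>n. (\<Sum>k<n. f (Suc k) x - f k x) + f 0 x)"
      by (intro convergent_add) (auto simp: summable_iff_convergent convergent_const)
    then show ?case by (simp add: sum_lessThan_telescope[of "\<lambda>n. f n x"])
  qed
  define F where "F x = lim (\<lambda>n. f n x)" for x
  have [measurable]: "F \<in> borel_measurable borel"
    unfolding F_def by measurable
  have lim: "AE x in lborel. (\<lambda>n. f n x) \<longlonglongrightarrow> F x"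
    using conv by eventually_elim (simp add: F_def convergent_LIMSEQ_iff)
  \<comment> \<open>Fatou's lemma carries the Cauchy bound over to the almost everywhere limit; no
    dominating function is available here.\<close>
  have le: "(\<integral>\<^sup>+x. ennreal ((cmod (F x - f n x))\<^sup>2) \<partial>lborel) \<le> ennreal (((1/2) ^ n)\<^sup>2)" for n
  proof -
    have "(\<integral>\<^sup>+x. ennreal ((cmod (F x - f n x))\<^sup>2) \<partial>lborel) =
        (\<integral>\<^sup>+x. liminf (\<lambda>m. ennreal ((cmod (f m x - f n x))\<^sup>2)) \<partial>lborel)"
    proof (rule nn_integral_cong_AE, use lim in eventually_elim)
      case (elim x)
      have "(\<lambda>m. ennreal ((cmod (f m x - f n x))\<^sup>2)) \<longlonglongrightarrow> ennreal ((cmod (F x - f n x))\<^sup>2)"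
        by (intro tendsto_ennrealI tendsto_intros elim)
      then show ?case by (metis lim_imp_Liminf sequentially_bot)
    qed
    also have "\<dots> \<le> liminf (\<lambda>m. \<integral>\<^sup>+x. ennreal ((cmod (f m x - f n x))\<^sup>2) \<partial>lborel)"
      by (rule nn_integral_liminf) measurable
    also have "\<dots> \<le> ennreal (((1/2) ^ n)\<^sup>2)"
    proof (rule Liminf_le)
      show "\<forall>\<^sub>F m in sequentially. (\<integral>\<^sup>+x. ennreal ((cmod (f m x - f n x))\<^sup>2) \<partial>lborel) \<le> ennreal (((1/2) ^ n)\<^sup>2)"
        using eventually_ge_at_top[of n]
        by eventually_elim (auto simp: ndiff intro!: ennreal_leI power_mono fast)
    qed simp
    finally show ?thesis .
  qed
  have sq: "square_integrable (\<lambda>x. F x - f n x)" for n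
    unfolding square_integrable_def
    using le_less_trans[OF le[of n]] by (auto intro!: integrableI_bounded)
  have F: "square_integrable F"
    using square_integrable_add[OF sq[of 0] f[of 0]] by simp
  have "norm (X n - to_L2 F) \<le> (1/2) ^ n" for n
  proof -
    have "ennreal ((norm (to_L2 F - X n))\<^sup>2) = (\<integral>\<^sup>+x. ennreal ((cmod (F x - f n x))\<^sup>2) \<partial>lborel)"
      using sq[of n] F f[of n]
      by (subst nn_integral_eq_integral) (auto simp: X norm_to_L2 square_integrable_def simp flip: to_L2_diff)
    then have "(norm (to_L2 F - X n))\<^sup>2 \<le> ((1/2) ^ n)\<^sup>2"
      using le[of n] by (metis ennreal_le_iff zero_le_power2)
    then have "norm (to_L2 F - X n) \<le> (1/2) ^ n"
      by (rule power2_le_imp_le) simp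
    then show ?thesis by (simp add: norm_minus_commute)
  qed
  then have "(\<lambda>n. X n - to_L2 F) \<longlonglongrightarrow> 0"
    by (rule Lim_null_comparison[OF always_eventually, rule_format]) (intro LIMSEQ_power_zero, simp)
  then show ?thesis by (auto simp: convergent_def LIM_zero_iff)
qed

instance L2 :: (euclidean_space) complete_space
proof
  fix X :: "nat \<Rightarrow> 'a L2"
  assume X: "Cauchy X"
  have "\<exists>r. strict_mono r \<and> (\<forall>n m. n \<le> m \<longrightarrow> norm (X (r m) - X (r n)) \<le> (1/2) ^ n)"
  proof -
    have "\<exists>N. \<forall>n\<ge>N. \<forall>m\<ge>N. norm (X m - X n) < (1/2) ^ k" for k :: nat
      using X by (metis CauchyD half_gt_zero_iff zero_less_one zero_less_power)
    then obtain N where N: "\<And>k n m. n \<ge> N k \<Longrightarrow> m \<ge> N k \<Longrightarrow> norm (X m - X n) < (1/2) ^ k"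
      by metis
    \<comment> \<open>The sum puts \<open>r k\<close> beyond \<open>N k\<close>, and the added k
      makes r strictly increasing.\<close>
    define r where "r k = (\<Sum>i\<le>k. N i) + k" for k
    have "strict_mono r" by (rule strict_monoI_Suc) (simp add: r_def)
    moreover have "r k \<ge> N k" for k
      unfolding r_def by (rule trans_le_add1) (rule member_le_sum, auto)
    ultimately have "norm (X (r m) - X (r n)) \<le> (1/2) ^ n" if "n \<le> m" for n m
      using N[of n "r n" "r m"] that by (meson le_trans less_imp_le strict_mono_less_eq)
    with \<open>strict_mono r\<close> show ?thesis by blast
  qed
  then obtain r where r: "strict_mono r" "\<And>n m. n \<le> m \<Longrightarrow> norm (X (r m) - X (r n)) \<le> (1/2) ^ n"
    by blast
  then have "convergent (\<lambda>n. X (r n))" by (intro L2_fast_Cauchy_convergent) auto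
  then obtain l where "(X \<circ> r) \<longlonglongrightarrow> l" by (auto simp: convergent_def o_def)
  then have "X \<longlonglongrightarrow> l" using X r(1) by (rule Cauchy_converges_subseq[rotated -1])
  then show "convergent X" by (auto simp: convergent_def)
qed


section \<open>Orthogonality and adjoints\<close>

text \<open>The projection theorem: a sequence minimizing the distance to x is Cauchy by the
  parallelogram identity, its limit p is the nearest point, and w = x - p.\<close>

lemma closed_subspace_orthogonal:
  fixes S :: "'a::{real_inner, complete_space} set"
  assumes S: "subspace S" "closed S" and x: "x \<notin> S"
  obtains w where "\<And>s. s \<in> S \<Longrightarrow> inner s w = 0" "inner x w \<noteq> 0"
proof -
  define d where "d = infdist x S"
  have ne: "S \<noteq> {}" using S subspace_0 by blast
  have d0: "0 \<le> d" unfolding d_def by (rule infdist_nonneg)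
  have dle: "d \<le> norm (x - s)" if "s \<in> S" for s
    unfolding d_def using infdist_le[OF that, of x] by (simp add: dist_norm)
  \<comment> \<open>The error is added to the squared distance, so that d^2 cancels exactly in the
    parallelogram identity.\<close>
  have "\<exists>s\<in>S. (norm (x - s))\<^sup>2 < d\<^sup>2 + 1 / real (Suc n)" for n
  proof (rule ccontr)
    assume "\<not> ?thesis"
    then have *: "sqrt (d\<^sup>2 + 1 / real (Suc n)) \<le> dist x s" if "s \<in> S" for s
      using that by (auto simp: dist_norm not_less intro!: real_le_lsqrt)
    have "sqrt (d\<^sup>2 + 1 / real (Suc n)) \<le> d"
      unfolding d_def infdist_notempty[OF ne] using * ne
      by (intro cINF_greatest) (auto simp: d_def infdist_notempty)
    then have "d\<^sup>2 + 1 / real (Suc n) \<le> d\<^sup>2"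
      by (rule sqrt_le_D)
    then show False by (simp add: field_simps)
  qed
  then obtain s where s: "\<And>n. s n \<in> S" and sd: "\<And>n. (norm (x - s n))\<^sup>2 < d\<^sup>2 + 1 / real (Suc n)"
    by metis
  have par: "(norm (s n - s m))\<^sup>2 \<le> 2 / real (Suc n) + 2 / real (Suc m)" for n m
  proof -
    have "(1/2) *\<^sub>R (s n + s m) \<in> S" using s S(1) by (simp add: subspace_add subspace_scale)
    then have "d\<^sup>2 \<le> (norm (x - (1/2) *\<^sub>R (s n + s m)))\<^sup>2"
      by (intro power_mono dle d0)
    moreover have "(norm (s n - s m))\<^sup>2 + 4 * (norm (x - (1/2) *\<^sub>R (s n + s m)))\<^sup>2
        = 2 * (norm (x - s n))\<^sup>2 + 2 * (norm (x - s m))\<^sup>2"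
      unfolding power2_norm_eq_inner
      by (simp add: inner_simps algebra_simps inner_commute)
    ultimately show ?thesis using sd[of n] sd[of m] by simp
  qed
  have "Cauchy s"
  proof (rule metric_CauchyI)
    fix e :: real assume e: "0 < e"
    obtain N where N: "4 / e\<^sup>2 < real N" using reals_Archimedean2 by blast
    have "dist (s m) (s n) < e" if "m \<ge> N" "n \<ge> N" for m n
    proof -
      have N0: "0 < real N" using N e by (smt (verit) divide_nonneg_pos zero_less_power)
      have "2 / real (Suc k) < e\<^sup>2 / 2" if "k \<ge> N" for k
      proof -
        have "4 / e\<^sup>2 < real (Suc k)" using N that by linarith
        then show ?thesis using e by (simp add: field_simps)
      qed
      from this[OF that(1)] this[OF that(2)] have "(norm (s m - s n))\<^sup>2 < e\<^sup>2"
        using par[of m n] by linarith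
      then show ?thesis using e by (simp add: dist_norm power_less_imp_less_base)
    qed
    then show "\<exists>M. \<forall>m\<ge>M. \<forall>n\<ge>M. dist (s m) (s n) < e" by blast
  qed
  then obtain p where p: "s \<longlonglongrightarrow> p" using Cauchy_convergent convergent_def by blast
  have pS: "p \<in> S" using S(2) s p closed_sequentially by blast
  define w where "w = x - p"
  have wd: "(norm w)\<^sup>2 \<le> d\<^sup>2"
  proof (rule LIMSEQ_le)
    show "(\<lambda>n. (norm (x - s n))\<^sup>2) \<longlonglongrightarrow> (norm w)\<^sup>2"
      unfolding w_def by (intro tendsto_intros p)
    show "(\<lambda>n. d\<^sup>2 + 1 / real (Suc n)) \<longlonglongrightarrow> d\<^sup>2"
      using tendsto_add[OF tendsto_const LIMSEQ_inverse_real_of_nat, of "d\<^sup>2"]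
      by (simp add: inverse_eq_divide)
    show "\<exists>N. \<forall>n\<ge>N. (norm (x - s n))\<^sup>2 \<le> d\<^sup>2 + 1 / real (Suc n)"
      using sd by (auto intro: less_imp_le)
  qed
  have orth: "inner t w = 0" if t: "t \<in> S" for t
  proof (cases "t = 0")
    case False
    \<comment> \<open>The real number at which the distance from x to p + r t is smallest;
      minimality of p then forces the gain (inner t w)^2 / |t|^2 to be 0.\<close>
    define r where "r = inner t w / (norm t)\<^sup>2"
    have "p + r *\<^sub>R t \<in> S" using pS t S(1) by (simp add: subspace_add subspace_scale)
    then have "d\<^sup>2 \<le> (norm (x - (p + r *\<^sub>R t)))\<^sup>2"
      by (intro power_mono dle d0)
    also have "x - (p + r *\<^sub>R t) = w - r *\<^sub>R t" by (simp add: w_def)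
    also have "(norm (w - r *\<^sub>R t))\<^sup>2 = (norm w)\<^sup>2 - 2 * r * inner t w + r\<^sup>2 * (norm t)\<^sup>2"
      unfolding power2_norm_eq_inner
      by (simp add: inner_simps algebra_simps inner_commute power2_eq_square)
    also have "\<dots> = (norm w)\<^sup>2 - (inner t w)\<^sup>2 / (norm t)\<^sup>2"
      using False by (simp add: r_def field_simps power2_eq_square)
    finally have "(inner t w)\<^sup>2 / (norm t)\<^sup>2 \<le> 0" using wd by linarith
    then show ?thesis using False by (simp add: divide_le_0_iff)
  qed simp
  have "inner x w = inner p w + inner w w" by (simp add: w_def inner_simps)
  then have "inner x w \<noteq> 0" using orth[OF pS] x pS by (auto simp: w_def)
  then show ?thesis using orth that by blast
qed

lemma subspace_closure:
  fixes S :: "'a::real_normed_vector set"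
  assumes "subspace S"
  shows "subspace (closure S)"
proof (rule subspaceI)
  show "0 \<in> closure S" using subspace_0[OF assms] closure_subset by blast
next
  fix x y assume "x \<in> closure S" "y \<in> closure S"
  then obtain f g where "\<And>n. f n \<in> S" "f \<longlonglongrightarrow> x" "\<And>n. g n \<in> S" "g \<longlonglongrightarrow> y"
    by (metis closure_sequential)
  then have "\<And>n. f n + g n \<in> S" "(\<lambda>n. f n + g n) \<longlonglongrightarrow> x + y"
    using assms by (auto intro: subspace_add tendsto_add)
  then show "x + y \<in> closure S"
    unfolding closure_sequential by (intro exI[of _ "\<lambda>n. f n + g n"]) auto
next
  fix c x assume "x \<in> closure S"
  then obtain f where "\<And>n. f n \<in> S" "f \<longlonglongrightarrow> x"
    by (metis closure_sequential)
  then have "\<And>n. c *\<^sub>R f n \<in> S" "(\<lambda>n. c *\<^sub>R f n) \<longlonglongrightarrow> c *\<^sub>R x"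
    using assms by (auto intro: subspace_scale tendsto_scaleR)
  then show "c *\<^sub>R x \<in> closure S"
    unfolding closure_sequential by (intro exI[of _ "\<lambda>n. c *\<^sub>R f n"]) auto
qed

lemma closed_adjoint_op: "closed (adjoint_op T)"
proof -
  have "adjoint_op T = (\<Inter>(x, y)\<in>T. {p. cinner y (fst p) = cinner x (snd p)})"
    by (auto simp: adjoint_op_def)
  moreover have "closed {p. cinner y (fst p) = cinner x (snd p)}" for x y :: "'a L2"
    by (intro closed_Collect_eq continuous_intros)
  ultimately show ?thesis by auto
qed

lemma adjoint_op_antimono: "S \<subseteq> T \<Longrightarrow> adjoint_op T \<subseteq> adjoint_op S"
  unfolding adjoint_op_def by blast

lemma subset_adjoint_adjoint: "T \<subseteq> adjoint_op (adjoint_op T)"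
proof
  fix p assume "p \<in> T"
  moreover have "cinner w (fst p) = cinner v (snd p)" if "cinner (snd p) v = cinner (fst p) w" for v w
    using that by (metis cinner_commute)
  ultimately show "p \<in> adjoint_op (adjoint_op T)"
    by (auto simp: adjoint_op_def split_beta)
qed

text \<open>A point off the closed graph is separated from it by some (a, b). Orthogonality of (a,
  b) to the graph says exactly that (b, -a) lies in the adjoint, and testing the double adjoint
  against that element contradicts the separation.\<close>

lemma closure_eq_adjoint_adjoint:
  fixes T :: "'a::euclidean_space operator"
  assumes zero: "(0, 0) \<in> T"
    and add: "\<And>u v u' v'. (u, v) \<in> T \<Longrightarrow> (u', v') \<in> T \<Longrightarrow> (u + u', v + v') \<in> T"
    and scale: "\<And>c u v. (u, v) \<in> T \<Longrightarrow> (c *\<^sub>C u, c *\<^sub>C v) \<in> T"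
  shows "closure T = adjoint_op (adjoint_op T)"
proof
  show "closure T \<subseteq> adjoint_op (adjoint_op T)"
    by (rule closure_minimal[OF subset_adjoint_adjoint closed_adjoint_op])
next
  have "subspace T"
    using zero add scale by (auto simp: subspace_def zero_prod_def scaleR_eq_scaleC)
  then have sub: "subspace (closure T)" by (rule subspace_closure)
  show "adjoint_op (adjoint_op T) \<subseteq> closure T"
  proof (rule ccontr)
    assume "\<not> ?thesis"
    then obtain x y where xy: "(x, y) \<in> adjoint_op (adjoint_op T)" "(x, y) \<notin> closure T"
      by auto
    obtain a b where ab: "\<And>s. s \<in> closure T \<Longrightarrow> inner s (a, b) = 0" "inner (x, y) (a, b) \<noteq> 0"
      using closed_subspace_orthogonal[OF sub closed_closure xy(2)] by (metis surj_pair)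
    \<comment> \<open>The separating functional is only real-linear; since the graph contains all
      complex multiples, the factors 1 and \<i> upgrade orthogonality to the complex inner
      product.\<close>
    have orth: "cinner u a + cinner v b = 0" if "(u, v) \<in> T" for u v
    proof -
      have "inner (c *\<^sub>C u) a + inner (c *\<^sub>C v) b = 0" for c
        using ab(1)[of "(c *\<^sub>C u, c *\<^sub>C v)"] scale[OF that, of c] closure_subset[of T]
        by (auto simp: inner_prod_def)
      then have *: "Re (c * (cinner u a + cinner v b)) = 0" for c
        by (simp add: inner_L2_def cinner_scaleC_left distrib_left)
      show ?thesis
        using *[of 1] *[of \<i>] by (simp add: complex_eq_iff)
    qed
    have "(b, - a) \<in> adjoint_op T"
      using orth by (auto simp: adjoint_op_def cinner_minus_right add_eq_0_iff add.commute)
    then have "cinner (- a) x = cinner b y"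
      using xy(1) by (auto simp: adjoint_op_def)
    then have "cinner x a + cinner y b = 0"
      by (metis (no_types, lifting) cinner_commute cinner_minus_left complex_cnj_minus add.left_inverse add.commute minus_minus)
    then show False using ab(2) by (simp add: inner_prod_def inner_L2_def flip: plus_complex.sel)
  qed
qed


section \<open>Gaussians and absolutely convergent Fourier integrals\<close>

definition wave :: "'a::euclidean_space \<Rightarrow> 'a \<Rightarrow> complex" where
  "wave x \<xi> = exp (\<i> * of_real (x \<bullet> \<xi>))"

definition fourier_integral :: "('a::euclidean_space \<Rightarrow> complex) \<Rightarrow> 'a \<Rightarrow> complex" where
  "fourier_integral g x = (LINT \<xi>|lborel. wave x \<xi> * g \<xi>)"

definition gauss :: "real \<Rightarrow> 'a::euclidean_space \<Rightarrow> 'a \<Rightarrow> complex" where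
  "gauss a \<eta> \<xi> = of_real (exp (- (a / 2 * (norm (\<xi> - \<eta>))\<^sup>2)))"

text \<open>Up to a constant the Fourier integral of \<open>gauss a \<eta>\<close>: translation
  becomes modulation and the width is inverted.\<close>

definition mgauss :: "real \<Rightarrow> 'a::euclidean_space \<Rightarrow> 'a \<Rightarrow> complex" where
  "mgauss a \<eta> x = wave \<eta> x * gauss (1 / a) 0 x"

text \<open>The total integral of \<open>gauss a \<eta>\<close>. The type argument supplies the
  dimension, which the parameter a does not determine.\<close>

definition gauss_const :: "'a::euclidean_space itself \<Rightarrow> real \<Rightarrow> complex" where
  "gauss_const _ a = of_real (sqrt (2 * pi / a) ^ DIM('a))"

lemma norm_wave [simp]: "cmod (wave x \<xi>) = 1"
  by (simp add: wave_def)

lemma wave_nonzero [simp]: "wave x \<xi> \<noteq> 0"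
  by (simp add: wave_def)

lemma wave_commute: "wave x \<xi> = wave \<xi> x"
  by (simp add: wave_def inner_commute)

lemma cnj_wave: "cnj (wave x \<xi>) = wave (- x) \<xi>"
  by (simp add: wave_def exp_cnj)

lemma wave_add: "wave (x + y) \<xi> = wave x \<xi> * wave y \<xi>"
  by (simp add: wave_def inner_add_left distrib_left exp_add)

lemma wave_add_right: "wave x (\<xi> + \<eta>) = wave x \<xi> * wave x \<eta>"
  by (metis wave_add wave_commute)

lemma wave_zero [simp]: "wave 0 \<xi> = 1" "wave x 0 = 1"
  by (simp_all add: wave_def)

lemma measurable_wave [measurable (raw)]:
  "f \<in> borel_measurable M \<Longrightarrow> g \<in> borel_measurable M \<Longrightarrow> (\<lambda>x. wave (f x) (g x)) \<in> borel_measurable M"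
  unfolding wave_def by measurable

lemma measurable_gauss [measurable (raw)]:
  "f \<in> borel_measurable M \<Longrightarrow> g \<in> borel_measurable M \<Longrightarrow> (\<lambda>x. gauss a (f x) (g x)) \<in> borel_measurable M"
  unfolding gauss_def by measurable

lemma measurable_mgauss [measurable]: "mgauss a \<eta> \<in> borel_measurable borel"
  unfolding mgauss_def by measurable

lemma gauss_le_1: "0 < a \<Longrightarrow> cmod (gauss a \<eta> \<xi>) \<le> 1"
  by (simp add: gauss_def)

lemma cnj_gauss [simp]: "cnj (gauss a \<eta> \<xi>) = gauss a \<eta> \<xi>"
  by (simp add: gauss_def)

lemma cnj_mgauss: "cnj (mgauss a \<eta> x) = mgauss a (- \<eta>) x"
  by (simp add: mgauss_def cnj_wave)

lemma gauss_nonzero [simp]: "gauss a \<eta> \<xi> \<noteq> 0"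
  by (simp add: gauss_def)

lemma gauss_const_nonzero [simp]: "0 < a \<Longrightarrow> gauss_const TYPE('a::euclidean_space) a \<noteq> 0"
  by (simp add: gauss_const_def)

section \<open>Fourier integrals of Gaussians\<close>

text \<open>Lebesgue measure is the image of the product measure over the basis, so integrals of
  functions with separated coordinates factor; this reduces Gaussians, and later the resolvent
  bound, to one variable.\<close>

lemma integral_prod_Basis:
  fixes f :: "'a::euclidean_space \<Rightarrow> real \<Rightarrow> complex"
  assumes f: "\<And>b. b \<in> Basis \<Longrightarrow> integrable lborel (f b)"
  shows "integrable lborel (\<lambda>x::'a. \<Prod>b\<in>Basis. f b (x \<bullet> b))" (is ?int)
    and "(LINT x|(lborel::'a measure). (\<Prod>b\<in>Basis. f b (x \<bullet> b))) = (\<Prod>b\<in>Basis. LINT t|lborel. f b t)" (is ?eq)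
proof -
  interpret product_sigma_finite "\<lambda>_::'a. lborel :: real measure" ..
  have [measurable]: "b \<in> Basis \<Longrightarrow> f b \<in> borel_measurable borel" for b
    using f by auto
  let ?T = "\<lambda>y::'a \<Rightarrow> real. \<Sum>b\<in>Basis. y b *\<^sub>R b"
  have T[measurable]: "?T \<in> (\<Pi>\<^sub>M b\<in>Basis. lborel) \<rightarrow>\<^sub>M borel" by measurable
  have m: "(\<lambda>x::'a. \<Prod>b\<in>Basis. f b (x \<bullet> b)) \<in> borel_measurable borel" by measurable
  have *: "(\<Prod>b\<in>Basis. f b (?T y \<bullet> b)) = (\<Prod>b\<in>Basis. f b (y b))" for y
    by (intro prod.cong refl) simp
  show ?int
    by (subst lborel_eq, subst integrable_distr_eq[OF T m], subst *)
      (intro product_integrable_prod f finite_Basis)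
  show ?eq
    by (subst lborel_eq, subst integral_distr[OF T m], subst *)
      (intro product_integral_prod f finite_Basis)
qed

lemma lborel_integral_affine:
  fixes f :: "'a::euclidean_space \<Rightarrow> complex"
  assumes c: "c \<noteq> 0" and [measurable]: "f \<in> borel_measurable borel"
  shows "(LINT x|lborel. f x) = of_real (\<bar>c\<bar> ^ DIM('a)) * (LINT x|lborel. f (t + c *\<^sub>R x))"
    and "integrable lborel (\<lambda>x. f (t + c *\<^sub>R x)) \<longleftrightarrow> integrable lborel f"
proof -
  have [measurable]: "(\<lambda>x. t + c *\<^sub>R x) \<in> borel_measurable lborel" by measurable
  show "(LINT x|lborel. f x) = of_real (\<bar>c\<bar> ^ DIM('a)) * (LINT x|lborel. f (t + c *\<^sub>R x))"
    by (subst lborel_affine[OF c, of t], subst integral_density)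
      (auto simp: integral_distr scaleR_conv_of_real)
  show "integrable lborel (\<lambda>x. f (t + c *\<^sub>R x)) \<longleftrightarrow> integrable lborel f"
  proof -
    have "integrable lborel f \<longleftrightarrow> integrable lborel (\<lambda>x. \<bar>c\<bar> ^ DIM('a) *\<^sub>R f (t + c *\<^sub>R x))"
      by (subst lborel_affine[OF c, of t], subst integrable_density) (auto simp: integrable_distr_eq)
    also have "\<dots> \<longleftrightarrow> integrable lborel (\<lambda>x. f (t + c *\<^sub>R x))"
    proof
      assume "integrable lborel (\<lambda>x. \<bar>c\<bar> ^ DIM('a) *\<^sub>R f (t + c *\<^sub>R x))"
      then have "integrable lborel (\<lambda>x. (1 / \<bar>c\<bar> ^ DIM('a)) *\<^sub>R (\<bar>c\<bar> ^ DIM('a) *\<^sub>R f (t + c *\<^sub>R x)))"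
        by (rule integrable_scaleR_right)
      then show "integrable lborel (\<lambda>x. f (t + c *\<^sub>R x))" using c by simp
    qed auto
    finally show ?thesis by simp
  qed
qed

text \<open>Substituting s = sqrt a turns the integral into the characteristic function of the
  standard normal distribution.\<close>

lemma integral_wave_gauss_real:
  fixes x a :: real
  assumes a: "0 < a"
  defines "g \<equiv> \<lambda>t. exp (\<i> * of_real (x * t)) * of_real (exp (- (a / 2 * t\<^sup>2)))"
  shows "integrable lborel g"
    and "(LINT t|lborel. g t) = of_real (sqrt (2 * pi / a) * exp (- (x\<^sup>2 / (2 * a))))"
proof -
  define s where "s = sqrt a"
  have s: "0 < s" "s\<^sup>2 = a" using a by (auto simp: s_def)
  have g_eq: "g t = sqrt (2 * pi) *\<^sub>R (std_normal_density (0 + s * t) *\<^sub>R iexp (x / s * (0 + s * t)))" for t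
    using s by (simp add: g_def std_normal_density_def power_mult_distrib scaleR_conv_of_real mult.commute)
  have int: "integrable lborel (\<lambda>t. std_normal_density t *\<^sub>R iexp (x / s * t))"
  proof (rule Bochner_Integration.integrable_bound)
    show "integrable lborel std_normal_density" by simp
  qed auto
  show "integrable lborel g"
    unfolding g_eq[abs_def] using s
    by (intro integrable_scaleR_right lborel_integrable_real_affine[OF int, of s 0]) auto
  have "(LINT t|lborel. std_normal_density t *\<^sub>R iexp (x / s * t)) = char std_normal_distribution (x / s)"
    unfolding char_def by (subst integral_density) auto
  also have "\<dots> = of_real (exp (- (x\<^sup>2 / (2 * a))))"
    using s by (simp add: char_std_normal_distribution power_divide mult.commute)
  finally have *: "(LINT t|lborel. std_normal_density t *\<^sub>R iexp (x / s * t)) = of_real (exp (- (x\<^sup>2 / (2 * a))))" .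
  have "(LINT t|lborel. g t) = sqrt (2 * pi) *\<^sub>R ((1 / s) *\<^sub>R
      (\<bar>s\<bar> *\<^sub>R (LINT t|lborel. std_normal_density (0 + s * t) *\<^sub>R iexp (x / s * (0 + s * t)))))"
    unfolding g_eq[abs_def] using s by (subst integral_scaleR_right) simp_all
  also have "\<dots> = sqrt (2 * pi) *\<^sub>R ((1 / s) *\<^sub>R of_real (exp (- (x\<^sup>2 / (2 * a)))))"
    using lborel_integral_real_affine[of s "\<lambda>t. std_normal_density t *\<^sub>R iexp (x / s * t)" 0] s *
    by simp
  finally show "(LINT t|lborel. g t) = of_real (sqrt (2 * pi / a) * exp (- (x\<^sup>2 / (2 * a))))"
    by (simp add: s_def real_sqrt_divide scaleR_conv_of_real)
qed

lemma fourier_integral_gauss_0: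
  fixes x :: "'a::euclidean_space"
  assumes a: "0 < a"
  shows "integrable lborel (\<lambda>\<xi>. wave x \<xi> * gauss a 0 \<xi>)"
    and "fourier_integral (gauss a 0) x = gauss_const TYPE('a) a * gauss (1 / a) 0 x"
proof -
  let ?f = "\<lambda>b t. exp (\<i> * of_real ((x \<bullet> b) * t)) * of_real (exp (- (a / 2 * t\<^sup>2)))"
  have sq: "(norm y)\<^sup>2 = (\<Sum>b\<in>Basis. (y \<bullet> b)\<^sup>2)" for y :: 'a
    unfolding power2_norm_eq_inner by (subst euclidean_inner) (simp add: power2_eq_square)
  have prod: "wave x \<xi> * gauss a 0 \<xi> = (\<Prod>b\<in>Basis. ?f b (\<xi> \<bullet> b))" for \<xi> :: 'a
    unfolding wave_def gauss_def prod.distrib of_real_prod[symmetric] exp_sum[OF finite_Basis, symmetric]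
    by (simp add: sq euclidean_inner[of x \<xi>] sum_distrib_left sum_negf)
  show "integrable lborel (\<lambda>\<xi>. wave x \<xi> * gauss a 0 \<xi>)"
    unfolding prod by (intro integral_prod_Basis(1) integral_wave_gauss_real(1) a)
  have "fourier_integral (gauss a 0) x = (\<Prod>b\<in>Basis. LINT t|lborel. ?f b t)"
    unfolding fourier_integral_def prod by (intro integral_prod_Basis(2) integral_wave_gauss_real(1) a)
  also have "\<dots> = (\<Prod>b\<in>(Basis::'a set). of_real (sqrt (2 * pi / a) * exp (- ((x \<bullet> b)\<^sup>2 / (2 * a)))))"
    by (simp only: integral_wave_gauss_real(2)[OF a])
  also have "\<dots> = gauss_const TYPE('a) a * gauss (1 / a) 0 x"
    unfolding of_real_mult prod.distrib of_real_prod[symmetric] exp_sum[OF finite_Basis, symmetric]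
    by (simp add: gauss_const_def gauss_def sq sum_negf sum_divide_distrib mult.commute[of a])
  finally show "fourier_integral (gauss a 0) x = gauss_const TYPE('a) a * gauss (1 / a) 0 x" .
qed

lemma integrable_gauss: "0 < a \<Longrightarrow> integrable lborel (gauss a \<eta>)"
  using fourier_integral_gauss_0(1)[of a 0] lborel_integral_affine(2)[of 1 "gauss a 0" "- \<eta>"]
  by (simp add: gauss_def[abs_def])

lemma integrable_mgauss: "0 < a \<Longrightarrow> integrable lborel (mgauss a \<eta>)"
  using fourier_integral_gauss_0(1)[of "1 / a" \<eta>] by (simp add: mgauss_def[abs_def])

lemma fourier_integral_gauss:
  fixes x :: "'a::euclidean_space"
  assumes a: "0 < a"
  shows "fourier_integral (gauss a \<eta>) x = gauss_const TYPE('a) a * mgauss a \<eta> x"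
proof -
  have "fourier_integral (gauss a \<eta>) x = (LINT \<xi>|lborel. wave x (\<eta> + \<xi>) * gauss a \<eta> (\<eta> + \<xi>))"
    unfolding fourier_integral_def
    using lborel_integral_affine(1)[of 1 "\<lambda>\<xi>. wave x \<xi> * gauss a \<eta> \<xi>" \<eta>] by simp
  also have "\<dots> = wave x \<eta> * fourier_integral (gauss a 0) x"
    by (simp add: fourier_integral_def wave_add_right gauss_def mult.assoc)
  finally show ?thesis
    by (simp add: fourier_integral_gauss_0(2)[OF a] mgauss_def wave_commute[of x])
qed

text \<open>The kernel has the same sign in both directions, so transforming back returns the
  reflected Gaussian; hence the centre - \<eta>.\<close>

lemma fourier_integral_mgauss:
  fixes \<xi> :: "'a::euclidean_space"
  assumes a: "0 < a"
  shows "fourier_integral (mgauss a \<eta>) \<xi> = gauss_const TYPE('a) (1 / a) * gauss a (- \<eta>) \<xi>"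
proof -
  have "fourier_integral (mgauss a \<eta>) \<xi> = fourier_integral (gauss (1 / a) 0) (\<xi> + \<eta>)"
    by (simp add: fourier_integral_def mgauss_def wave_add mult.assoc)
  also have "\<dots> = gauss_const TYPE('a) (1 / a) * gauss a (- \<eta>) \<xi>"
    using fourier_integral_gauss_0(2)[of "1 / a" "\<xi> + \<eta>"] a by (simp add: gauss_def)
  finally show ?thesis .
qed

section \<open>Exchange of integrals and the multiplication formula\<close>

text \<open>f(x) g(y) is integrable on the product and a kernel bounded by 1 preserves this. It is
  applied with a wave as kernel for duality and with a Gaussian as kernel for mollification.\<close>

lemma Fubini_bounded_kernel:
  fixes f :: "'a::euclidean_space \<Rightarrow> complex" and g :: "'b::euclidean_space \<Rightarrow> complex"
  assumes f: "integrable lborel f" and g: "integrable lborel g"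
    and B: "case_prod B \<in> borel_measurable (borel \<Otimes>\<^sub>M borel)" "\<And>x y. cmod (B x y) \<le> 1"
  shows "(LINT x|lborel. f x * (LINT y|lborel. B x y * g y)) =
         (LINT y|lborel. g y * (LINT x|lborel. B x y * f x))"
proof -
  have [measurable]: "f \<in> borel_measurable borel" "g \<in> borel_measurable borel" "case_prod B \<in> borel_measurable (borel \<Otimes>\<^sub>M borel)"
    using f g B by auto
  have Bx: "integrable lborel (\<lambda>y. B x y * g y)" for x
    by (rule Bochner_Integration.integrable_bound[OF g]) (auto intro!: mult_left_le_one_le B simp: norm_mult)
  have *: "integrable (lborel \<Otimes>\<^sub>M lborel) (\<lambda>(x, y). f x * (B x y * g y))"
  proof (rule lborel_pair.Fubini_integrable)
    show "AE x in lborel. integrable lborel (\<lambda>y. case (x, y) of (x, y) \<Rightarrow> f x * (B x y * g y))"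
      using Bx by simp
    show "integrable lborel (\<lambda>x. LINT y|lborel. cmod (case (x, y) of (x, y) \<Rightarrow> f x * (B x y * g y)))"
    proof (rule Bochner_Integration.integrable_bound)
      show "integrable lborel (\<lambda>x. cmod (f x) * (LINT y|lborel. cmod (g y)))"
        using f by simp
      have "(LINT y|lborel. cmod (B x y * g y)) \<le> (LINT y|lborel. cmod (g y))" for x
        using integrable_norm[OF Bx[of x]] g
        by (intro integral_mono) (auto intro!: mult_left_le_one_le B simp: norm_mult)
      then show "AE x in lborel. norm (LINT y|lborel. cmod (case (x, y) of (x, y) \<Rightarrow> f x * (B x y * g y)))
          \<le> norm (cmod (f x) * (LINT y|lborel. cmod (g y)))"
        by (auto simp: norm_mult[of "f _"] abs_mult intro!: mult_left_mono)
    qed measurable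
  qed measurable
  have "(LINT x|lborel. f x * (LINT y|lborel. B x y * g y)) =
      (LINT x|lborel. LINT y|lborel. f x * (B x y * g y))" by simp
  also have "\<dots> = (LINT y|lborel. LINT x|lborel. f x * (B x y * g y))"
    using lborel_pair.Fubini_integral[OF *] by simp
  also have "\<dots> = (LINT y|lborel. LINT x|lborel. g y * (B x y * f x))"
    by (simp add: mult_ac)
  finally show ?thesis by simp
qed

lemma integrable_wave_mult:
  assumes "integrable lborel g" shows "integrable lborel (\<lambda>\<xi>. wave x \<xi> * g \<xi>)"
  by (rule Bochner_Integration.integrable_bound[OF assms])
    (use assms in \<open>auto simp: norm_mult\<close>)

text \<open>Moves the transform from an arbitrary integrable function onto a Gaussian, where it is
  explicit.\<close>

lemma fourier_integral_duality:
  assumes "integrable lborel f" "integrable lborel g"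
  shows "(LINT x|lborel. f x * fourier_integral g x) = (LINT x|lborel. fourier_integral f x * g x)"
proof -
  have "(LINT x|lborel. f x * (LINT y|lborel. wave x y * g y)) =
      (LINT y|lborel. g y * (LINT x|lborel. wave x y * f x))"
    by (rule Fubini_bounded_kernel[OF assms]) (simp_all add: split_beta')
  then show ?thesis
    by (simp add: fourier_integral_def wave_commute mult.commute)
qed

lemma fourier_integral_bound:
  assumes "integrable lborel g"
  shows "cmod (fourier_integral g x) \<le> (LINT \<xi>|lborel. cmod (g \<xi>))"
  using integral_norm_bound[of lborel "\<lambda>\<xi>. wave x \<xi> * g \<xi>"]
  by (simp add: fourier_integral_def norm_mult)

lemma continuous_fourier_integral:
  assumes g: "integrable lborel g"
  shows "continuous_on UNIV (fourier_integral g)"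
  unfolding continuous_on_eq_continuous_within
proof (intro ballI)
  fix x :: 'a
  show "isCont (fourier_integral g) x"
    unfolding continuous_at_sequentially comp_def fourier_integral_def
  proof (intro allI impI)
    fix y :: "nat \<Rightarrow> 'a" assume y: "y \<longlonglongrightarrow> x"
    have [measurable]: "g \<in> borel_measurable borel" using g by auto
    show "(\<lambda>n. LINT \<xi>|lborel. wave (y n) \<xi> * g \<xi>) \<longlonglongrightarrow> (LINT \<xi>|lborel. wave x \<xi> * g \<xi>)"
    proof (rule integral_dominated_convergence)
      show "integrable lborel (\<lambda>\<xi>. cmod (g \<xi>))" using g by simp
      show "AE \<xi> in lborel. (\<lambda>n. wave (y n) \<xi> * g \<xi>) \<longlonglongrightarrow> wave x \<xi> * g \<xi>"
        unfolding wave_def by (intro AE_I2 tendsto_intros y)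
    qed (auto simp: norm_mult)
  qed
qed


subsection \<open>Functions annihilated by Gaussians\<close>

text \<open>The densities given by the positive and the negative part of r agree on boxes, which are
  stable under intersection and generate the Borel sets, so they are the same measure.\<close>

lemma AE_zero_of_box_integrals_real:
  fixes r :: "'a::euclidean_space \<Rightarrow> real"
  assumes r: "integrable lborel r" and z: "\<And>u v. (LINT x|lborel. indicator (box u v) x * r x) = 0"
  shows "AE x in lborel. r x = 0"
proof -
  have [measurable]: "r \<in> borel_measurable borel" using r by auto
  let ?P = "density lborel (\<lambda>x. ennreal (r x))" and ?N = "density lborel (\<lambda>x. ennreal (- r x))"
  have fin: "(\<integral>\<^sup>+x. ennreal (r x) \<partial>lborel) < \<infinity>" "(\<integral>\<^sup>+x. ennreal (- r x) \<partial>lborel) < \<infinity>"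
    using integrableD(2,3)[OF r] by (auto simp: less_top)
  have "?P = ?N"
  proof (rule measure_eqI_generator_eq)
    let ?E = "range (\<lambda>(a, b). box a b::'a set)"
    show "Int_stable ?E" by (auto simp: Int_stable_def box_Int_box)
    show "?E \<subseteq> Pow UNIV" "sets ?P = sigma_sets UNIV ?E" "sets ?N = sigma_sets UNIV ?E"
      by (simp_all add: borel_eq_box)
    let ?A = "\<lambda>n::nat. box (- (real n *\<^sub>R One)) (real n *\<^sub>R One) :: 'a set"
    show "range ?A \<subseteq> ?E" "(\<Union>i. ?A i) = UNIV"
      unfolding UN_box_eq_UNIV by auto
    have le: "emeasure ?P X \<le> (\<integral>\<^sup>+x. ennreal (r x) \<partial>lborel)" "emeasure ?N X \<le> (\<integral>\<^sup>+x. ennreal (- r x) \<partial>lborel)"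
      if "X \<in> sets borel" for X
      using that by (auto simp: emeasure_density intro!: nn_integral_mono split: split_indicator)
    show "emeasure ?P (?A i) \<noteq> \<infinity>" for i
      using le(1)[of "?A i"] fin(1) by (auto simp: less_top[symmetric] top_unique)
    show "emeasure ?P X = emeasure ?N X" if "X \<in> ?E" for X
    proof -
      obtain u v where X: "X = box u v" using \<open>X \<in> ?E\<close> by auto
      let ?f = "\<lambda>x. indicator X x * r x"
      have i: "integrable lborel ?f"
        using integrable_mult_indicator[OF _ r, of X] by (simp add: X)
      have P: "emeasure ?P X = (\<integral>\<^sup>+x. ennreal (?f x) \<partial>lborel)"
        by (auto simp: X emeasure_density intro!: nn_integral_cong split: split_indicator)
      have N: "emeasure ?N X = (\<integral>\<^sup>+x. ennreal (- ?f x) \<partial>lborel)"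
        by (auto simp: X emeasure_density intro!: nn_integral_cong split: split_indicator)
      have "enn2real (emeasure ?P X) - enn2real (emeasure ?N X) = 0"
        unfolding P N using real_lebesgue_integral_def[OF i] z[of u v] by (simp add: X)
      moreover have "emeasure ?P X \<noteq> \<infinity>" "emeasure ?N X \<noteq> \<infinity>"
        using le[of X] fin by (auto simp: X less_top[symmetric] top_unique)
      ultimately show ?thesis
        by (metis eq_iff_diff_eq_0 ennreal_enn2real less_top infinity_ennreal_def)
    qed
  qed
  \<comment> \<open>\<open>ennreal\<close> truncates negative reals to 0, so one of the two sides
    vanishes at each point and equality forces r x = 0.\<close>
  then have "AE x in lborel. ennreal (r x) = ennreal (- r x)"
    by (intro sigma_finite_measure.density_unique[OF sigma_finite_lborel]) auto
  then show ?thesis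
  proof eventually_elim
    case (elim x)
    then show ?case
      by (cases "0 \<le> r x") (auto simp: ennreal_neg ennreal_eq_0_iff dest: sym)
  qed
qed

lemma AE_zero_of_box_integrals:
  fixes k :: "'a::euclidean_space \<Rightarrow> complex"
  assumes k: "integrable lborel k" and z: "\<And>u v. (LINT x|lborel. indicator (box u v) x * k x) = 0"
  shows "AE x in lborel. k x = 0"
proof -
  have i: "integrable lborel (\<lambda>x. indicator (box u v) x * k x)" for u v
  proof -
    have "integrable lborel (\<lambda>x. indicator (box u v) x *\<^sub>R k x)"
      using k by (intro integrable_mult_indicator) auto
    moreover have "indicator (box u v) x *\<^sub>R k x = indicator (box u v) x * k x" for x
      by (simp split: split_indicator)
    ultimately show ?thesis by simp
  qed
  have re: "(LINT x|lborel. indicator (box u v) x * Re (k x)) = 0" for u v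
  proof -
    have "(LINT x|lborel. indicator (box u v) x * Re (k x)) = (LINT x|lborel. Re (indicator (box u v) x * k x))"
      by (intro Bochner_Integration.integral_cong) (auto split: split_indicator)
    also have "\<dots> = 0" by (simp only: integral_Re[OF i] z zero_complex.sel)
    finally show ?thesis .
  qed
  have im: "(LINT x|lborel. indicator (box u v) x * Im (k x)) = 0" for u v
  proof -
    have "(LINT x|lborel. indicator (box u v) x * Im (k x)) = (LINT x|lborel. Im (indicator (box u v) x * k x))"
      by (intro Bochner_Integration.integral_cong) (auto split: split_indicator)
    also have "\<dots> = 0" by (simp only: integral_Im[OF i] z zero_complex.sel)
    finally show ?thesis .
  qed
  have "AE x in lborel. Re (k x) = 0" "AE x in lborel. Im (k x) = 0"
    using re im k by (auto intro!: AE_zero_of_box_integrals_real)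
  then show ?thesis by eventually_elim (simp add: complex_eq_iff)
qed

text \<open>Off this null set the indicator of the box is locally constant, which is what makes its
  mollifications converge pointwise.\<close>

lemma AE_box_eq_cbox: "AE x in lborel. x \<in> cbox u v \<longrightarrow> x \<in> box u (v :: 'a::euclidean_space)"
proof (rule AE_I')
  have "emeasure lborel (cbox u v - box u v) = 0"
    by (subst emeasure_Diff) (auto simp: box_subset_cbox emeasure_lborel_cbox_eq emeasure_lborel_box_eq)
  then show "cbox u v - box u v \<in> null_sets lborel" by auto
qed auto

text \<open>Mollifying the indicator of a box by Gaussians reduces the claim to integrals over boxes.\<close>
lemma integrable_gauss_separating:
  fixes k :: "'a::euclidean_space \<Rightarrow> complex"
  assumes k: "integrable lborel k"
    and z: "\<And>a \<eta>. 0 < a \<Longrightarrow> (LINT \<xi>|lborel. k \<xi> * gauss a \<eta> \<xi>) = 0"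
  shows "AE \<xi> in lborel. k \<xi> = 0"
proof (rule AE_zero_of_box_integrals[OF k])
  fix u v :: 'a
  have [measurable]: "k \<in> borel_measurable borel" using k by auto
  define I :: "'a \<Rightarrow> complex" where "I = indicator (box u v)"
  have [measurable]: "I \<in> borel_measurable borel" unfolding I_def by measurable
  have I1: "cmod (I x) \<le> 1" for x by (simp add: I_def indicator_def)
  have iI: "integrable lborel I"
  proof -
    have "integrable lborel (\<lambda>x. indicator (box u v) x *\<^sub>R (1 :: complex))"
      using emeasure_lborel_box_finite[of u v] by (intro integrable_indicator) auto
    moreover have "indicator (box u v) x *\<^sub>R (1 :: complex) = I x" for x
      by (simp add: I_def split: split_indicator)
    ultimately show ?thesis by simp
  qed
  define s where "s n = 1 / sqrt (real (Suc n))" for n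
  have s: "0 < s n" for n by (simp add: s_def)
  have s0: "s \<longlonglongrightarrow> 0"
    using tendsto_real_sqrt[OF LIMSEQ_inverse_real_of_nat]
    by (simp add: s_def[abs_def] inverse_eq_divide real_sqrt_divide)
  \<comment> \<open>The box indicator convolved with a Gaussian of standard deviation
    \<open>s n\<close>, not normalized, after the substitution \<eta> = \<xi> + s n t: the limit can
    be taken under the integral, and the original form only contains Gaussians of parameter 1 / (s
    n)^2.\<close>
  define Q where "Q n \<xi> = (LINT t|lborel. I (\<xi> + s n *\<^sub>R t) * gauss 1 0 t)" for n \<xi>
  have [measurable]: "Q n \<in> borel_measurable borel" for n
    unfolding Q_def by measurable
  define C where "C = (LINT t|lborel. gauss 1 (0::'a) t)"
  have C: "C = gauss_const TYPE('a) 1"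
    using fourier_integral_gauss_0(2)[of 1 "0::'a"] by (simp add: C_def fourier_integral_def gauss_def)
  have iG: "integrable lborel (\<lambda>t. cmod (gauss 1 (0::'a) t))"
    by (intro integrable_norm integrable_gauss) simp
  have bnd: "cmod (Q n \<xi>) \<le> (LINT t|lborel. cmod (gauss 1 (0::'a) t))" for n \<xi>
    unfolding Q_def
    by (rule order_trans[OF integral_norm_bound], rule integral_mono')
      (auto intro!: iG mult_left_le_one_le I1 simp: norm_mult)
  have "(LINT \<xi>|lborel. k \<xi> * Q n \<xi>) = 0" for n
  proof -
    have "Q n \<xi> * s n ^ DIM('a) = (LINT \<eta>|lborel. gauss (1 / (s n)\<^sup>2) \<eta> \<xi> * I \<eta>)" for \<xi>
      using lborel_integral_affine(1)[of "s n" "\<lambda>\<eta>. gauss (1 / (s n)\<^sup>2) \<eta> \<xi> * I \<eta>" \<xi>] s[of n]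
      by (simp add: Q_def gauss_def power_mult_distrib mult.commute)
    then have "(LINT \<xi>|lborel. k \<xi> * Q n \<xi>) * s n ^ DIM('a) =
        (LINT \<xi>|lborel. k \<xi> * (LINT \<eta>|lborel. gauss (1 / (s n)\<^sup>2) \<eta> \<xi> * I \<eta>))"
      by (simp add: mult.assoc flip: integral_mult_left_zero)
    also have "\<dots> = (LINT \<eta>|lborel. I \<eta> * (LINT \<xi>|lborel. gauss (1 / (s n)\<^sup>2) \<eta> \<xi> * k \<xi>))"
      using s[of n] by (intro Fubini_bounded_kernel k iI gauss_le_1) auto
    also have "\<dots> = 0" using z[of "1 / (s n)\<^sup>2"] s[of n] by (simp add: mult.commute)
    finally show ?thesis using s[of n] by simp
  qed
  moreover have "(\<lambda>n. LINT \<xi>|lborel. k \<xi> * Q n \<xi>) \<longlonglongrightarrow> (LINT \<xi>|lborel. k \<xi> * (I \<xi> * C))"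
  proof (rule integral_dominated_convergence)
    show "integrable lborel (\<lambda>\<xi>. cmod (k \<xi>) * (LINT t|lborel. cmod (gauss 1 (0::'a) t)))"
      using k by simp
    show "AE \<xi> in lborel. cmod (k \<xi> * Q n \<xi>) \<le> cmod (k \<xi>) * (LINT t|lborel. cmod (gauss 1 (0::'a) t))" for n
      by (auto simp: norm_mult intro!: mult_left_mono bnd)
    show "AE \<xi> in lborel. (\<lambda>n. k \<xi> * Q n \<xi>) \<longlonglongrightarrow> k \<xi> * (I \<xi> * C)"
      using AE_box_eq_cbox[of u v]
    proof eventually_elim
      case (elim \<xi>)
      have "(\<lambda>n. Q n \<xi>) \<longlonglongrightarrow> (LINT t|lborel. I \<xi> * gauss 1 (0::'a) t)"
        unfolding Q_def
      proof (rule integral_dominated_convergence[OF _ _ iG])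
        show "AE t in lborel. (\<lambda>n. I (\<xi> + s n *\<^sub>R t) * gauss 1 0 t) \<longlonglongrightarrow> I \<xi> * gauss 1 0 t"
        proof (intro AE_I2 tendsto_mult tendsto_const)
          fix t :: 'a
          have lim: "(\<lambda>n. \<xi> + s n *\<^sub>R t) \<longlonglongrightarrow> \<xi>"
            using tendsto_add[OF tendsto_const[of \<xi>] tendsto_scaleR[OF s0 tendsto_const[of t]]] by simp
          have "\<forall>\<^sub>F n in sequentially. I (\<xi> + s n *\<^sub>R t) = I \<xi>"
          proof (cases "\<xi> \<in> box u v")
            case True
            then show ?thesis
              using eventually_mono[OF topological_tendstoD[OF lim open_box True]] by (simp add: I_def)
          next
            case False
            then have "\<xi> \<in> - cbox u v" using elim by auto
            with lim have "\<forall>\<^sub>F n in sequentially. \<xi> + s n *\<^sub>R t \<in> - cbox u v"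
              by (intro topological_tendstoD[of _ \<xi>]) (auto intro: closed_cbox)
            then show ?thesis
            proof (rule eventually_mono)
              fix n assume "\<xi> + s n *\<^sub>R t \<in> - cbox u v"
              then have "\<xi> + s n *\<^sub>R t \<notin> box u v" using box_subset_cbox by blast
              then show "I (\<xi> + s n *\<^sub>R t) = I \<xi>" using False by (simp add: I_def)
            qed
          qed
          then show "(\<lambda>n. I (\<xi> + s n *\<^sub>R t)) \<longlonglongrightarrow> I \<xi>" by (rule tendsto_eventually)
        qed
      qed (auto simp: norm_mult intro!: mult_left_le_one_le I1)
      then show ?case by (intro tendsto_mult tendsto_const) (simp add: C_def)
    qed
  qed measurable
  ultimately have "(LINT \<xi>|lborel. k \<xi> * (I \<xi> * C)) = 0"
    by (simp add: LIMSEQ_const_iff)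
  moreover have "k \<xi> * (I \<xi> * C) = C * (indicator (box u v) \<xi> * k \<xi>)" for \<xi>
    by (simp add: I_def)
  ultimately have "C * (LINT \<xi>|lborel. indicator (box u v) \<xi> * k \<xi>) = 0"
    by simp
  then show "(LINT \<xi>|lborel. indicator (box u v) \<xi> * k \<xi>) = 0"
    using C by simp
qed

text \<open>Completing the square: the parameters 1 and a add up, and the new centre is the weighted
  mean of 0 and \<eta>.\<close>

lemma gauss_mult_gauss:
  fixes \<xi> :: "'a::euclidean_space"
  assumes "0 < a"
  obtains c where "\<And>\<xi>. gauss 1 0 \<xi> * gauss a \<eta> \<xi> = c * gauss (a + 1) ((a / (a + 1)) *\<^sub>R \<eta>) (\<xi> :: 'a)"
proof
  fix \<xi> :: 'a
  define b where "b = a / (a + 1)"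
  have b: "(a + 1) * b = a" using assms by (simp add: b_def)
  have "(a + 1) * (norm (\<xi> - b *\<^sub>R \<eta>))\<^sup>2 =
      (a + 1) * inner \<xi> \<xi> - 2 * ((a + 1) * b) * inner \<xi> \<eta> + ((a + 1) * b) * b * inner \<eta> \<eta>"
    unfolding power2_norm_eq_inner by (simp add: inner_simps inner_commute algebra_simps)
  also have "\<dots> = inner \<xi> \<xi> + a * (norm (\<xi> - \<eta>))\<^sup>2 - ((a + 1) * b) * inner \<eta> \<eta> + a * b * inner \<eta> \<eta>"
    unfolding b power2_norm_eq_inner by (simp add: inner_simps inner_commute algebra_simps)
  finally have "- (1 / 2 * (norm \<xi>)\<^sup>2) + - (a / 2 * (norm (\<xi> - \<eta>))\<^sup>2) =
      - (b * (norm \<eta>)\<^sup>2 / 2) + - ((a + 1) / 2 * (norm (\<xi> - b *\<^sub>R \<eta>))\<^sup>2)"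
    unfolding power2_norm_eq_inner[of \<xi>] power2_norm_eq_inner[of \<eta>]
    by (simp add: algebra_simps flip: add_divide_distrib)
  note this[unfolded b_def]
  then show "gauss 1 0 \<xi> * gauss a \<eta> \<xi> =
      of_real (exp (- (a / (a + 1) * (norm \<eta>)\<^sup>2 / 2))) * gauss (a + 1) ((a / (a + 1)) *\<^sub>R \<eta>) \<xi>"
    unfolding gauss_def of_real_mult[symmetric] exp_add[symmetric] by simp
qed

text \<open>K itself need not be integrable. The weight \<open>gauss 1 0\<close> makes it so, and
  absorbing the weight into a test Gaussian yields another Gaussian, for which the hypothesis
  holds.\<close>

lemma gauss_separating:
  fixes K :: "'a::euclidean_space \<Rightarrow> complex"
  assumes i: "integrable lborel (\<lambda>\<xi>. K \<xi> * gauss 1 0 \<xi>)"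
    and z: "\<And>a \<eta>. 0 < a \<Longrightarrow> (LINT \<xi>|lborel. K \<xi> * gauss a \<eta> \<xi>) = 0"
  shows "AE \<xi> in lborel. K \<xi> = 0"
proof -
  have "AE \<xi> in lborel. K \<xi> * gauss 1 0 \<xi> = 0"
  proof (rule integrable_gauss_separating[OF i])
    fix a \<eta> assume a: "0 < (a::real)"
    obtain c where c: "\<And>\<xi>. gauss 1 0 \<xi> * gauss a \<eta> \<xi> = c * gauss (a + 1) ((a / (a + 1)) *\<^sub>R \<eta>) (\<xi> :: 'a)"
      using gauss_mult_gauss[OF a] by blast
    have "(LINT \<xi>|lborel. K \<xi> * gauss 1 0 \<xi> * gauss a \<eta> \<xi>) =
        (LINT \<xi>|lborel. c * (K \<xi> * gauss (a + 1) ((a / (a + 1)) *\<^sub>R \<eta>) \<xi>))"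
      by (simp add: mult.assoc c mult.left_commute)
    then show "(LINT \<xi>|lborel. K \<xi> * gauss 1 0 \<xi> * gauss a \<eta> \<xi>) = 0"
      using z[of "a + 1"] a by simp
  qed
  then show ?thesis by eventually_elim simp
qed

text \<open>The case a = 1 of the hypothesis says that the Fourier integral of the weighted K
  vanishes identically; by duality the weighted K is then annihilated by all unmodulated
  Gaussians.\<close>

lemma mgauss_separating:
  fixes K :: "'a::euclidean_space \<Rightarrow> complex"
  assumes i: "integrable lborel (\<lambda>x. K x * gauss 1 0 x)"
    and z: "\<And>a \<eta>. 0 < a \<Longrightarrow> (LINT x|lborel. K x * cnj (mgauss a \<eta> x)) = 0"
  shows "AE x in lborel. K x = 0"
proof -
  have FI: "fourier_integral (\<lambda>x. K x * gauss 1 0 x) \<eta> = 0" for \<eta>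
    using z[of 1 "- \<eta>"] by (simp add: fourier_integral_def mgauss_def cnj_wave mult_ac)
  have "AE x in lborel. K x * gauss 1 0 x = 0"
  proof (rule integrable_gauss_separating[OF i])
    fix a :: real and \<eta> :: 'a assume a: "0 < a"
    have "(LINT x|lborel. K x * gauss 1 0 x * fourier_integral (mgauss a (- \<eta>)) x) = 0"
      using fourier_integral_duality[OF i integrable_mgauss[OF a]] by (simp add: FI)
    then show "(LINT x|lborel. K x * gauss 1 0 x * gauss a \<eta> x) = 0"
      using a by (simp add: fourier_integral_mgauss mult.left_commute)
  qed
  then show ?thesis by eventually_elim simp
qed


section \<open>Plancherel's theorem\<close>

lemma square_integrable_of_bounded:
  assumes f: "integrable lborel f" and B: "\<And>x. cmod (f x) \<le> B"
  shows "square_integrable f"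
  unfolding square_integrable_def
proof
  have [measurable]: "f \<in> borel_measurable borel" using f by auto
  show "integrable lborel (\<lambda>x. (cmod (f x))\<^sup>2)"
  proof (rule Bochner_Integration.integrable_bound)
    show "integrable lborel (\<lambda>x. B * cmod (f x))" using f by simp
    show "AE x in lborel. norm ((cmod (f x))\<^sup>2) \<le> norm (B * cmod (f x))"
    proof (rule AE_I2)
      fix x
      have "(cmod (f x))\<^sup>2 \<le> B * cmod (f x)"
        unfolding power2_eq_square by (intro mult_right_mono B) simp
      then show "norm ((cmod (f x))\<^sup>2) \<le> norm (B * cmod (f x))" by simp
    qed
  qed measurable
qed (use f in auto)

lemma integrable_bounded_mult:
  fixes f g :: "'a::euclidean_space \<Rightarrow> complex"
  assumes g: "integrable lborel g" and f: "f \<in> borel_measurable borel" "\<And>x. cmod (f x) \<le> B"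
  shows "integrable lborel (\<lambda>x. f x * g x)"
proof (rule Bochner_Integration.integrable_bound)
  show "integrable lborel (\<lambda>x. of_real B * g x)" using g by simp
  show "(\<lambda>x. f x * g x) \<in> borel_measurable lborel" using f g by measurable
  have "0 \<le> B" using f(2) norm_ge_zero order_trans by blast
  then show "AE x in lborel. norm (f x * g x) \<le> norm (of_real B * g x)"
    by (auto simp: norm_mult intro!: mult_right_mono f)
qed

lemma square_integrable_gauss: "0 < a \<Longrightarrow> square_integrable (gauss a \<eta>)"
  by (rule square_integrable_of_bounded[OF integrable_gauss gauss_le_1])

lemma square_integrable_mgauss: "0 < a \<Longrightarrow> square_integrable (mgauss a \<eta>)"
  by (rule square_integrable_of_bounded[OF integrable_mgauss, where B=1])
    (auto simp: mgauss_def norm_mult gauss_le_1)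

text \<open>The defect of isometry: with this normalization the inverse transform divides squared L2
  norms by this number.\<close>

definition fourier_norm :: "'a::euclidean_space itself \<Rightarrow> real" where
  "fourier_norm _ = (2 * pi) ^ DIM('a)"

lemma fourier_norm_pos [simp]: "0 < fourier_norm TYPE('a::euclidean_space)"
  by (simp add: fourier_norm_def)

lemma fourier_norm_nonzero [simp]: "fourier_norm TYPE('a::euclidean_space) \<noteq> 0"
  using fourier_norm_pos[where 'a='a] by linarith

lemma gauss_const_mult:
  assumes "0 < a"
  shows "gauss_const TYPE('a::euclidean_space) a * gauss_const TYPE('a) (1 / a) = of_real (fourier_norm TYPE('a))"
proof -
  have "sqrt (2 * pi / a) * sqrt (2 * pi * a) = 2 * pi"
  proof -
    have "sqrt (2 * pi / a) * sqrt (2 * pi * a) = sqrt ((2 * pi)\<^sup>2)"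
      using assms unfolding real_sqrt_mult[symmetric] by (simp add: power2_eq_square)
    also have "\<dots> = 2 * pi" by (rule real_sqrt_unique) auto
    finally show ?thesis .
  qed
  then show ?thesis
    unfolding gauss_const_def fourier_norm_def of_real_mult[symmetric] power_mult_distrib[symmetric]
    by simp
qed

text \<open>
  The relation ``\<open>u\<close> is the inverse Fourier transform of \<open>g\<close>'', tested against Gaussians; it makes
  sense without any integrability beyond \<open>L\<^sup>2\<close>.
\<close>
definition fourier_pair :: "'a::euclidean_space L2 \<Rightarrow> 'a L2 \<Rightarrow> bool" where
  "fourier_pair g u \<longleftrightarrow> (\<forall>a \<eta>. 0 < a \<longrightarrow>
     cinner u (to_L2 (mgauss a \<eta>)) =
       gauss_const TYPE('a) (1 / a) / of_real (fourier_norm TYPE('a)) * cinner g (to_L2 (gauss a \<eta>)))"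

lemma fourier_pair_add: "fourier_pair g u \<Longrightarrow> fourier_pair h v \<Longrightarrow> fourier_pair (g + h) (u + v)"
  by (simp add: fourier_pair_def cinner_simps distrib_left)

lemma fourier_pair_scaleC: "fourier_pair g u \<Longrightarrow> fourier_pair (c *\<^sub>C g) (c *\<^sub>C u)"
  by (simp add: fourier_pair_def cinner_simps)

lemma fourier_pair_diff: "fourier_pair g u \<Longrightarrow> fourier_pair h v \<Longrightarrow> fourier_pair (g - h) (u - v)"
  by (simp add: fourier_pair_def cinner_simps right_diff_distrib)

text \<open>Both sides of the defining identity are continuous in L2. Transforms of limits are
  identified through this closedness.\<close>

lemma fourier_pair_tendsto:
  assumes "\<And>n. fourier_pair (g n) (u n)" "g \<longlonglongrightarrow> g'" "u \<longlonglongrightarrow> u'"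
  shows "fourier_pair g' u'"
  unfolding fourier_pair_def
proof (intro allI impI)
  fix a :: real and \<eta> :: 'a assume a: "0 < a"
  let ?c = "gauss_const TYPE('a) (1 / a) / of_real (fourier_norm TYPE('a))"
  have "(\<lambda>n. cinner (u n) (to_L2 (mgauss a \<eta>))) \<longlonglongrightarrow> cinner u' (to_L2 (mgauss a \<eta>))"
    by (intro tendsto_cinner assms tendsto_const)
  moreover have "(\<lambda>n. ?c * cinner (g n) (to_L2 (gauss a \<eta>))) \<longlonglongrightarrow> ?c * cinner g' (to_L2 (gauss a \<eta>))"
    by (intro tendsto_mult tendsto_cinner assms tendsto_const)
  moreover have "cinner (u n) (to_L2 (mgauss a \<eta>)) = ?c * cinner (g n) (to_L2 (gauss a \<eta>))" for n
    using assms(1) a by (simp add: fourier_pair_def)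
  ultimately show "cinner u' (to_L2 (mgauss a \<eta>)) = ?c * cinner g' (to_L2 (gauss a \<eta>))"
    using LIMSEQ_unique by auto
qed

lemma gauss_complete:
  assumes "\<And>a \<eta>. 0 < a \<Longrightarrow> cinner g (to_L2 (gauss a \<eta>)) = 0"
  shows "g = 0"
proof -
  obtain k where k: "square_integrable k" "g = to_L2 k" by (rule L2_cases)
  have "AE \<xi> in lborel. k \<xi> = 0"
  proof (rule gauss_separating)
    show "integrable lborel (\<lambda>\<xi>. k \<xi> * gauss 1 0 \<xi>)"
      by (intro square_integrable_mult k square_integrable_gauss) simp
    show "(LINT \<xi>|lborel. k \<xi> * gauss a \<eta> \<xi>) = 0" if "0 < a" for a \<eta>
      using assms[OF that, of \<eta>] k that by (simp add: cinner_to_L2 square_integrable_gauss)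
  qed
  then show ?thesis
    using k by (simp add: to_L2_eq_iff square_integrable_zero flip: to_L2_zero)
qed

lemma mgauss_complete:
  assumes "\<And>a \<eta>. 0 < a \<Longrightarrow> cinner g (to_L2 (mgauss a \<eta>)) = 0"
  shows "g = 0"
proof -
  obtain k where k: "square_integrable k" "g = to_L2 k" by (rule L2_cases)
  have "AE \<xi> in lborel. k \<xi> = 0"
  proof (rule mgauss_separating)
    show "integrable lborel (\<lambda>\<xi>. k \<xi> * gauss 1 0 \<xi>)"
      by (intro square_integrable_mult k square_integrable_gauss) simp
    show "(LINT \<xi>|lborel. k \<xi> * cnj (mgauss a \<eta> \<xi>)) = 0" if "0 < a" for a \<eta>
      using assms[OF that, of \<eta>] k that by (simp add: cinner_to_L2 square_integrable_mgauss)
  qed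
  then show ?thesis
    using k by (simp add: to_L2_eq_iff square_integrable_zero flip: to_L2_zero)
qed

lemma fourier_pair_unique: "fourier_pair g u \<Longrightarrow> fourier_pair g v \<Longrightarrow> u = v"
  using mgauss_complete[of "u - v"] by (simp add: fourier_pair_def cinner_simps)

lemma fourier_pair_unique_left: "fourier_pair g u \<Longrightarrow> fourier_pair h u \<Longrightarrow> g = h"
  using gauss_complete[of "g - h"] by (simp add: fourier_pair_def cinner_simps gauss_const_def)

text \<open>Origin of the constant in \<open>fourier_pair\<close>: duality moves the transform onto
  the conjugated modulated Gaussian, whose transform is a multiple of
  \<open>gauss a \<eta>\<close>.\<close>

lemma fourier_integral_mgauss_pairing:
  assumes g: "integrable lborel g" and a: "0 < a"
  shows "(LINT x|lborel. fourier_integral g x * cnj (mgauss a \<eta> x)) =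
    gauss_const TYPE('a::euclidean_space) (1 / a) * (LINT \<xi>|lborel. g \<xi> * gauss a \<eta> (\<xi> :: 'a))"
proof -
  have "(LINT x|lborel. fourier_integral g x * cnj (mgauss a \<eta> x)) =
      (LINT \<xi>|lborel. g \<xi> * fourier_integral (mgauss a (- \<eta>)) \<xi>)"
    using fourier_integral_duality[OF g integrable_mgauss[OF a]] by (simp add: cnj_mgauss)
  also have "\<dots> = (LINT \<xi>|lborel. gauss_const TYPE('a) (1 / a) * (g \<xi> * gauss a \<eta> \<xi>))"
    using a by (simp add: fourier_integral_mgauss mult.left_commute)
  finally show ?thesis by simp
qed

lemma fourier_pair_fourier_integral:
  fixes g :: "'a::euclidean_space \<Rightarrow> complex"
  assumes g: "integrable lborel g" "square_integrable g"
    and u: "square_integrable (\<lambda>x. fourier_integral g x / of_real (fourier_norm TYPE('a)))"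
  shows "fourier_pair (to_L2 g) (to_L2 (\<lambda>x. fourier_integral g x / of_real (fourier_norm TYPE('a))))"
  unfolding fourier_pair_def
  using fourier_integral_mgauss_pairing[OF g(1)]
  by (simp add: cinner_to_L2 g u square_integrable_gauss square_integrable_mgauss)

text \<open>The Fourier integral is not yet known to be square integrable, only bounded. The
  difference of an L2 function and a bounded function is integrable against a Gaussian, which is
  enough for \<open>mgauss_separating\<close>.\<close>

lemma AE_eq_fourier_integral:
  fixes g :: "'a::euclidean_space \<Rightarrow> complex"
  assumes g: "integrable lborel g" "square_integrable g"
    and u: "square_integrable u" "fourier_pair (to_L2 g) (to_L2 u)"
  shows "AE x in lborel. u x = fourier_integral g x / of_real (fourier_norm TYPE('a))"
proof -
  let ?N = "complex_of_real (fourier_norm TYPE('a))"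
  have [measurable]: "fourier_integral g \<in> borel_measurable borel"
    by (intro borel_measurable_continuous_onI continuous_fourier_integral g)
  have i: "integrable lborel (\<lambda>x. fourier_integral g x * h x)" if "integrable lborel h" for h
    by (rule integrable_bounded_mult[OF that _ fourier_integral_bound[OF g(1)]]) measurable
  have i': "integrable lborel (\<lambda>x. fourier_integral g x / ?N * h x)" if "integrable lborel h" for h
    using i[OF that] by simp
  have "AE x in lborel. u x - fourier_integral g x / ?N = 0"
  proof (rule mgauss_separating)
    show "integrable lborel (\<lambda>x. (u x - fourier_integral g x / ?N) * gauss 1 0 x)"
      unfolding left_diff_distrib
      by (intro Bochner_Integration.integrable_diff i' integrable_gauss square_integrable_mult u square_integrable_gauss) auto
    fix a :: real and \<eta> :: 'a assume a: "0 < a"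
    have ic: "integrable lborel (\<lambda>x. cnj (mgauss a \<eta> x))"
      using integrable_mgauss[OF a] by (simp add: cnj_mgauss)
    have "(LINT x|lborel. (u x - fourier_integral g x / ?N) * cnj (mgauss a \<eta> x)) =
       (LINT x|lborel. u x * cnj (mgauss a \<eta> x)) - (LINT x|lborel. fourier_integral g x / ?N * cnj (mgauss a \<eta> x))"
      unfolding left_diff_distrib
      by (intro Bochner_Integration.integral_diff square_integrable_mult_cnj i' ic u square_integrable_mgauss a)
    also have "\<dots> = 0"
      using u(2) fourier_integral_mgauss_pairing[OF g(1) a, of \<eta>] a
      by (simp add: fourier_pair_def cinner_to_L2 g u square_integrable_gauss square_integrable_mgauss)
    finally show "(LINT x|lborel. (u x - fourier_integral g x / ?N) * cnj (mgauss a \<eta> x)) = 0" .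
  qed
  then show ?thesis by simp
qed

section \<open>Existence and isometry of the L2 transform\<close>

lemma dense_of_no_orthogonal:
  fixes S :: "'a::{real_inner, complete_space} set"
  assumes "subspace S" "\<And>w. (\<And>s. s \<in> S \<Longrightarrow> inner s w = 0) \<Longrightarrow> w = 0"
  shows "closure S = UNIV"
proof (rule ccontr)
  assume "closure S \<noteq> UNIV"
  then obtain x where x: "x \<notin> closure S" by auto
  obtain w where "\<And>s. s \<in> closure S \<Longrightarrow> inner s w = 0" "inner x w \<noteq> 0"
    using closed_subspace_orthogonal[OF subspace_closure[OF assms(1)] closed_closure x] by metis
  then show False
    using assms(2)[of w] closure_subset[of S] by (metis inner_zero_right subsetD)
qed

text \<open>Density is decided with the real inner product of the class, completeness of the
  Gaussians with the complex one; the multiples by 1 and \<i> mediate.\<close>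

lemma inner_all_multiples_zero:
  assumes "\<And>c. inner (c *\<^sub>C u) w = 0" shows "cinner w u = 0"
proof -
  have *: "Re (c * cinner u w) = 0" for c
    using assms[of c] by (simp add: inner_L2_def cinner_simps)
  have "cinner u w = 0" using *[of 1] *[of \<i>] by (simp add: complex_eq_iff)
  then show ?thesis using cinner_commute[of w u] by simp
qed

text \<open>
  On the span of the Gaussians the transform is isometric by explicit computation; density and
  completeness do the rest.
\<close>
lemma fourier_pair_exists:
  fixes g :: "'a::euclidean_space L2"
  shows "\<exists>u. fourier_pair g u \<and> (norm u)\<^sup>2 = (norm g)\<^sup>2 / fourier_norm TYPE('a)"
proof -
  define N where "N = fourier_norm TYPE('a)"
  have N: "0 < N" by (simp add: N_def)
  define \<Gamma> where "\<Gamma> a \<eta> = (gauss_const TYPE('a) a / of_real N) *\<^sub>C to_L2 (mgauss a (\<eta> :: 'a))" for a \<eta>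
  \<comment> \<open>Taking the span of pairs, rather than extending a map from the span of the
    Gaussians, avoids showing separately that such a map is well defined.\<close>
  define G where "G = {(c *\<^sub>C to_L2 (gauss a \<eta>), c *\<^sub>C \<Gamma> a \<eta>) |c a (\<eta> :: 'a). 0 < a}"
  have \<Gamma>_eq: "\<Gamma> a \<eta> = to_L2 (\<lambda>x. fourier_integral (gauss a \<eta>) x / of_real N)"
    and sq: "square_integrable (\<lambda>x. fourier_integral (gauss a \<eta>) x / of_real N)" if "0 < a" for a \<eta>
  proof -
    have *: "(\<lambda>x. fourier_integral (gauss a \<eta>) x / of_real N) =
        (\<lambda>x. gauss_const TYPE('a) a / of_real N * mgauss a \<eta> x)"
      by (simp add: fourier_integral_gauss[OF that])
    show "\<Gamma> a \<eta> = to_L2 (\<lambda>x. fourier_integral (gauss a \<eta>) x / of_real N)"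
      unfolding * \<Gamma>_def using that by (intro to_L2_scale[symmetric] square_integrable_mgauss)
    show "square_integrable (\<lambda>x. fourier_integral (gauss a \<eta>) x / of_real N)"
      unfolding * using that by (intro square_integrable_scale square_integrable_mgauss)
  qed
  have pair\<Gamma>: "fourier_pair (to_L2 (gauss a \<eta>)) (\<Gamma> a \<eta>)" if "0 < a" for a and \<eta> :: 'a
    using fourier_pair_fourier_integral[OF integrable_gauss[OF that] square_integrable_gauss[OF that], of \<eta>] sq[OF that]
    by (simp add: \<Gamma>_eq[OF that] N_def)
  \<comment> \<open>The second factor is a multiple of a modulated Gaussian, so the pairing relation
    of the first factor evaluates this inner product without a further integral.\<close>
  have \<Gamma>\<Gamma>: "cinner (\<Gamma> a \<eta>) (\<Gamma> b \<zeta>) = cinner (to_L2 (gauss a \<eta>)) (to_L2 (gauss b \<zeta>)) / of_real N"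
    if "0 < a" "0 < b" for a b \<eta> \<zeta>
  proof -
    have "cnj (gauss_const TYPE('a) b) * gauss_const TYPE('a) (1 / b) = of_real N"
      using gauss_const_mult[OF that(2), where 'a='a] by (simp add: N_def gauss_const_def)
    moreover have "cinner (\<Gamma> a \<eta>) (\<Gamma> b \<zeta>) =
        cnj (gauss_const TYPE('a) b) * gauss_const TYPE('a) (1 / b) / of_real N *
        cinner (to_L2 (gauss a \<eta>)) (to_L2 (gauss b \<zeta>)) / of_real N"
      using pair\<Gamma>[OF that(1), of \<eta>] that
      by (subst (2) \<Gamma>_def) (simp add: fourier_pair_def cinner_scaleC_right N_def)
    ultimately show ?thesis using N by simp
  qed
  have iso0: "inner (snd p) (snd q) = inner (fst p) (fst q) / N" if pG: "p \<in> G" and qG: "q \<in> G" for p q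
  proof -
    obtain c a \<eta> where p: "p = (c *\<^sub>C to_L2 (gauss a \<eta>), c *\<^sub>C \<Gamma> a \<eta>)" "0 < a"
      using pG unfolding G_def by blast
    obtain d b \<zeta> where q: "q = (d *\<^sub>C to_L2 (gauss b \<zeta>), d *\<^sub>C \<Gamma> b \<zeta>)" "0 < b"
      using qG unfolding G_def by blast
    have "cinner (snd p) (snd q) = cinner (fst p) (fst q) / of_real N"
      by (simp add: p q cinner_simps \<Gamma>\<Gamma>)
    then show ?thesis by (simp add: inner_L2_def Re_divide_of_real)
  qed
  \<comment> \<open>The identity is bilinear over the reals, so it extends from the generators to
    the span in one argument at a time.\<close>
  have iso1: "inner (snd p) (snd q) = inner (fst p) (fst q) / N" if p: "p \<in> span G" and q: "q \<in> G" for p q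
    using p
  proof (induct rule: span_induct)
    case base
    show ?case by (rule subspaceI) (auto simp: inner_simps add_divide_distrib)
  qed (rule iso0[OF _ q])
  have iso2: "inner (snd p) (snd q) = inner (fst p) (fst q) / N" if p: "p \<in> span G" and q: "q \<in> span G" for p q
    using q
  proof (induct rule: span_induct)
    case base
    show ?case by (rule subspaceI) (auto simp: inner_simps add_divide_distrib)
  qed (rule iso1[OF p])
  have iso: "(norm (snd p))\<^sup>2 = (norm (fst p))\<^sup>2 / N" if "p \<in> span G" for p
    using iso2[OF that that] by (simp add: power2_norm_eq_inner)
  have pair: "fourier_pair (fst p) (snd p)" if "p \<in> span G" for p
    using that
  proof (induct rule: span_induct)
    case base
    show ?case
      by (rule subspaceI)
        (auto simp: scaleR_eq_scaleC fourier_pair_add fourier_pair_scaleC fourier_pair_scaleC[of 0 0 0, simplified]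
          intro: fourier_pair_def[THEN iffD2])
  next
    case (step p)
    then show ?case by (auto simp: G_def intro!: fourier_pair_scaleC pair\<Gamma>)
  qed
  have "closure (fst ` span G) = UNIV"
  proof (rule dense_of_no_orthogonal)
    show "subspace (fst ` span G)"
      by (intro linear_subspace_image subspace_span bounded_linear.linear[OF bounded_linear_fst])
    fix w assume w: "\<And>s. s \<in> fst ` span G \<Longrightarrow> inner s w = 0"
    show "w = 0"
    proof (rule gauss_complete, rule inner_all_multiples_zero, rule w)
      fix a \<eta> c assume "0 < (a::real)"
      then have "(c *\<^sub>C to_L2 (gauss a \<eta>), c *\<^sub>C \<Gamma> a \<eta>) \<in> span G"
        by (intro span_base) (auto simp: G_def)
      then show "c *\<^sub>C to_L2 (gauss a \<eta>) \<in> fst ` span G" by (force simp: image_iff)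
    qed
  qed
  then obtain h where h: "\<And>n. h n \<in> fst ` span G" "h \<longlonglongrightarrow> g"
    by (metis UNIV_I closure_sequential)
  then have "\<forall>n. \<exists>u. (h n, u) \<in> span G" by force
  then obtain u where hu: "\<And>n. (h n, u n) \<in> span G" by metis
  have dist: "(dist (u m) (u n))\<^sup>2 = (dist (h m) (h n))\<^sup>2 / N" for m n
    using iso[OF span_diff[OF hu[of m] hu[of n]]] by (simp add: dist_norm)
  have "Cauchy u"
  proof (rule metric_CauchyI)
    fix e :: real assume e: "0 < e"
    then obtain M where M: "\<And>m n. m \<ge> M \<Longrightarrow> n \<ge> M \<Longrightarrow> dist (h m) (h n) < e * sqrt N"
      using N LIMSEQ_imp_Cauchy[OF h(2)] by (meson metric_CauchyD mult_pos_pos real_sqrt_gt_zero)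
    have "dist (u m) (u n) < e" if "m \<ge> M" "n \<ge> M" for m n
    proof -
      have "(dist (h m) (h n))\<^sup>2 < (e * sqrt N)\<^sup>2"
        using M[OF that] by (intro power_strict_mono) auto
      also have "\<dots> = e\<^sup>2 * N" using N by (simp add: power_mult_distrib)
      finally have "(dist (u m) (u n))\<^sup>2 < e\<^sup>2"
        using N unfolding dist by (simp add: pos_divide_less_eq)
      then show ?thesis using e by (simp add: power_less_imp_less_base)
    qed
    then show "\<exists>M. \<forall>m\<ge>M. \<forall>n\<ge>M. dist (u m) (u n) < e" by blast
  qed
  then obtain v where v: "u \<longlonglongrightarrow> v" using Cauchy_convergent convergent_def by blast
  have "fourier_pair g v"
    by (rule fourier_pair_tendsto[OF _ h(2) v]) (use pair[OF hu] in simp)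
  moreover have "(norm v)\<^sup>2 = (norm g)\<^sup>2 / N"
  proof (rule LIMSEQ_unique)
    show "(\<lambda>n. (norm (u n))\<^sup>2) \<longlonglongrightarrow> (norm v)\<^sup>2" by (intro tendsto_intros v)
    have "(\<lambda>n. (norm (h n))\<^sup>2 / N) \<longlonglongrightarrow> (norm g)\<^sup>2 / N"
      using N by (intro tendsto_intros h) auto
    then show "(\<lambda>n. (norm (u n))\<^sup>2) \<longlonglongrightarrow> (norm g)\<^sup>2 / N" using iso[OF hu] by simp
  qed
  ultimately show ?thesis by (auto simp: N_def)
qed

lemma fourier_pair_norm:
  "fourier_pair g u \<Longrightarrow> (norm u)\<^sup>2 = (norm g)\<^sup>2 / fourier_norm TYPE('a)" for g :: "'a::euclidean_space L2"
  using fourier_pair_exists[of g] fourier_pair_unique by blast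

text \<open>The partner of g constructed abstractly in L2 agrees almost everywhere with the Fourier
  integral, which inherits square integrability from it.\<close>

lemma square_integrable_fourier_integral:
  fixes g :: "'a::euclidean_space \<Rightarrow> complex"
  assumes g: "integrable lborel g" "square_integrable g"
  shows "square_integrable (\<lambda>x. fourier_integral g x / of_real (fourier_norm TYPE('a)))"
proof -
  obtain u where u: "fourier_pair (to_L2 g) u" using fourier_pair_exists by blast
  obtain v where v: "square_integrable v" "u = to_L2 v" by (rule L2_cases)
  have "AE x in lborel. v x = fourier_integral g x / of_real (fourier_norm TYPE('a))"
    using AE_eq_fourier_integral[OF g v(1)] u v(2) by simp
  moreover have "fourier_integral g \<in> borel_measurable borel"
    by (intro borel_measurable_continuous_onI continuous_fourier_integral g)
  ultimately show ?thesis
    by (intro square_integrable_AE_bound[OF v(1)]) auto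
qed

section \<open>Identification with the limit of truncated integrals\<close>

lemma square_integrable_truncate:
  assumes g: "square_integrable g"
  shows "integrable lborel (\<lambda>\<xi>. indicator (cball 0 R) \<xi> * g \<xi>)"
    and "square_integrable (\<lambda>\<xi>. indicator (cball 0 R) \<xi> * g \<xi>)"
proof -
  have [measurable]: "g \<in> borel_measurable borel" using g by (rule square_integrable_measurable)
  have "integrable lborel (\<lambda>\<xi>::'a. indicator (cball 0 R) \<xi> *\<^sub>R (1::complex))"
    by (intro integrable_indicator) (auto simp: emeasure_lborel_cball_finite[unfolded infinity_ennreal_def])
  then have "square_integrable (\<lambda>\<xi>::'a. indicator (cball 0 R) \<xi> *\<^sub>R (1::complex))"
    by (rule square_integrable_of_bounded[where B=1]) (auto split: split_indicator)
  from square_integrable_mult[OF this g]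
  show "integrable lborel (\<lambda>\<xi>. indicator (cball 0 R) \<xi> * g \<xi>)"
    by (rule Bochner_Integration.integrable_cong[THEN iffD1, rotated 2]) (auto split: split_indicator)
  show "square_integrable (\<lambda>\<xi>. indicator (cball 0 R) \<xi> * g \<xi>)"
  proof (rule square_integrable_bound[OF g])
    have [measurable]: "cball (0::'a) R \<in> sets borel" by simp
    show "(\<lambda>\<xi>. indicator (cball 0 R) \<xi> * g \<xi>) \<in> borel_measurable borel" by measurable
  qed (auto split: split_indicator)
qed

lemma inv_fourier_ball_to_L2:
  fixes g :: "'a::euclidean_space \<Rightarrow> complex"
  assumes "square_integrable g"
  shows "inv_fourier_ball R (to_L2 g) =
    (\<lambda>x. fourier_integral (\<lambda>\<xi>. indicator (cball 0 R) \<xi> * g \<xi>) x / of_real (fourier_norm TYPE('a)))"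
proof -
  have "inv_fourier_ball R (to_L2 g) =
    (\<lambda>x. (LINT \<xi>:cball 0 R|lborel. exp (\<i> * of_real (x \<bullet> \<xi>)) * g \<xi>) / of_real ((2 * pi) ^ DIM('a)))"
    using assms by transfer simp
  also have "\<dots> = (\<lambda>x. fourier_integral (\<lambda>\<xi>. indicator (cball 0 R) \<xi> * g \<xi>) x / of_real (fourier_norm TYPE('a)))"
    unfolding fourier_integral_def set_lebesgue_integral_def fourier_norm_def wave_def
    by (intro ext arg_cong2[where f="(/)"] Bochner_Integration.integral_cong refl) (auto split: split_indicator)
  finally show ?thesis .
qed

text \<open>The symbols truncated to balls converge to g in L2, and isometry transports this to
  their transforms; so the limit in the definition of \<open>inv_fourier\<close> exists and equals
  the partner of g.\<close>

lemma inv_fourier_eqI: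
  fixes g :: "'a::euclidean_space L2"
  assumes gu: "fourier_pair g u"
  shows "inv_fourier g = u"
proof -
  obtain k where k: "square_integrable k" "g = to_L2 k" by (rule L2_cases)
  have [measurable]: "k \<in> borel_measurable borel" using k by (intro square_integrable_measurable)
  define k' where "k' R = (\<lambda>\<xi>. indicator (cball 0 R) \<xi> * k \<xi>)" for R
  have k': "integrable lborel (k' R)" "square_integrable (k' R)" for R
    unfolding k'_def using square_integrable_truncate[OF k(1)] by auto
  have "fourier_pair (to_L2 (k' R)) (to_L2 (inv_fourier_ball R g))" for R
    unfolding k(2) inv_fourier_ball_to_L2[OF k(1)]
    using fourier_pair_fourier_integral[OF k' square_integrable_fourier_integral[OF k'], of R]
    by (simp add: k'_def)
  then have nrm: "(norm (to_L2 (inv_fourier_ball R g) - u))\<^sup>2 =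
      (norm (to_L2 (k' R) - g))\<^sup>2 / fourier_norm TYPE('a)" for R
    using gu by (intro fourier_pair_norm fourier_pair_diff)
  have "((\<lambda>R. to_L2 (inv_fourier_ball R g)) \<longlongrightarrow> u) at_top"
  proof (rule tendsto_at_topI_sequentially)
    fix X :: "nat \<Rightarrow> real" assume X: "filterlim X at_top sequentially"
    have "(\<lambda>n. to_L2 (k' (X n))) \<longlonglongrightarrow> to_L2 k"
    proof (rule L2_dominated_convergence(3)[OF _ _ k(1)])
      show "AE \<xi> in lborel. (\<lambda>n. k' (X n) \<xi>) \<longlonglongrightarrow> k \<xi>"
      proof (rule AE_I2)
        fix \<xi> :: 'a
        have "\<forall>\<^sub>F n in sequentially. norm \<xi> \<le> X n"
          using X by (simp add: filterlim_at_top)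
        then have "\<forall>\<^sub>F n in sequentially. k' (X n) \<xi> = k \<xi>"
          by (rule eventually_mono) (simp add: k'_def)
        then show "(\<lambda>n. k' (X n) \<xi>) \<longlonglongrightarrow> k \<xi>" by (rule tendsto_eventually)
      qed
      show "AE \<xi> in lborel. cmod (k' (X n) \<xi>) \<le> cmod (k \<xi>)" for n
        by (auto simp: k'_def split: split_indicator)
      show "k' (X n) \<in> borel_measurable borel" for n using k'(1) by auto
    qed measurable
    then have "(\<lambda>n. (norm (to_L2 (k' (X n)) - g))\<^sup>2 / fourier_norm TYPE('a)) \<longlonglongrightarrow> (norm (g - g))\<^sup>2 / fourier_norm TYPE('a)"
      unfolding k(2) by (intro tendsto_intros) auto
    then have "(\<lambda>n. sqrt ((norm (to_L2 (inv_fourier_ball (X n) g) - u))\<^sup>2)) \<longlonglongrightarrow> sqrt 0"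
      unfolding nrm by (intro tendsto_real_sqrt) simp
    then show "(\<lambda>n. to_L2 (inv_fourier_ball (X n) g)) \<longlonglongrightarrow> u"
      by (simp add: tendsto_norm_zero_iff LIM_zero_iff)
  qed
  then show ?thesis
    unfolding inv_fourier_def by (intro tendsto_Lim) auto
qed

lemma fourier_pair_inv_fourier: "fourier_pair g (inv_fourier g)"
  using fourier_pair_exists inv_fourier_eqI by metis

lemma inv_fourier_add: "inv_fourier (g + h) = inv_fourier g + inv_fourier h"
  by (intro inv_fourier_eqI fourier_pair_add fourier_pair_inv_fourier)

lemma inv_fourier_diff: "inv_fourier (g - h) = inv_fourier g - inv_fourier h"
  by (intro inv_fourier_eqI fourier_pair_diff fourier_pair_inv_fourier)

lemma inv_fourier_scaleC: "inv_fourier (c *\<^sub>C g) = c *\<^sub>C inv_fourier g"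
  by (intro inv_fourier_eqI fourier_pair_scaleC fourier_pair_inv_fourier)

lemma inv_fourier_eq_iff [simp]: "inv_fourier g = inv_fourier h \<longleftrightarrow> g = h"
  using fourier_pair_inv_fourier fourier_pair_unique_left by metis

lemma norm_inv_fourier:
  "(norm (inv_fourier g))\<^sup>2 = (norm g)\<^sup>2 / fourier_norm TYPE('a)" for g :: "'a::euclidean_space L2"
  by (intro fourier_pair_norm fourier_pair_inv_fourier)

text \<open>Polarization of the norm identity gives the real part; replacing h by \<i> h gives the
  imaginary part.\<close>

lemma cinner_inv_fourier:
  fixes g h :: "'a::euclidean_space L2"
  shows "cinner (inv_fourier g) (inv_fourier h) = cinner g h / of_real (fourier_norm TYPE('a))"
proof -
  have inner: "inner (inv_fourier g) (inv_fourier h) = inner g h / fourier_norm TYPE('a)" for g h :: "'a L2"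
    unfolding dot_norm inv_fourier_add[symmetric] norm_inv_fourier by (simp add: diff_divide_distrib)
  show ?thesis
  proof (rule complex_eqI)
    show "Re (cinner (inv_fourier g) (inv_fourier h)) = Re (cinner g h / of_real (fourier_norm TYPE('a)))"
      using inner[of g h] by (simp add: inner_L2_def Re_divide_of_real)
    show "Im (cinner (inv_fourier g) (inv_fourier h)) = Im (cinner g h / of_real (fourier_norm TYPE('a)))"
      using inner[of g "\<i> *\<^sub>C h"] by (simp add: Im_cinner Im_divide_of_real inv_fourier_scaleC)
  qed
qed

lemma inv_fourier_to_L2:
  fixes g :: "'a::euclidean_space \<Rightarrow> complex"
  assumes "integrable lborel g" "square_integrable g"
  shows "inv_fourier (to_L2 g) = to_L2 (\<lambda>x. fourier_integral g x / of_real (fourier_norm TYPE('a)))"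
  using assms by (intro inv_fourier_eqI fourier_pair_fourier_integral square_integrable_fourier_integral)

text \<open>The range is closed, since isometry pulls Cauchy sequences back, and dense, since it
  contains every modulated Gaussian.\<close>

lemma inv_fourier_surj: "surj (inv_fourier :: 'a::euclidean_space L2 \<Rightarrow> 'a L2)"
proof -
  let ?R = "range (inv_fourier :: 'a L2 \<Rightarrow> 'a L2)"
  define N where "N = fourier_norm TYPE('a)"
  have N: "0 < N" by (simp add: N_def)
  have zero: "inv_fourier (0::'a L2) = 0" using inv_fourier_scaleC[of 0 "0 :: 'a L2"] by simp
  have sub: "subspace ?R"
    by (rule subspaceI, metis rangeI zero)
      (auto simp: scaleR_eq_scaleC simp flip: inv_fourier_add inv_fourier_scaleC)
  have "closed ?R"
    unfolding closed_sequential_limits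
  proof (intro allI impI, elim conjE)
    fix u :: "nat \<Rightarrow> 'a L2" and l assume u: "\<forall>n. u n \<in> ?R" "u \<longlonglongrightarrow> l"
    then have "\<forall>n. \<exists>g. u n = inv_fourier g" by auto
    then obtain g where g: "\<And>n. u n = inv_fourier (g n)" by metis
    have "Cauchy g"
    proof (rule metric_CauchyI)
      fix e :: real assume e: "0 < e"
      then obtain M where M: "\<And>m n. m \<ge> M \<Longrightarrow> n \<ge> M \<Longrightarrow> dist (u m) (u n) < e / sqrt N"
        using N LIMSEQ_imp_Cauchy[OF u(2)] by (meson metric_CauchyD divide_pos_pos real_sqrt_gt_zero)
      have "dist (g m) (g n) < e" if "m \<ge> M" "n \<ge> M" for m n
      proof -
        have "(dist (u m) (u n))\<^sup>2 < (e / sqrt N)\<^sup>2"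
          using M[OF that] by (intro power_strict_mono) auto
        moreover have "(dist (u m) (u n))\<^sup>2 = (dist (g m) (g n))\<^sup>2 / N"
          using norm_inv_fourier[of "g m - g n"] by (simp add: g dist_norm N_def inv_fourier_diff)
        ultimately have "(dist (g m) (g n))\<^sup>2 < e\<^sup>2"
          using N by (simp add: power_divide divide_less_cancel)
        then show ?thesis using e by (simp add: power_less_imp_less_base)
      qed
      then show "\<exists>M. \<forall>m\<ge>M. \<forall>n\<ge>M. dist (g m) (g n) < e" by blast
    qed
    then obtain h where h: "g \<longlonglongrightarrow> h" using Cauchy_convergent convergent_def by blast
    have "fourier_pair h l"
      by (rule fourier_pair_tendsto[OF _ h u(2)]) (simp only: g fourier_pair_inv_fourier)
    then show "l \<in> ?R" using inv_fourier_eqI by blast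
  qed
  moreover have "closure ?R = UNIV"
  proof (rule dense_of_no_orthogonal[OF sub])
    fix w assume w: "\<And>s. s \<in> ?R \<Longrightarrow> inner s w = 0"
    show "w = 0"
    proof (rule mgauss_complete, rule inner_all_multiples_zero, rule w)
      fix a \<eta> c assume a: "0 < (a::real)"
      have "inv_fourier (to_L2 (gauss a (\<eta>::'a))) = to_L2 (\<lambda>x. gauss_const TYPE('a) a / of_real N * mgauss a \<eta> x)"
        using a by (simp add: inv_fourier_to_L2 integrable_gauss square_integrable_gauss fourier_integral_gauss N_def)
      also have "\<dots> = (gauss_const TYPE('a) a / of_real N) *\<^sub>C to_L2 (mgauss a \<eta>)"
        using a by (intro to_L2_scale square_integrable_mgauss)
      finally have "c *\<^sub>C to_L2 (mgauss a \<eta>) =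
          inv_fourier ((c * of_real N / gauss_const TYPE('a) a) *\<^sub>C to_L2 (gauss a \<eta>))"
        using a N by (simp add: inv_fourier_scaleC)
      then show "c *\<^sub>C to_L2 (mgauss a \<eta>) \<in> ?R" by blast
    qed
  qed
  ultimately show ?thesis by (simp add: closure_closed)
qed

lemma inv_fourier_cases:
  obtains g where "square_integrable g" "u = inv_fourier (to_L2 g)"
  using inv_fourier_surj L2_cases by (metis surjD)

section \<open>The forward transform and inversion\<close>

text \<open>The exponent has the opposite sign and there is no prefactor, as the whole factor (2
  pi)^(-d) sits in the inverse.\<close>

definition fourier_transform :: "('a::euclidean_space \<Rightarrow> complex) \<Rightarrow> 'a \<Rightarrow> complex" where
  "fourier_transform f \<xi> = fourier_integral f (- \<xi>)"

text \<open>By surjectivity f has some L2 symbol g. The Fourier integral of f and g have the same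
  pairings with all Gaussians, hence agree almost everywhere.\<close>

lemma
  fixes f :: "'a::euclidean_space \<Rightarrow> complex"
  assumes f: "integrable lborel f" "square_integrable f"
  shows square_integrable_fourier_transform: "square_integrable (fourier_transform f)"
    and inv_fourier_fourier_transform: "inv_fourier (to_L2 (fourier_transform f)) = to_L2 f"
proof -
  obtain g where g: "square_integrable g" "to_L2 f = inv_fourier (to_L2 g)" by (rule inv_fourier_cases)
  have m0: "fourier_integral f \<in> borel_measurable borel"
    by (intro borel_measurable_continuous_onI continuous_fourier_integral f)
  then have m[measurable]: "fourier_transform f \<in> borel_measurable borel"
    unfolding fourier_transform_def[abs_def] by measurable
  have i: "integrable lborel (\<lambda>\<xi>. fourier_transform f \<xi> * h \<xi>)" if "integrable lborel h" for h
    unfolding fourier_transform_def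
    by (rule integrable_bounded_mult[OF that _ fourier_integral_bound[OF f(1)]])
      (use m in \<open>simp add: fourier_transform_def[abs_def]\<close>)
  have eq: "AE \<xi> in lborel. fourier_transform f \<xi> - g \<xi> = 0"
  proof (rule gauss_separating)
    show "integrable lborel (\<lambda>\<xi>. (fourier_transform f \<xi> - g \<xi>) * gauss 1 0 \<xi>)"
      unfolding left_diff_distrib
      by (intro Bochner_Integration.integrable_diff i integrable_gauss square_integrable_mult g square_integrable_gauss) auto
    fix a :: real and \<eta> :: 'a assume a: "0 < a"
    have "(LINT \<xi>|lborel. fourier_transform f \<xi> * gauss a \<eta> \<xi>) =
        (LINT \<xi>|lborel. fourier_integral f \<xi> * gauss a \<eta> (- \<xi>))"
    proof -
      have "(\<lambda>\<xi>. fourier_transform f \<xi> * gauss a \<eta> \<xi>) \<in> borel_measurable borel" by measurable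
      from lborel_integral_affine(1)[OF _ this, of "-1" 0] show ?thesis
        by (simp add: fourier_transform_def)
    qed
    also have "\<dots> = (LINT \<xi>|lborel. fourier_integral f \<xi> * gauss a (- \<eta>) \<xi>)"
    proof -
      have "gauss a \<eta> (- \<xi>) = gauss a (- \<eta>) \<xi>" for \<xi> :: 'a
      proof -
        have "- \<xi> - \<eta> = - (\<xi> + \<eta>)" by simp
        then have "norm (- \<xi> - \<eta>) = norm (\<xi> + \<eta>)" by (metis norm_minus_cancel)
        then show ?thesis by (simp add: gauss_def)
      qed
      then show ?thesis by simp
    qed
    also have "\<dots> = (LINT x|lborel. f x * fourier_integral (gauss a (- \<eta>)) x)"
      by (rule fourier_integral_duality[symmetric]) (intro f integrable_gauss a)+
    also have "\<dots> = gauss_const TYPE('a) a * (LINT x|lborel. f x * cnj (mgauss a \<eta> x))"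
      using a by (simp add: fourier_integral_gauss cnj_mgauss mult.left_commute[of "f _"])
    also have "(LINT x|lborel. f x * cnj (mgauss a \<eta> x)) =
        gauss_const TYPE('a) (1 / a) / of_real (fourier_norm TYPE('a)) * (LINT \<xi>|lborel. g \<xi> * gauss a \<eta> \<xi>)"
      using fourier_pair_inv_fourier[of "to_L2 g"] a
      by (simp add: fourier_pair_def cinner_to_L2 f g square_integrable_gauss square_integrable_mgauss flip: g(2))
    finally have "(LINT \<xi>|lborel. fourier_transform f \<xi> * gauss a \<eta> \<xi>) = (LINT \<xi>|lborel. g \<xi> * gauss a \<eta> \<xi>)"
      using gauss_const_mult[OF a, where 'a='a] by (simp flip: mult.assoc)
    then show "(LINT \<xi>|lborel. (fourier_transform f \<xi> - g \<xi>) * gauss a \<eta> \<xi>) = 0"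
      unfolding left_diff_distrib using a
      by (subst Bochner_Integration.integral_diff)
        (auto intro!: i integrable_gauss square_integrable_mult g square_integrable_gauss)
  qed
  then show sq: "square_integrable (fourier_transform f)"
    by (intro square_integrable_AE_bound[OF g(1) m]) auto
  show "inv_fourier (to_L2 (fourier_transform f)) = to_L2 f"
    unfolding g(2) using eq by (simp add: to_L2_eq_iff sq g(1))
qed


section \<open>Smooth functions and test functions\<close>

text \<open>The relational form records that the derivative exists, which a value of
  \<open>partial_deriv\<close> alone does not.\<close>

definition has_partial_deriv ::
  "(real^'n::finite \<Rightarrow> complex) \<Rightarrow> (real^'n \<Rightarrow> complex) \<Rightarrow> 'n \<Rightarrow> bool" where
  "has_partial_deriv f f' i \<longleftrightarrow>
     (\<forall>x. ((\<lambda>t. f (x + t *\<^sub>R axis i 1)) has_vector_derivative f' x) (at 0))"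

lemma has_partial_deriv_imp_eq: "has_partial_deriv f f' i \<Longrightarrow> partial_deriv i f = f'"
  by (auto simp: has_partial_deriv_def partial_deriv_def fun_eq_iff intro: vector_derivative_at)

lemma has_partial_deriv_add:
  "has_partial_deriv f f' i \<Longrightarrow> has_partial_deriv g g' i \<Longrightarrow>
    has_partial_deriv (\<lambda>x. f x + g x) (\<lambda>x. f' x + g' x) i"
  unfolding has_partial_deriv_def by (simp add: has_vector_derivative_add)

lemma has_partial_deriv_mult:
  "has_partial_deriv f f' i \<Longrightarrow> has_partial_deriv g g' i \<Longrightarrow>
    has_partial_deriv (\<lambda>x. f x * g x) (\<lambda>x. f x * g' x + f' x * g x) i"
  unfolding has_partial_deriv_def
  using has_vector_derivative_mult[of "\<lambda>t. f (_ + t *\<^sub>R axis i 1)" _ 0 UNIV] by fastforce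

lemma has_partial_deriv_const: "has_partial_deriv (\<lambda>_. c) (\<lambda>_. 0) i"
  by (simp add: has_partial_deriv_def)

lemma has_partial_deriv_inner:
  "has_partial_deriv (\<lambda>x. of_real (x \<bullet> v)) (\<lambda>_. of_real (v $ i)) i"
  unfolding has_partial_deriv_def
proof
  fix x
  have "((\<lambda>t. complex_of_real (x \<bullet> v + t * (v $ i))) has_vector_derivative of_real (0 + 1 * (v $ i))) (at 0)"
    by (intro has_vector_derivative_of_real has_real_derivative_iff_has_vector_derivative[THEN iffD1])
      (auto intro!: derivative_eq_intros)
  then show "((\<lambda>t. complex_of_real ((x + t *\<^sub>R axis i 1) \<bullet> v)) has_vector_derivative of_real (v $ i)) (at 0)"
    by (simp add: inner_add_left inner_axis' )
qed

lemma has_partial_deriv_cnj: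
  "has_partial_deriv f f' i \<Longrightarrow> has_partial_deriv (\<lambda>x. cnj (f x)) (\<lambda>x. cnj (f' x)) i"
  by (simp add: has_partial_deriv_def has_vector_derivative_cnj)

lemma has_partial_deriv_chain:
  assumes f: "has_partial_deriv f f' i" and h: "\<And>x. (h has_field_derivative h' (f x)) (at (f x))"
  shows "has_partial_deriv (\<lambda>x. h (f x)) (\<lambda>x. f' x * h' (f x)) i"
  unfolding has_partial_deriv_def
proof
  fix x
  show "((\<lambda>t. h (f (x + t *\<^sub>R axis i 1))) has_vector_derivative f' x * h' (f x)) (at 0)"
    using field_vector_diff_chain_at[of "\<lambda>t. f (x + t *\<^sub>R axis i 1)" "f' x" 0 h "h' (f x)"] f h
    by (simp add: has_partial_deriv_def o_def)
qed

text \<open>Serves outer functions such as \<open>flat p\<close>, which have a real derivative only,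
  so that the complex chain rule does not apply to them.\<close>

lemma has_partial_deriv_chain_real:
  assumes f: "has_partial_deriv (\<lambda>x. of_real (q x)) f' i"
    and h: "\<And>t. (h has_real_derivative h' t) (at t)"
  shows "has_partial_deriv (\<lambda>x. of_real (h (q x))) (\<lambda>x. f' x * of_real (h' (q x))) i"
  unfolding has_partial_deriv_def
proof
  fix x
  have *: "((\<lambda>t. complex_of_real (q (x + t *\<^sub>R axis i 1))) has_vector_derivative f' x) (at 0)"
    using f by (simp add: has_partial_deriv_def)
  from bounded_linear.has_vector_derivative[OF bounded_linear_Re this]
    bounded_linear.has_vector_derivative[OF bounded_linear_Im this]
  have re: "((\<lambda>t. q (x + t *\<^sub>R axis i 1)) has_vector_derivative Re (f' x)) (at 0)"
    and im: "((\<lambda>t. 0 :: real) has_vector_derivative Im (f' x)) (at 0)" by simp_all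
  \<comment> \<open>The inner function is real along the line, so its derivative is real as well and
    the chain rule can be applied to real curves.\<close>
  from im have "Im (f' x) = 0" using vector_derivative_at by fastforce
  then have f'x: "f' x = of_real (Re (f' x))" by (simp add: complex_eq_iff)
  have "((h \<circ> (\<lambda>t. q (x + t *\<^sub>R axis i 1))) has_vector_derivative Re (f' x) *\<^sub>R h' (q x)) (at 0)"
    using h[of "q x"] re
    by (intro vector_diff_chain_at) (auto simp: has_real_derivative_iff_has_vector_derivative)
  from has_vector_derivative_of_real[OF this[folded has_real_derivative_iff_has_vector_derivative]]
  show "((\<lambda>t. complex_of_real (h (q (x + t *\<^sub>R axis i 1)))) has_vector_derivative f' x * of_real (h' (q x))) (at 0)"
    by (subst f'x) (simp add: o_def)
qed

lemma has_partial_deriv_dilate: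
  assumes "has_partial_deriv f f' i"
  shows "has_partial_deriv (\<lambda>x. f (r *\<^sub>R x)) (\<lambda>x. of_real r * f' (r *\<^sub>R x)) i"
  unfolding has_partial_deriv_def
proof
  fix x
  let ?g = "\<lambda>t. f (r *\<^sub>R x + t *\<^sub>R axis i 1)"
  have "(?g has_vector_derivative f' (r *\<^sub>R x)) (at (r * 0))"
    using assms by (simp add: has_partial_deriv_def)
  moreover have "((\<lambda>t. r * t) has_vector_derivative r) (at 0)"
    unfolding has_real_derivative_iff_has_vector_derivative[symmetric]
    by (auto intro!: derivative_eq_intros)
  ultimately have "((?g \<circ> (\<lambda>t. r * t)) has_vector_derivative r *\<^sub>R f' (r *\<^sub>R x)) (at 0)"
    by (intro vector_diff_chain_at) auto
  then show "((\<lambda>t. f (r *\<^sub>R (x + t *\<^sub>R axis i 1))) has_vector_derivative of_real r * f' (r *\<^sub>R x)) (at 0)"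
    by (simp add: o_def scaleR_add_right scaleR_conv_of_real[where 'a=complex])
qed


subsection \<open>The functions \<open>p(1/t) e\<^sup>-\<^sup>1\<^sup>/\<^sup>t\<close>\<close>

text \<open>For p = 1 this is the usual smooth function that vanishes exactly on t \<le> 0; the
  polynomial factor closes the family under differentiation.\<close>

definition flat :: "real poly \<Rightarrow> real \<Rightarrow> real" where
  "flat p t = (if 0 < t then poly p (1 / t) * exp (- (1 / t)) else 0)"

lemma flat_tendsto_0: "(flat p \<longlongrightarrow> 0) (at 0)"
proof (rule filterlim_split_at)
  have "((\<lambda>s. poly p s * exp (- s)) \<longlongrightarrow> (\<Sum>i\<le>degree p. coeff p i * 0)) at_top"
  proof -
    have "((\<lambda>s. \<Sum>i\<le>degree p. coeff p i * (s ^ i / exp s)) \<longlongrightarrow> (\<Sum>i\<le>degree p. coeff p i * 0)) at_top"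
      by (intro tendsto_intros tendsto_power_div_exp_0)
    then show ?thesis
      by (simp add: poly_altdef sum_distrib_right exp_minus divide_inverse mult.assoc)
  qed
  then have "((\<lambda>t. poly p (inverse t) * exp (- inverse t)) \<longlongrightarrow> 0) (at_right 0)"
    using filterlim_compose[OF _ filterlim_inverse_at_top_right] by fastforce
  then show "(flat p \<longlongrightarrow> 0) (at_right 0)"
  proof (rule Lim_transform_eventually)
    show "\<forall>\<^sub>F t in at_right 0. poly p (inverse t) * exp (- inverse t) = flat p t"
      using eventually_at_right_less[of 0] by eventually_elim (simp add: flat_def inverse_eq_divide)
  qed
  have "\<forall>\<^sub>F t in at_left 0. flat p t = 0"
    by (simp add: flat_def eventually_at_filter)
  then show "(flat p \<longlongrightarrow> 0) (at_left 0)" by (rule tendsto_eventually)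
qed

text \<open>With s = 1 / t one has d/dt = - s^2 d/ds, and differentiating p(s) exp(-s) gives s^2 (p
  - p') exp(-s).\<close>

definition flat_step :: "real poly \<Rightarrow> real poly" where
  "flat_step p = [:0, 0, 1:] * (p - pderiv p)"

lemma flat_has_derivative: "(flat p has_real_derivative flat (flat_step p) t) (at t)"
proof -
  consider "t > 0" | "t < 0" | "t = 0" by linarith
  then show ?thesis
  proof cases
    case 1
    have d: "((\<lambda>t. poly p (1 / t) * exp (- (1 / t))) has_real_derivative flat (flat_step p) t) (at t)"
      using 1 by (auto intro!: derivative_eq_intros poly_DERIV[THEN DERIV_chain2]
          simp: flat_def flat_step_def field_simps power2_eq_square)
    show ?thesis
      by (rule has_field_derivative_transform_within_open[OF d, of "{0<..}"]) (use 1 in \<open>auto simp: flat_def\<close>)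
  next
    case 2
    have d: "((\<lambda>t. 0) has_real_derivative flat (flat_step p) t) (at t)"
      using 2 by (simp add: flat_def)
    show ?thesis
      by (rule has_field_derivative_transform_within_open[OF d, of "{..<0}"]) (use 2 in \<open>auto simp: flat_def\<close>)
  next
    case 3
    have "((\<lambda>t. (flat p t - flat p 0) / (t - 0)) \<longlongrightarrow> 0) (at 0)"
    \<comment> \<open>The difference quotient at 0 is again in the family: dividing by t multiplies
      the polynomial by 1 / t, that is, shifts its coefficients.\<close>
    proof (rule Lim_transform_eventually[OF flat_tendsto_0[of "pCons 0 p"]])
      show "\<forall>\<^sub>F t in at 0. flat (pCons 0 p) t = (flat p t - flat p 0) / (t - 0)"
        by (auto simp: flat_def eventually_at_filter)
    qed
    then show ?thesis
      using 3 by (simp add: has_field_derivative_iff flat_def)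
  qed
qed

lemma flat_1_pos: "0 < t \<Longrightarrow> 0 < flat 1 t" and flat_1_nonneg: "0 \<le> flat 1 t" and flat_nonpos: "t \<le> 0 \<Longrightarrow> flat p t = 0"
  by (auto simp: flat_def)


subsection \<open>Closure properties\<close>

lemma smooth_partial_deriv: "smooth f \<Longrightarrow> smooth (partial_deriv i f)"
proof -
  have "partial_derivs is (partial_deriv i f) = partial_derivs (is @ [i]) f" for "is"
    by (induction "is") auto
  then show "smooth f \<Longrightarrow> smooth (partial_deriv i f)" by (auto simp: smooth_def)
qed

lemma smooth_has_partial_deriv: "smooth f \<Longrightarrow> has_partial_deriv f (partial_deriv i f) i"
  unfolding smooth_def has_partial_deriv_def
proof (intro allI)
  fix x
  assume "\<forall>is. continuous_on UNIV (partial_derivs is f) \<and>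
        (\<forall>i x. (\<lambda>t. partial_derivs is f (x + t *\<^sub>R axis i 1)) differentiable at 0)"
  then have "(\<lambda>t. f (x + t *\<^sub>R axis i 1)) differentiable at 0"
    by (metis partial_derivs.simps(1))
  then show "((\<lambda>t. f (x + t *\<^sub>R axis i 1)) has_vector_derivative partial_deriv i f x) (at 0)"
    unfolding partial_deriv_def by (rule vector_derivative_works[THEN iffD1])
qed

lemma smooth_continuous: "smooth f \<Longrightarrow> continuous_on UNIV f"
  unfolding smooth_def by (metis partial_derivs.simps(1))

text \<open>
  Smoothness is stable under the operations below because the class they generate is closed under
  partial derivatives.
\<close>
inductive smooth_gen :: "(real^'n::finite \<Rightarrow> complex) \<Rightarrow> bool" where
  base: "smooth f \<Longrightarrow> smooth_gen f"
| const: "smooth_gen (\<lambda>_. c)"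
| inner: "smooth_gen (\<lambda>x. of_real (x \<bullet> v))"
| add: "smooth_gen f \<Longrightarrow> smooth_gen g \<Longrightarrow> smooth_gen (\<lambda>x. f x + g x)"
| mult: "smooth_gen f \<Longrightarrow> smooth_gen g \<Longrightarrow> smooth_gen (\<lambda>x. f x * g x)"
| inv: "smooth_gen f \<Longrightarrow> (\<And>x. f x \<noteq> 0) \<Longrightarrow> smooth_gen (\<lambda>x. inverse (f x))"
| exp: "smooth_gen f \<Longrightarrow> smooth_gen (\<lambda>x. exp (f x))"
| cnj: "smooth_gen f \<Longrightarrow> smooth_gen (\<lambda>x. cnj (f x))"
| flat: "smooth_gen (\<lambda>x. of_real (q x)) \<Longrightarrow> smooth_gen (\<lambda>x. of_real (flat p (q x)))"
| dilate: "smooth_gen f \<Longrightarrow> smooth_gen (\<lambda>x. f (r *\<^sub>R x))"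

lemma continuous_on_flat: "continuous_on S (flat p)"
  using flat_has_derivative
  by (meson DERIV_isCont continuous_at_imp_continuous_on)

lemma smooth_gen_continuous: "smooth_gen f \<Longrightarrow> continuous_on UNIV f"
proof (induction rule: smooth_gen.induct)
  case (base f)
  then show ?case by (rule smooth_continuous)
next
  case (flat q p)
  from continuous_on_Re[OF flat.IH] have "continuous_on UNIV q" by (simp only: Re_complex_of_real)
  then have "continuous_on UNIV (\<lambda>x. flat p (q x))"
    by (rule continuous_on_compose2[OF continuous_on_flat[of UNIV]]) auto
  then show ?case by (intro continuous_intros)
next
  case (dilate f r)
  show ?case by (rule continuous_on_compose2[OF dilate.IH]) (auto intro!: continuous_intros)
qed (auto intro!: continuous_intros)

lemma smooth_gen_partial_deriv:
  "smooth_gen f \<Longrightarrow> \<exists>f'. smooth_gen f' \<and> has_partial_deriv f f' i"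
proof (induction rule: smooth_gen.induct)
  case (base f)
  then show ?case by (metis smooth_gen.base smooth_has_partial_deriv smooth_partial_deriv)
next
  case (const c)
  show ?case using has_partial_deriv_const smooth_gen.const by blast
next
  case (inner v)
  show ?case using has_partial_deriv_inner smooth_gen.const by blast
next
  case (add f g)
  then show ?case using has_partial_deriv_add smooth_gen.add by metis
next
  case (mult f g)
  then obtain f' g' where "smooth_gen f'" "has_partial_deriv f f' i" "smooth_gen g'" "has_partial_deriv g g' i"
    by blast
  then show ?case
    using mult.hyps by (intro exI[of _ "\<lambda>x. f x * g' x + f' x * g x"] conjI has_partial_deriv_mult smooth_gen.add smooth_gen.mult)
next
  case (inv f)
  then obtain f' where f': "smooth_gen f'" "has_partial_deriv f f' i" by blast
  have "has_partial_deriv (\<lambda>x. inverse (f x)) (\<lambda>x. f' x * (- 1 * (inverse (f x) * inverse (f x)))) i"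
    by (rule has_partial_deriv_chain[OF f'(2)])
      (use inv.hyps(2) in \<open>auto intro!: derivative_eq_intros simp: power2_eq_square\<close>)
  moreover have "smooth_gen (\<lambda>x. f' x * (- 1 * (inverse (f x) * inverse (f x))))"
    by (intro smooth_gen.mult smooth_gen.const smooth_gen.inv f' inv.hyps)
  ultimately show ?case by blast
next
  case (exp f)
  then obtain f' where f': "smooth_gen f'" "has_partial_deriv f f' i" by blast
  have "has_partial_deriv (\<lambda>x. exp (f x)) (\<lambda>x. f' x * exp (f x)) i"
    by (rule has_partial_deriv_chain[OF f'(2)]) (rule DERIV_exp)
  moreover have "smooth_gen (\<lambda>x. f' x * exp (f x))"
    by (intro smooth_gen.mult smooth_gen.exp f' exp.hyps)
  ultimately show ?case by blast
next
  case (cnj f)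
  then show ?case using has_partial_deriv_cnj smooth_gen.cnj by blast
next
  case (flat q p)
  then obtain f' where f': "smooth_gen f'" "has_partial_deriv (\<lambda>x. of_real (q x)) f' i" by blast
  have "has_partial_deriv (\<lambda>x. of_real (flat p (q x))) (\<lambda>x. f' x * of_real (flat (flat_step p) (q x))) i"
    by (rule has_partial_deriv_chain_real[OF f'(2) flat_has_derivative])
  moreover have "smooth_gen (\<lambda>x. f' x * of_real (flat (flat_step p) (q x)))"
    by (intro smooth_gen.mult smooth_gen.flat f' flat.hyps)
  ultimately show ?case by blast
next
  case (dilate f r)
  then obtain f' where f': "smooth_gen f'" "has_partial_deriv f f' i" by blast
  then show ?case
    using has_partial_deriv_dilate[OF f'(2), of r]
    by (intro exI[of _ "\<lambda>x. of_real r * f' (r *\<^sub>R x)"] conjI smooth_gen.mult smooth_gen.const smooth_gen.dilate)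
qed

lemma smooth_gen_iff: "smooth_gen f \<longleftrightarrow> smooth f"
proof
  assume f: "smooth_gen f"
  have gen: "smooth_gen (partial_derivs is f)" for "is"
    by (induction "is") (use f smooth_gen_partial_deriv has_partial_deriv_imp_eq in fastforce)+
  show "smooth f"
    unfolding smooth_def
  proof (intro allI conjI)
    fix "is" i x
    show "continuous_on UNIV (partial_derivs is f)" by (rule smooth_gen_continuous[OF gen])
    obtain f' where "has_partial_deriv (partial_derivs is f) f' i"
      using smooth_gen_partial_deriv[OF gen] by blast
    then show "(\<lambda>t. partial_derivs is f (x + t *\<^sub>R axis i 1)) differentiable at 0"
      by (auto simp: has_partial_deriv_def intro: differentiableI_vector)
  qed
qed (rule smooth_gen.base)

text \<open>The rules are later selected by position: constant, inner product, sum, product,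
  inverse, exponential, conjugate, \<open>flat\<close>, dilation.\<close>

lemmas smooth_intros = smooth_gen.intros(2-)[unfolded smooth_gen_iff]

lemma smooth_sum: "(\<And>i. i \<in> I \<Longrightarrow> smooth (f i)) \<Longrightarrow> smooth (\<lambda>x. \<Sum>i\<in>I. f i x)"
  by (induction I rule: infinite_finite_induct) (auto intro: smooth_intros)

lemma smooth_diff: "smooth f \<Longrightarrow> smooth g \<Longrightarrow> smooth (\<lambda>x. f x - g x)"
  using smooth_intros(3)[of f "\<lambda>x. - 1 * g x"] smooth_intros(4)[OF smooth_intros(1)[of "- 1"], of g] by simp

lemma smooth_norm_square: "smooth (\<lambda>x::real^'n::finite. of_real ((norm x)\<^sup>2))"
proof -
  have "(norm x)\<^sup>2 = (\<Sum>i\<in>UNIV. (x \<bullet> axis i 1) * (x \<bullet> axis i 1))" for x :: "real^'n"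
    by (simp add: inner_axis) (simp add: power2_norm_eq_inner inner_vec_def)
  then have "complex_of_real ((norm x)\<^sup>2) = (\<Sum>i\<in>UNIV. of_real (x \<bullet> axis i 1) * of_real (x \<bullet> axis i 1))" for x :: "real^'n"
    by (simp only: of_real_sum of_real_mult)
  then show ?thesis by (simp only: smooth_sum smooth_intros(2,4))
qed

lemma smooth_wave: "smooth (wave (\<eta> :: real^'n::finite))"
proof -
  have *: "wave \<eta> = (\<lambda>x. exp (\<i> * of_real (x \<bullet> \<eta>)))" by (simp add: wave_def fun_eq_iff inner_commute)
  show ?thesis unfolding * by (intro smooth_intros)
qed

lemma smooth_mgauss: "smooth (mgauss a (\<eta> :: real^'n::finite))"
proof -
  have *: "mgauss a \<eta> = (\<lambda>x. wave \<eta> x * exp (of_real (- (1 / a / 2)) * of_real ((norm x)\<^sup>2)))"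
    by (simp add: mgauss_def gauss_def fun_eq_iff exp_of_real[symmetric])
  show ?thesis unfolding * by (intro smooth_intros smooth_wave smooth_norm_square)
qed

lemma partial_deriv_mult:
  "smooth f \<Longrightarrow> smooth g \<Longrightarrow>
    partial_deriv i (\<lambda>x. f x * g x) = (\<lambda>x. f x * partial_deriv i g x + partial_deriv i f x * g x)"
  by (intro has_partial_deriv_imp_eq has_partial_deriv_mult smooth_has_partial_deriv)

lemma partial_deriv_add:
  "smooth f \<Longrightarrow> smooth g \<Longrightarrow>
    partial_deriv i (\<lambda>x. f x + g x) = (\<lambda>x. partial_deriv i f x + partial_deriv i g x)"
  by (intro has_partial_deriv_imp_eq has_partial_deriv_add smooth_has_partial_deriv)

lemma partial_deriv_cmult:
  "smooth f \<Longrightarrow> partial_deriv i (\<lambda>x. c * f x) = (\<lambda>x. c * partial_deriv i f x)"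
  using partial_deriv_mult[OF smooth_intros(1)[of c], of f i]
    has_partial_deriv_imp_eq[OF has_partial_deriv_const[of c i]] by simp

lemma partial_deriv_cnj:
  "smooth f \<Longrightarrow> partial_deriv i (\<lambda>x. cnj (f x)) = (\<lambda>x. cnj (partial_deriv i f x))"
  by (intro has_partial_deriv_imp_eq has_partial_deriv_cnj smooth_has_partial_deriv)

lemma partial_derivs_add:
  "smooth f \<Longrightarrow> smooth g \<Longrightarrow>
    partial_derivs is (\<lambda>x. f x + g x) = (\<lambda>x. partial_derivs is f x + partial_derivs is g x)"
proof (induction "is")
  case (Cons i "is")
  have "smooth (partial_derivs is h)" if "smooth h" for h
    using that by (induction "is") (auto intro: smooth_partial_deriv)
  then show ?case using Cons by (simp add: partial_deriv_add)
qed simp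

lemma smooth_partial_derivs: "smooth f \<Longrightarrow> smooth (partial_derivs is f)"
  by (induction "is") (auto intro: smooth_partial_deriv)

lemma partial_derivs_cmult:
  "smooth f \<Longrightarrow> partial_derivs is (\<lambda>x. c * f x) = (\<lambda>x. c * partial_derivs is f x)"
  by (induction "is") (auto simp: partial_deriv_cmult smooth_partial_derivs)

lemma partial_derivs_cnj:
  "smooth f \<Longrightarrow> partial_derivs is (\<lambda>x. cnj (f x)) = (\<lambda>x. cnj (partial_derivs is f x))"
  by (induction "is") (auto simp: partial_deriv_cnj smooth_partial_derivs)

lemma partial_deriv_dilate:
  "smooth f \<Longrightarrow> partial_deriv i (\<lambda>x. f (r *\<^sub>R x)) = (\<lambda>x. of_real r * partial_deriv i f (r *\<^sub>R x))"
  by (intro has_partial_deriv_imp_eq has_partial_deriv_dilate smooth_has_partial_deriv)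

lemma partial_deriv_eq_0_open:
  assumes "open S" "x \<in> S" "\<And>y. y \<in> S \<Longrightarrow> f y = c"
  shows "partial_deriv i f x = 0"
proof -
  have "continuous (at 0) (\<lambda>t. x + t *\<^sub>R axis i (1::real))" by (intro continuous_intros)
  then have "\<forall>\<^sub>F t in at 0. x + t *\<^sub>R axis i (1::real) \<in> S"
    using assms(1,2) unfolding continuous_at by (intro topological_tendstoD) auto
  then have "\<forall>\<^sub>F t in nhds 0. f (x + t *\<^sub>R axis i (1::real)) = c"
    using assms(2,3) by (auto simp: eventually_at_filter elim!: eventually_mono)
  then have "((\<lambda>t. f (x + t *\<^sub>R axis i 1)) has_vector_derivative 0) (at 0) \<longleftrightarrow>
      ((\<lambda>t::real. c) has_vector_derivative 0) (at 0)"
    by (intro has_vector_derivative_cong_ev) (auto elim!: eventually_mono dest: eventually_nhds_x_imp_x)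
  then show ?thesis
    by (simp add: partial_deriv_def vector_derivative_at)
qed

text \<open>A quotient u / (u + v) with u vanishing inside radius 1 and v outside radius 2. Both
  depend on the squared norm, because the norm is not smooth at 0. Shrunken copies cut off near the
  puncture; the complements of stretched copies cut off at infinity.\<close>

lemma smooth_cutoff_exists:
  obtains \<psi> :: "real^'n::finite \<Rightarrow> complex" and M :: real where
    "smooth \<psi>"
    "\<And>x. norm x \<le> 1 \<Longrightarrow> \<psi> x = 0" "\<And>x. 2 \<le> norm x \<Longrightarrow> \<psi> x = 1"
    "\<And>x. cmod (\<psi> x) \<le> 1" "\<And>x. cmod (1 - \<psi> x) \<le> 1"
    "\<And>i x. cmod (partial_deriv i \<psi> x) \<le> M" "\<And>i x. cmod (partial_derivs [i, i] \<psi> x) \<le> M"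
    "\<And>i x. norm x < 1 \<or> 2 < norm x \<Longrightarrow> partial_deriv i \<psi> x = 0"
    "\<And>i x. norm x < 1 \<or> 2 < norm x \<Longrightarrow> partial_derivs [i, i] \<psi> x = 0"
proof -
  define u where "u = (\<lambda>x::real^'n. flat 1 ((norm x)\<^sup>2 - 1))"
  define v where "v = (\<lambda>x::real^'n. flat 1 (4 - (norm x)\<^sup>2))"
  define \<psi> where "\<psi> = (\<lambda>x. complex_of_real (u x) * inverse (complex_of_real (u x) + complex_of_real (v x)))"
  have nonneg: "0 \<le> u x" "0 \<le> v x" for x by (auto simp: u_def v_def flat_1_nonneg)
  have pos: "0 < u x + v x" for x
  proof (cases "1 < (norm x)\<^sup>2")
    case True
    then have "0 < u x" by (simp add: u_def flat_1_pos)
    then show ?thesis using nonneg(2)[of x] by linarith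
  next
    case False
    then have "0 < v x" by (simp add: v_def flat_1_pos)
    then show ?thesis using nonneg(1)[of x] by linarith
  qed
  have smq: "smooth (\<lambda>x::real^'n. of_real ((norm x)\<^sup>2 - 1))" "smooth (\<lambda>x::real^'n. of_real (4 - (norm x)\<^sup>2))"
    unfolding of_real_diff by (intro smooth_diff smooth_norm_square smooth_intros(1))+
  have sm: "smooth \<psi>"
    unfolding \<psi>_def u_def v_def
  proof (intro smooth_intros smq)
    show "complex_of_real (flat 1 ((norm x)\<^sup>2 - 1)) + complex_of_real (flat 1 (4 - (norm x)\<^sup>2)) \<noteq> 0" for x :: "real^'n"
      using pos[of x] unfolding u_def v_def of_real_add[symmetric] of_real_eq_0_iff by linarith
  qed
  have \<psi>_eq: "\<psi> x = of_real (u x / (u x + v x))" for x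
    by (simp add: \<psi>_def divide_inverse)
  have 0: "\<psi> x = 0" if "norm x \<le> 1" for x
  proof -
    have "(norm x)\<^sup>2 \<le> 1" using that by (simp add: power_le_one)
    then show ?thesis by (simp add: \<psi>_eq u_def flat_nonpos)
  qed
  have 1: "\<psi> x = 1" if "2 \<le> norm x" for x
  proof -
    have "2\<^sup>2 \<le> (norm x)\<^sup>2" using that by (intro power_mono) auto
    then have "v x = 0" by (simp add: v_def flat_nonpos)
    then show ?thesis using pos[of x] by (simp add: \<psi>_eq)
  qed
  have le1: "cmod (\<psi> x) \<le> 1" for x
    unfolding \<psi>_eq norm_of_real using nonneg[of x] pos[of x] by (simp add: divide_le_eq)
  have le1': "cmod (1 - \<psi> x) \<le> 1" for x
  proof -
    have "1 - \<psi> x = of_real (v x / (u x + v x))"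
      using pos[of x] by (simp add: \<psi>_eq field_simps flip: of_real_add)
    then show ?thesis using nonneg[of x] pos[of x] by (simp add: divide_le_eq norm_divide del: of_real_divide of_real_add)
  qed
  have open2: "open {x::real^'n. 2 < norm x}" by (intro open_Collect_less continuous_intros)
  have d1: "partial_deriv i \<psi> x = 0" if "norm x < 1 \<or> 2 < norm x" for i x
    using that
  proof
    assume "norm x < 1"
    then show ?thesis using 0 by (intro partial_deriv_eq_0_open[of "ball 0 1" x \<psi> 0]) auto
  next
    assume "2 < norm x"
    then show ?thesis using 1 open2 by (intro partial_deriv_eq_0_open[of "{x. 2 < norm x}" x \<psi> 1]) auto
  qed
  have d2: "partial_derivs [i, i] \<psi> x = 0" if "norm x < 1 \<or> 2 < norm x" for i x
    using that
  proof
    assume "norm x < 1"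
    then show ?thesis using d1 by (auto intro!: partial_deriv_eq_0_open[of "ball 0 1" x _ 0])
  next
    assume "2 < norm x"
    then show ?thesis using d1 open2 by (auto intro!: partial_deriv_eq_0_open[of "{x. 2 < norm x}" x _ 0])
  qed
  have bnd: "\<exists>B. \<forall>x. cmod (f x) \<le> B" if f: "smooth f" "\<And>x. 2 < norm x \<Longrightarrow> f x = 0" for f :: "real^'n \<Rightarrow> complex"
  proof -
    have "compact (f ` cball 0 2)"
      by (intro compact_continuous_image compact_cball continuous_on_subset[OF smooth_continuous[OF f(1)]]) auto
    then obtain B where B: "\<And>x. x \<in> cball 0 2 \<Longrightarrow> cmod (f x) \<le> B"
      using compact_imp_bounded bounded_iff by (metis (no_types, lifting) imageI)
    have "cmod (f x) \<le> max 0 B" for x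
      using B[of x] f(2)[of x] by (cases "2 < norm x") auto
    then show ?thesis by blast
  qed
  have "\<exists>B. \<forall>x. cmod (partial_deriv i \<psi> x) \<le> B" "\<exists>B. \<forall>x. cmod (partial_derivs [i, i] \<psi> x) \<le> B" for i
    by (rule bnd[OF smooth_partial_deriv[OF sm] d1], simp) (rule bnd[OF smooth_partial_derivs[OF sm] d2], simp)
  then obtain B1 B2 where B: "\<And>i x. cmod (partial_deriv i \<psi> x) \<le> B1 i"
      "\<And>i x. cmod (partial_derivs [i, i] \<psi> x) \<le> B2 i" by metis
  \<comment> \<open>Summing the bounds over all directions yields one constant valid for each of
    them.\<close>
  define M where "M = (\<Sum>i\<in>UNIV. B1 i) + (\<Sum>i\<in>UNIV. B2 i)"
  have nn: "0 \<le> B1 i" "0 \<le> B2 i" for i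
    using B[of i 0] norm_ge_zero order_trans by blast+
  have "B1 i \<le> M" "B2 i \<le> M" for i
  proof -
    have "B1 i \<le> (\<Sum>i\<in>UNIV. B1 i)" "B2 i \<le> (\<Sum>i\<in>UNIV. B2 i)"
      by (intro member_le_sum nn; simp)+
    moreover have "0 \<le> (\<Sum>i\<in>UNIV. B1 i)" "0 \<le> (\<Sum>i\<in>UNIV. B2 i)"
      by (intro sum_nonneg nn)+
    ultimately show "B1 i \<le> M" "B2 i \<le> M" unfolding M_def by linarith+
  qed
  then have B': "cmod (partial_deriv i \<psi> x) \<le> M" "cmod (partial_derivs [i, i] \<psi> x) \<le> M" for i x
    using B order_trans by blast+
  show ?thesis by (rule that[OF sm 0 1 le1 le1' B' d1 d2])
qed


subsection \<open>Test functions\<close>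

lemma test_functionsI:
  assumes "smooth f" "\<And>x. R < norm x \<Longrightarrow> f x = 0"
  shows "f \<in> test_functions UNIV"
proof -
  have "{x. f x \<noteq> 0} \<subseteq> cball 0 R" using assms(2) by (force simp: not_less)
  then have "bounded {x. f x \<noteq> 0}" using bounded_cball bounded_subset by blast
  then show ?thesis using assms(1) by (simp add: test_functions_def compact_closure)
qed

lemma test_functions_smooth: "f \<in> test_functions U \<Longrightarrow> smooth f"
  by (simp add: test_functions_def)

lemma test_functions_support:
  assumes "f \<in> test_functions U"
  obtains R where "0 < R" "\<And>x. R < norm x \<Longrightarrow> f x = 0"
proof -
  have "bounded {x. f x \<noteq> 0}"
    using assms by (auto simp: test_functions_def intro: bounded_subset[OF compact_imp_bounded closure_subset])
  then obtain R where R: "0 < R" "\<And>x. f x \<noteq> 0 \<Longrightarrow> norm x \<le> R"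
    unfolding bounded_pos by auto
  then show ?thesis using that[of R] by (metis not_less)
qed

lemma test_functions_UNIV: "f \<in> test_functions U \<Longrightarrow> f \<in> test_functions UNIV"
  by (simp add: test_functions_def)

lemma test_functions_puncturedI:
  assumes f: "f \<in> test_functions UNIV" and \<epsilon>: "0 < \<epsilon>" and 0: "\<And>x. norm x < \<epsilon> \<Longrightarrow> f x = 0"
  shows "f \<in> test_functions (- {0})"
proof -
  have "ball 0 \<epsilon> \<inter> closure {x. f x \<noteq> 0} = {}"
    using 0 by (subst open_Int_closure_eq_empty) auto
  then have "0 \<notin> closure {x. f x \<noteq> 0}" using \<epsilon> by (metis centre_in_ball disjoint_iff)
  then show ?thesis using f by (auto simp: test_functions_def)
qed

lemma test_functions_punctured_0: "f \<in> test_functions (- {0}) \<Longrightarrow> f 0 = 0"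
  using closure_subset[of "{x. f x \<noteq> 0}"] unfolding test_functions_def by blast

lemma test_functions_mult:
  assumes "f \<in> test_functions UNIV" "smooth g"
  shows "(\<lambda>x. f x * g x) \<in> test_functions UNIV" "(\<lambda>x. g x * f x) \<in> test_functions UNIV"
proof -
  obtain R where "\<And>x. R < norm x \<Longrightarrow> f x = 0" using test_functions_support[OF assms(1)] by metis
  then show "(\<lambda>x. f x * g x) \<in> test_functions UNIV" "(\<lambda>x. g x * f x) \<in> test_functions UNIV"
    using assms by (auto intro: test_functionsI[of _ R] smooth_intros(4)[OF test_functions_smooth] smooth_intros(4)[OF _ test_functions_smooth])
qed

lemma test_functions_add:
  assumes "f \<in> test_functions UNIV" "g \<in> test_functions UNIV"
  shows "(\<lambda>x. f x + g x) \<in> test_functions UNIV"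
proof -
  obtain R where R: "\<And>x. R < norm x \<Longrightarrow> f x = 0" using test_functions_support[OF assms(1)] by metis
  obtain R' where R': "\<And>x. R' < norm x \<Longrightarrow> g x = 0" using test_functions_support[OF assms(2)] by metis
  show ?thesis
    using assms R R' by (intro test_functionsI[of _ "max R R'"] smooth_intros(3)) (auto intro: test_functions_smooth)
qed

lemma test_functions_cmult: "f \<in> test_functions UNIV \<Longrightarrow> (\<lambda>x. c * f x) \<in> test_functions UNIV"
  by (intro test_functions_mult smooth_intros)

lemma test_functions_cnj:
  assumes "f \<in> test_functions UNIV"
  shows "(\<lambda>x. cnj (f x)) \<in> test_functions UNIV"
proof -
  obtain R where "\<And>x. R < norm x \<Longrightarrow> f x = 0" using test_functions_support[OF assms(1)] by metis
  then show ?thesis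
    by (intro test_functionsI[of _ R] smooth_intros(7) test_functions_smooth[OF assms]) simp
qed

lemma test_functions_partial_deriv:
  assumes "f \<in> test_functions UNIV"
  shows "partial_deriv i f \<in> test_functions UNIV"
proof -
  obtain R where R: "\<And>x. R < norm x \<Longrightarrow> f x = 0" using test_functions_support[OF assms(1)] by metis
  have "open {x::real^'a. R < norm x}" by (intro open_Collect_less continuous_intros)
  then have "partial_deriv i f x = 0" if "R < norm x" for x
    using R that by (intro partial_deriv_eq_0_open[of "{x. R < norm x}" x f 0]) auto
  then show ?thesis
    using assms by (intro test_functionsI[of _ R] smooth_partial_deriv test_functions_smooth)
qed

lemma test_functions_partial_derivs:
  "f \<in> test_functions UNIV \<Longrightarrow> partial_derivs is f \<in> test_functions UNIV"
  by (induction "is") (auto intro: test_functions_partial_deriv)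

lemma test_functions_bounded:
  assumes "f \<in> test_functions UNIV"
  obtains B where "0 < B" "\<And>x. cmod (f x) \<le> B"
proof -
  obtain R where R: "\<And>x. R < norm x \<Longrightarrow> f x = 0" using test_functions_support[OF assms(1)] by metis
  have "compact (f ` cball 0 R)"
    using assms by (intro compact_continuous_image compact_cball
        continuous_on_subset[OF smooth_continuous[OF test_functions_smooth]]) auto
  then obtain B where B: "0 < B" "\<And>x. x \<in> cball 0 R \<Longrightarrow> cmod (f x) \<le> B"
    using compact_imp_bounded bounded_pos by (metis (no_types, lifting) imageI)
  have "cmod (f x) \<le> B" for x
    using B R[of x] by (cases "R < norm x") auto
  then show ?thesis using that B by blast
qed

lemma test_functions_measurable: "f \<in> test_functions UNIV \<Longrightarrow> f \<in> borel_measurable borel"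
  by (intro borel_measurable_continuous_onI smooth_continuous test_functions_smooth)

lemma test_functions_integrable:
  assumes "f \<in> test_functions UNIV"
  shows "integrable lborel f"
proof -
  obtain R where R: "\<And>x. R < norm x \<Longrightarrow> f x = 0" using test_functions_support[OF assms(1)] by metis
  have "integrable lborel (\<lambda>x. indicator (cball 0 R) x *\<^sub>R f x)"
    by (intro borel_integrable_compact[of "cball 0 R" f, unfolded set_integrable_def] compact_cball
        continuous_on_subset[OF smooth_continuous[OF test_functions_smooth[OF assms]]]) auto
  also have "(\<lambda>x. indicator (cball 0 R) x *\<^sub>R f x) = f"
    using R by (force simp: fun_eq_iff indicator_def)
  finally show ?thesis .
qed

lemma test_functions_square_integrable:
  assumes "f \<in> test_functions UNIV" shows "square_integrable f"
  using test_functions_bounded[OF assms] square_integrable_of_bounded[OF test_functions_integrable[OF assms]] by metis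

section \<open>Integration by parts and symbols of derivatives\<close>

text \<open>The mean value inequality along a coordinate line; it supplies the majorant when
  difference quotients are integrated.\<close>

lemma smooth_difference_quotient_bound:
  assumes f: "smooth f" and B: "\<And>x. cmod (partial_deriv i f x) \<le> B"
  shows "cmod (f (x + t *\<^sub>R axis i 1) - f x) \<le> B * \<bar>t\<bar>"
proof -
  have d: "((\<lambda>s. f (x + s *\<^sub>R axis i 1)) has_vector_derivative partial_deriv i f (x + s *\<^sub>R axis i 1)) (at s)" for s
  proof -
    have "((\<lambda>h. f ((x + s *\<^sub>R axis i 1) + h *\<^sub>R axis i 1)) has_vector_derivative partial_deriv i f (x + s *\<^sub>R axis i 1)) (at 0)"
      using smooth_has_partial_deriv[OF f, of i] by (simp only: has_partial_deriv_def)
    then have *: "((\<lambda>h. f ((x + s *\<^sub>R axis i 1) + h *\<^sub>R axis i 1)) has_vector_derivative partial_deriv i f (x + s *\<^sub>R axis i 1)) (at (s - s))"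
      by simp
    have "((\<lambda>r. r - s) has_vector_derivative 1) (at s)"
      unfolding has_real_derivative_iff_has_vector_derivative[symmetric] by (auto intro!: derivative_eq_intros)
    from vector_diff_chain_at[OF this *] show ?thesis
      by (simp add: o_def algebra_simps)
  qed
  have "cmod (f (x + t *\<^sub>R axis i 1) - f (x + 0 *\<^sub>R axis i 1)) \<le> B * norm (t - 0)"
  proof (rule differentiable_bound)
    show "convex (UNIV :: real set)" by simp
    show "((\<lambda>s. f (x + s *\<^sub>R axis i 1)) has_derivative (\<lambda>h. h *\<^sub>R partial_deriv i f (x + s *\<^sub>R axis i 1))) (at s within UNIV)" for s
      using d[of s] by (simp add: has_vector_derivative_def)
    show "onorm (\<lambda>h. h *\<^sub>R partial_deriv i f (x + s *\<^sub>R axis i 1)) \<le> B" for s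
      by (rule onorm_le) (use B in \<open>auto simp: mult.commute[of B] intro!: mult_left_mono\<close>)
  qed auto
  then show ?thesis by simp
qed

text \<open>Integrals of difference quotients vanish by translation invariance.\<close>
lemma integral_partial_deriv_eq_0:
  fixes f :: "real^'n::finite \<Rightarrow> complex"
  assumes f: "f \<in> test_functions UNIV"
  shows "(LINT x|lborel. partial_deriv i f x) = 0"
proof -
  have sm: "smooth f" by (rule test_functions_smooth[OF f])
  have [measurable]: "f \<in> borel_measurable borel" by (rule test_functions_measurable[OF f])
  have [measurable]: "partial_deriv i f \<in> borel_measurable borel"
    by (intro test_functions_measurable test_functions_partial_deriv f)
  obtain R where R: "\<And>x. R < norm x \<Longrightarrow> f x = 0" using test_functions_support[OF f] by metis
  obtain B where B: "0 < B" "\<And>x. cmod (partial_deriv i f x) \<le> B"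
    using test_functions_bounded[OF test_functions_partial_deriv[OF f]] by metis
  define h where "h n = 1 / real (Suc n)" for n
  have h: "0 < h n" "h n \<le> 1" for n by (auto simp: h_def)
  have h0: "h \<longlonglongrightarrow> 0" unfolding h_def by (rule LIMSEQ_Suc, rule lim_const_over_n[of "1::real", simplified])
  define q where "q n x = (f (h n *\<^sub>R axis i 1 + x) - f x) / of_real (h n)" for n x
  have intf: "integrable lborel f" by (rule test_functions_integrable[OF f])
  have "(LINT x|lborel. q n x) = 0" for n
  proof -
    have "(LINT x|lborel. f (h n *\<^sub>R axis i 1 + x)) = (LINT x|lborel. f x)"
      "integrable lborel (\<lambda>x. f (h n *\<^sub>R axis i 1 + x))"
      using lborel_integral_affine[of 1 f "h n *\<^sub>R axis i 1"] intf by simp_all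
    then show ?thesis using intf by (simp add: q_def)
  qed
  moreover have "(\<lambda>n. LINT x|lborel. q n x) \<longlonglongrightarrow> (LINT x|lborel. partial_deriv i f x)"
  proof (rule integral_dominated_convergence)
    \<comment> \<open>The steps \<open>h n\<close> are at most 1, so every difference quotient is
      supported in the ball of radius R + 1.\<close>
    show "integrable lborel (\<lambda>x::real^'n. indicator (cball 0 (R + 1)) x *\<^sub>R B :: real)"
      using emeasure_lborel_cball_finite[of "0::real^'n" "R + 1"] by (intro integrable_indicator) auto
    show "AE x in lborel. (\<lambda>n. q n x) \<longlonglongrightarrow> partial_deriv i f x"
    proof (rule AE_I2)
      fix x
      have "((\<lambda>t. f (x + t *\<^sub>R axis i 1)) has_vector_derivative partial_deriv i f x) (at 0)"
        using smooth_has_partial_deriv[OF sm, of i] by (simp add: has_partial_deriv_def)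
      note D = this
      have "((\<lambda>t. (f (x + t *\<^sub>R axis i 1) - f x) /\<^sub>R t) \<longlongrightarrow> partial_deriv i f x) (at 0)"
      proof -
        from D have *: "((\<lambda>t. cmod (f (x + t *\<^sub>R axis i 1) - f x - t *\<^sub>R partial_deriv i f x) / norm t) \<longlongrightarrow> 0) (at 0)"
          by (simp add: has_vector_derivative_def has_derivative_iff_norm)
        have "((\<lambda>t. cmod ((f (x + t *\<^sub>R axis i 1) - f x) /\<^sub>R t - partial_deriv i f x)) \<longlongrightarrow> 0) (at 0)"
        proof (rule Lim_transform_eventually[OF *])
          have "cmod (f (x + t *\<^sub>R axis i 1) - f x - t *\<^sub>R partial_deriv i f x) / norm t =
              cmod ((f (x + t *\<^sub>R axis i 1) - f x) /\<^sub>R t - partial_deriv i f x)" if "t \<noteq> 0" for t :: real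
          proof -
            have "(f (x + t *\<^sub>R axis i 1) - f x) /\<^sub>R t - partial_deriv i f x =
                (f (x + t *\<^sub>R axis i 1) - f x - t *\<^sub>R partial_deriv i f x) /\<^sub>R t"
              using that by (simp add: scaleR_right_diff_distrib)
            then show ?thesis by (simp add: divide_inverse mult.commute)
          qed
          then show "\<forall>\<^sub>F t in at 0. cmod (f (x + t *\<^sub>R axis i 1) - f x - t *\<^sub>R partial_deriv i f x) / norm t =
              cmod ((f (x + t *\<^sub>R axis i 1) - f x) /\<^sub>R t - partial_deriv i f x)"
            by (simp add: eventually_at_filter)
        qed
        then show ?thesis by (simp only: tendsto_norm_zero_iff LIM_zero_iff)
      qed
      moreover have "filterlim h (at 0) sequentially"
      proof -
        have "h n \<noteq> 0" for n using h(1)[of n] by simp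
        then show ?thesis by (simp add: filterlim_at h0)
      qed
      ultimately have "(\<lambda>n. (f (x + h n *\<^sub>R axis i 1) - f x) /\<^sub>R h n) \<longlonglongrightarrow> partial_deriv i f x"
        by (rule filterlim_compose)
      then show "(\<lambda>n. q n x) \<longlonglongrightarrow> partial_deriv i f x"
        by (simp add: q_def scaleR_conv_of_real divide_inverse mult.commute add.commute)
    qed
    show "AE x in lborel. cmod (q n x) \<le> indicator (cball 0 (R + 1)) x *\<^sub>R B" for n
    proof (rule AE_I2)
      fix x
      show "cmod (q n x) \<le> indicator (cball 0 (R + 1)) x *\<^sub>R B"
      proof (cases "norm x \<le> R + 1")
        case True
        have "cmod (f (x + h n *\<^sub>R axis i 1) - f x) \<le> B * h n"
          using smooth_difference_quotient_bound[OF sm B(2), of x "h n"] h(1)[of n] by simp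
        then show ?thesis
          using True h(1)[of n] by (simp add: q_def norm_divide divide_le_eq add.commute)
      next
        case False
        have "norm x \<le> norm (h n *\<^sub>R axis i 1 + x) + norm (h n *\<^sub>R axis i (1::real))"
          by (metis add_diff_cancel_left' norm_triangle_ineq4 add.commute)
        then have "R < norm (h n *\<^sub>R axis i 1 + x)"
          using False h[of n] by simp
        then show ?thesis using False R[of x] R[of "h n *\<^sub>R axis i 1 + x"] by (simp add: q_def)
      qed
    qed
  qed (simp_all add: q_def)
  ultimately show ?thesis by (simp add: LIMSEQ_const_iff)
qed

text \<open>Integration by parts: the product of a wave and f is again a test function, so the
  integral of its derivative vanishes, and the Leibniz rule splits it into the two sides.\<close>

lemma fourier_transform_partial_deriv:
  fixes f :: "real^'n::finite \<Rightarrow> complex"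
  assumes f: "f \<in> test_functions UNIV"
  shows "fourier_transform (partial_deriv i f) \<xi> = \<i> * of_real (\<xi> $ i) * fourier_transform f \<xi>"
proof -
  have sm: "smooth f" by (rule test_functions_smooth[OF f])
  have dw: "partial_deriv i (wave (- \<xi>)) = (\<lambda>x. - (\<i> * of_real (\<xi> $ i)) * wave (- \<xi>) x)"
  proof (rule has_partial_deriv_imp_eq)
    have "has_partial_deriv (\<lambda>x. exp (\<i> * of_real (x \<bullet> (- \<xi>))))
        (\<lambda>x. (\<i> * of_real ((- \<xi>) $ i) + 0 * of_real (x \<bullet> (- \<xi>))) * exp (\<i> * of_real (x \<bullet> (- \<xi>)))) i"
      by (intro has_partial_deriv_chain[OF has_partial_deriv_mult[OF has_partial_deriv_const has_partial_deriv_inner]] DERIV_exp)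
    then show "has_partial_deriv (wave (- \<xi>)) (\<lambda>x. - (\<i> * of_real (\<xi> $ i)) * wave (- \<xi>) x) i"
      by (simp add: wave_def[abs_def] inner_commute)
  qed
  have i1: "integrable lborel (\<lambda>x. wave (- \<xi>) x * partial_deriv i f x)" and i2: "integrable lborel (\<lambda>x. wave (- \<xi>) x * f x)"
    by (intro integrable_wave_mult test_functions_integrable test_functions_partial_deriv f)+
  have "0 = (LINT x|lborel. partial_deriv i (\<lambda>x. wave (- \<xi>) x * f x) x)"
    by (rule integral_partial_deriv_eq_0[symmetric]) (intro test_functions_mult f smooth_wave)
  also have "\<dots> = (LINT x|lborel. wave (- \<xi>) x * partial_deriv i f x - \<i> * of_real (\<xi> $ i) * (wave (- \<xi>) x * f x))"
    unfolding partial_deriv_mult[OF smooth_wave sm] dw by (simp add: algebra_simps)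
  also have "\<dots> = fourier_transform (partial_deriv i f) \<xi> - \<i> * of_real (\<xi> $ i) * fourier_transform f \<xi>"
    unfolding fourier_transform_def fourier_integral_def
    using i1 i2 by (subst Bochner_Integration.integral_diff) auto
  finally show ?thesis by simp
qed


section \<open>The Laplacian on the Fourier side\<close>

text \<open>Origin of the exponent: (1 + |\<xi>|^2)^(-2) decays with order 4, which shared among
  three coordinates leaves 4/3 for each, still more than 1.\<close>

lemma integrable_one_plus_abs_powr: "integrable lborel (\<lambda>t::real. (1 + \<bar>t\<bar>) powr (- 4 / 3))"
proof -
  let ?f = "\<lambda>t::real. indicator {0..} t * (1 + t) powr (- 4 / 3)"
  have "(\<integral>\<^sup>+t. ennreal ((1 + t) powr (- 4 / 3)) * indicator {0..} t \<partial>lborel) = 0 - (- 3 * (1 + 0) powr (- 1 / 3) :: real)"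
  proof (rule nn_integral_FTC_atLeast)
    show "((\<lambda>t::real. - 3 * (1 + t) powr (- 1 / 3)) has_real_derivative (1 + x) powr (- 4 / 3)) (at x)" if "0 \<le> x" for x
      using that by (auto intro!: derivative_eq_intros)
    have "((\<lambda>t::real. (1 + t) powr (- 1 / 3)) \<longlongrightarrow> 0) at_top"
      by (rule tendsto_neg_powr) (auto intro: filterlim_tendsto_add_at_top[OF tendsto_const] filterlim_ident)
    from tendsto_mult[OF tendsto_const[of "- 3"] this]
    show "((\<lambda>t::real. - 3 * (1 + t) powr (- 1 / 3)) \<longlongrightarrow> 0) at_top" by simp
  qed auto
  then have "integrable lborel ?f"
    by (intro integrableI_bounded) (auto simp: ennreal_mult'' mult.commute ennreal_indicator)
  then have "integrable lborel (\<lambda>t. ?f t + ?f (0 + - 1 * t))"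
    by (intro Bochner_Integration.integrable_add lborel_integrable_real_affine) auto
  then show ?thesis
    by (rule Bochner_Integration.integrable_bound) (auto intro!: AE_I2 simp: indicator_def)
qed

text \<open>The symbol of 1 minus the Laplacian. Unlike |\<xi>|^2 it has no zero, so it can be
  divided by.\<close>

definition bessel :: "'a::euclidean_space \<Rightarrow> complex" where
  "bessel \<xi> = of_real (1 + (norm \<xi>)\<^sup>2)"

lemma bessel_nonzero [simp]: "bessel \<xi> \<noteq> 0"
  unfolding bessel_def of_real_eq_0_iff
  using zero_le_power2[of "norm \<xi>"] by linarith

lemma cnj_bessel [simp]: "cnj (bessel \<xi>) = bessel \<xi>"
  by (simp only: bessel_def complex_cnj_complex_of_real)

lemma norm_bessel: "cmod (bessel \<xi>) = 1 + (norm \<xi>)\<^sup>2"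
  unfolding bessel_def norm_of_real by (simp add: add_nonneg_nonneg)

lemma measurable_bessel [measurable]: "bessel \<in> borel_measurable borel"
  unfolding bessel_def[abs_def] by measurable

text \<open>The square is dominated by a product of one-variable functions of order 4/3, one for
  each coordinate, and such products are integrated by \<open>integral_prod_Basis\<close>.\<close>

lemma square_integrable_inverse_bessel:
  assumes d: "DIM('a::euclidean_space) \<le> 3"
  shows "square_integrable (\<lambda>\<xi>::'a. 1 / bessel \<xi>)"
  unfolding square_integrable_def
proof
  have "integrable lborel (\<lambda>\<xi>::'a. \<Prod>b\<in>Basis. complex_of_real ((1 + \<bar>\<xi> \<bullet> b\<bar>) powr (- 4 / 3)))"
    using integrable_one_plus_abs_powr by (intro integral_prod_Basis(1)) simp
  then have "integrable lborel (\<lambda>\<xi>::'a. 4 *\<^sub>R cmod (\<Prod>b\<in>Basis. complex_of_real ((1 + \<bar>\<xi> \<bullet> b\<bar>) powr (- 4 / 3))))"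
    by (intro integrable_scaleR_right integrable_norm)
  then show "integrable lborel (\<lambda>\<xi>::'a. (cmod (1 / bessel \<xi>))\<^sup>2)"
  proof (rule Bochner_Integration.integrable_bound)
    have "(1 / (1 + (norm \<xi>)\<^sup>2))\<^sup>2 \<le> 4 * (\<Prod>b\<in>Basis. (1 + \<bar>\<xi> \<bullet> b\<bar>) powr (- 4 / 3))" for \<xi> :: 'a
    proof -
      \<comment> \<open>The factor 2 gives (1 + |\<xi> \<bullet> b|)^2 \<le> r for each basis vector
        b; its square is the 4 in the claim.\<close>
      define r where "r = 2 * (1 + (norm \<xi>)\<^sup>2)"
      have r_eq: "r = 2 + 2 * (norm \<xi>)\<^sup>2" by (simp add: r_def)
      have "2 * 1 \<le> r" unfolding r_def by (intro mult_left_mono) auto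
      then have r: "1 \<le> r" and r0: "0 < r" by auto
      have le: "r powr (- 2 / 3) \<le> (1 + \<bar>\<xi> \<bullet> b\<bar>) powr (- 4 / 3)" if "b \<in> Basis" for b
      proof -
        have "\<bar>\<xi> \<bullet> b\<bar>\<^sup>2 \<le> (norm \<xi>)\<^sup>2" by (intro power_mono Basis_le_norm that) simp
        moreover have "(1 + \<bar>\<xi> \<bullet> b\<bar>)\<^sup>2 + (1 - \<bar>\<xi> \<bullet> b\<bar>)\<^sup>2 = 2 + 2 * \<bar>\<xi> \<bullet> b\<bar>\<^sup>2"
          unfolding power2_eq_square by (simp add: algebra_simps)
        ultimately have "(1 + \<bar>\<xi> \<bullet> b\<bar>)\<^sup>2 \<le> r"
          using zero_le_power2[of "1 - \<bar>\<xi> \<bullet> b\<bar>"] unfolding r_eq by linarith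
        then have "r powr (- 2 / 3) \<le> ((1 + \<bar>\<xi> \<bullet> b\<bar>)\<^sup>2) powr (- 2 / 3)"
          by (intro powr_mono2') auto
        also have "\<dots> = (1 + \<bar>\<xi> \<bullet> b\<bar>) powr (- 4 / 3)"
          by (simp add: powr_powr flip: powr_numeral)
        finally show ?thesis .
      qed
      have "(1 / (1 + (norm \<xi>)\<^sup>2))\<^sup>2 = 4 * r powr (- 2)"
      proof -
        have "r powr (- 2) = 1 / r\<^sup>2"
          using r0 by (simp add: powr_minus divide_inverse)
        moreover have "r\<^sup>2 = 4 * (1 + (norm \<xi>)\<^sup>2)\<^sup>2"
          unfolding r_def power_mult_distrib by simp
        ultimately show ?thesis by (simp add: power_divide)
      qed
      \<comment> \<open>The bound on the dimension enters here: as r \<ge> 1 and d \<le> 3, the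
        exponent -2 may be raised to -2d/3.\<close>
      also have "r powr (- 2) \<le> r powr (- 2 / 3 * real DIM('a))"
        using d r by (intro powr_mono) auto
      also have "\<dots> = (\<Prod>b\<in>(Basis :: 'a set). r powr (- 2 / 3))"
        using r0 by (simp add: powr_power mult.commute)
      also have "\<dots> \<le> (\<Prod>b\<in>Basis. (1 + \<bar>\<xi> \<bullet> b\<bar>) powr (- 4 / 3))"
        by (intro prod_mono conjI le) auto
      finally show ?thesis by simp
    qed
    then show "AE \<xi> in lborel. norm ((cmod (1 / bessel \<xi>))\<^sup>2) \<le>
        norm (4 *\<^sub>R cmod (\<Prod>b\<in>(Basis::'a set). complex_of_real ((1 + \<bar>\<xi> \<bullet> b\<bar>) powr (- 4 / 3))))"
      by (intro AE_I2) (simp add: norm_divide norm_bessel prod_norm[symmetric] prod_nonneg)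
  qed measurable
qed measurable

text \<open>The symbols of elements of W^{2,2}, as \<open>sobolev_2_iff\<close> shows.\<close>

definition laplace_symbol :: "('a::euclidean_space \<Rightarrow> complex) \<Rightarrow> bool" where
  "laplace_symbol h \<longleftrightarrow>
     square_integrable h \<and> square_integrable (\<lambda>\<xi>. of_real ((norm \<xi>)\<^sup>2) * h \<xi>)"

lemma laplace_symbol_bessel:
  assumes "laplace_symbol h" shows "square_integrable (\<lambda>\<xi>. bessel \<xi> * h \<xi>)"
proof -
  have "(\<lambda>\<xi>. bessel \<xi> * h \<xi>) = (\<lambda>\<xi>. h \<xi> + of_real ((norm \<xi>)\<^sup>2) * h \<xi>)"
    by (simp add: bessel_def fun_eq_iff distrib_right)
  then show ?thesis using assms by (simp add: laplace_symbol_def square_integrable_add)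
qed

lemma laplace_symbol_iff: "laplace_symbol h \<longleftrightarrow> square_integrable (\<lambda>\<xi>. bessel \<xi> * h \<xi>)"
proof
  assume b: "square_integrable (\<lambda>\<xi>. bessel \<xi> * h \<xi>)"
  then have "(\<lambda>\<xi>. bessel \<xi> * h \<xi> / bessel \<xi>) \<in> borel_measurable borel"
    by (intro borel_measurable_divide) (auto intro: square_integrable_measurable)
  then have [measurable]: "h \<in> borel_measurable borel" by simp
  show "laplace_symbol h"
    unfolding laplace_symbol_def
  proof
    show "square_integrable h"
      by (rule square_integrable_bound[OF b]) (auto simp: norm_mult norm_bessel distrib_right)
    show "square_integrable (\<lambda>\<xi>. of_real ((norm \<xi>)\<^sup>2) * h \<xi>)"
    proof (rule square_integrable_bound[OF b])
      show "cmod (of_real ((norm \<xi>)\<^sup>2) * h \<xi>) \<le> cmod (bessel \<xi> * h \<xi>)" for \<xi>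
        by (auto simp: norm_mult norm_bessel norm_power intro!: mult_right_mono)
    qed measurable
  qed
qed (rule laplace_symbol_bessel)

lemma laplace_symbol_square_integrable: "laplace_symbol h \<Longrightarrow> square_integrable h"
  by (simp add: laplace_symbol_def)

text \<open>h is the product of 1 / \<open>bessel\<close> and \<open>bessel\<close> h, both in L2.
  This is the Sobolev embedding in dimension at most 3: it gives continuous representatives and
  turns the value at 0 into an integral.\<close>

lemma laplace_symbol_integrable:
  assumes d: "DIM('a::euclidean_space) \<le> 3" and h: "laplace_symbol (h :: 'a \<Rightarrow> complex)"
  shows "integrable lborel h"
  using square_integrable_mult[OF square_integrable_inverse_bessel[OF d] laplace_symbol_bessel[OF h]]
  by simp

section \<open>Values of continuous representatives\<close>

lemma continuous_AE_eq:
  fixes f g :: "'a::euclidean_space \<Rightarrow> complex"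
  assumes "continuous_on UNIV f" "continuous_on UNIV g" "AE x in lborel. f x = g x"
  shows "f = g"
proof
  fix x
  have "closed {x. f x = g x}" by (rule closed_Collect_eq[OF assms(1,2)])
  moreover have "AE x in lebesgue. x \<in> {x. f x = g x}"
    using AE_completion[OF assms(3)] by simp
  ultimately show "f x = g x" using mem_closed_if_AE_lebesgue by blast
qed

lemma point_value_eq:
  assumes "continuous_on UNIV f" "square_integrable f"
  shows "point_value (to_L2 f) x = f x"
proof -
  have "(THE g. continuous_on UNIV g \<and> square_integrable g \<and> to_L2 g = to_L2 f) = f"
    using assms continuous_AE_eq by (intro the_equality) (auto simp: to_L2_eq_iff)
  then show ?thesis by (simp add: point_value_def)
qed

lemma laplace_symbol_inv_fourier:
  fixes h :: "'a::euclidean_space \<Rightarrow> complex"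
  assumes d: "DIM('a) \<le> 3" and h: "laplace_symbol h"
  defines "u \<equiv> \<lambda>x. fourier_integral h x / of_real (fourier_norm TYPE('a))"
  shows "continuous_on UNIV u" "square_integrable u" "inv_fourier (to_L2 h) = to_L2 u"
proof -
  note h' = laplace_symbol_integrable[OF d h] laplace_symbol_square_integrable[OF h]
  show "continuous_on UNIV u"
    unfolding u_def by (intro continuous_intros continuous_fourier_integral h') auto
  show "square_integrable u" unfolding u_def by (rule square_integrable_fourier_integral[OF h'])
  show "inv_fourier (to_L2 h) = to_L2 u" unfolding u_def by (rule inv_fourier_to_L2[OF h'])
qed

lemma point_value_inv_fourier:
  fixes h :: "'a::euclidean_space \<Rightarrow> complex"
  assumes "DIM('a) \<le> 3" "laplace_symbol h"
  shows "point_value (inv_fourier (to_L2 h)) 0 = (LINT \<xi>|lborel. h \<xi>) / of_real (fourier_norm TYPE('a))"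
  using laplace_symbol_inv_fourier[OF assms] by (simp add: point_value_eq fourier_integral_def)

section \<open>The Laplacian of test functions\<close>

definition neg_laplacian :: "(real^'n::finite \<Rightarrow> complex) \<Rightarrow> real^'n \<Rightarrow> complex" where
  "neg_laplacian f x = - (\<Sum>i\<in>UNIV. partial_derivs [i, i] f x)"

lemma test_functions_sum:
  "finite I \<Longrightarrow> (\<And>i. i \<in> I \<Longrightarrow> f i \<in> test_functions UNIV) \<Longrightarrow> (\<lambda>x. \<Sum>i\<in>I. f i x) \<in> test_functions UNIV"
proof (induction I rule: finite_induct)
  case empty
  show ?case by (auto intro: test_functionsI smooth_intros(1))
qed (auto intro: test_functions_add)

lemma test_functions_neg_laplacian:
  assumes "f \<in> test_functions UNIV" shows "neg_laplacian f \<in> test_functions UNIV"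
proof -
  have "(\<lambda>x. - 1 * (\<Sum>i\<in>UNIV. partial_derivs [i, i] f x)) \<in> test_functions UNIV"
    by (intro test_functions_cmult test_functions_sum test_functions_partial_derivs assms) simp
  then show ?thesis by (simp add: neg_laplacian_def[abs_def])
qed

lemma neg_laplacian_cnj: "smooth f \<Longrightarrow> neg_laplacian (\<lambda>x. cnj (f x)) = (\<lambda>x. cnj (neg_laplacian f x))"
  unfolding neg_laplacian_def partial_derivs_cnj by (simp add: fun_eq_iff)

lemma neg_laplacian_add:
  "smooth f \<Longrightarrow> smooth g \<Longrightarrow> neg_laplacian (\<lambda>x. f x + g x) = (\<lambda>x. neg_laplacian f x + neg_laplacian g x)"
  unfolding neg_laplacian_def partial_derivs_add by (simp add: fun_eq_iff sum.distrib)

lemma neg_laplacian_cmult: "smooth f \<Longrightarrow> neg_laplacian (\<lambda>x. c * f x) = (\<lambda>x. c * neg_laplacian f x)"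
  unfolding neg_laplacian_def partial_derivs_cmult by (simp add: fun_eq_iff sum_distrib_left)

lemma partial_derivs_mult_2:
  assumes "smooth f" "smooth g"
  shows "partial_derivs [i, i] (\<lambda>x. f x * g x) x =
    f x * partial_derivs [i, i] g x + 2 * (partial_deriv i f x * partial_deriv i g x) + partial_derivs [i, i] f x * g x"
  using assms
  by (simp add: partial_deriv_mult partial_deriv_add smooth_partial_deriv smooth_intros(4) algebra_simps)

lemma fourier_transform_partial_derivs:
  assumes "f \<in> test_functions UNIV"
  shows "fourier_transform (partial_derivs is f) \<xi> = (\<Prod>i\<leftarrow>is. \<i> * of_real (\<xi> $ i)) * fourier_transform f \<xi>"
  by (induction "is")
    (simp_all add: fourier_transform_partial_deriv test_functions_partial_derivs assms mult.assoc)

lemma fourier_transform_neg_laplacian: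
  fixes f :: "real^'n::finite \<Rightarrow> complex"
  assumes f: "f \<in> test_functions UNIV"
  shows "fourier_transform (neg_laplacian f) \<xi> = of_real ((norm \<xi>)\<^sup>2) * fourier_transform f \<xi>"
proof -
  have n: "(norm \<xi>)\<^sup>2 = (\<Sum>i\<in>UNIV. (\<xi> $ i)\<^sup>2)"
    unfolding power2_norm_eq_inner by (simp add: inner_vec_def power2_eq_square)
  have "fourier_transform (neg_laplacian f) \<xi> = - (\<Sum>i\<in>UNIV. fourier_transform (partial_derivs [i, i] f) \<xi>)"
    unfolding fourier_transform_def fourier_integral_def neg_laplacian_def
    by (subst Bochner_Integration.integral_sum[symmetric])
      (simp_all add: integrable_wave_mult test_functions_integrable test_functions_partial_derivs f
        sum_distrib_left del: partial_derivs.simps)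
  also have "\<dots> = - (\<Sum>i\<in>UNIV. (\<i> * of_real (\<xi> $ i)) * (\<i> * of_real (\<xi> $ i)) * fourier_transform f \<xi>)"
    by (simp only: fourier_transform_partial_derivs[OF f] list.map prod_list.Cons prod_list.Nil mult_1_right)
  also have "\<dots> = of_real ((norm \<xi>)\<^sup>2) * fourier_transform f \<xi>"
  proof -
    have "(\<i> * of_real (\<xi> $ i)) * (\<i> * of_real (\<xi> $ i)) * fourier_transform f \<xi> =
        - (complex_of_real ((\<xi> $ i)\<^sup>2) * fourier_transform f \<xi>)" for i
      by (simp add: power2_eq_square mult_ac)
    then show ?thesis
      unfolding n of_real_sum sum_distrib_right by (simp only: sum_negf minus_minus)
  qed
  finally show ?thesis .
qed

lemma test_functions_fourier:
  assumes "f \<in> test_functions UNIV"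
  shows test_functions_laplace_symbol: "laplace_symbol (fourier_transform f)"
    and to_L2_test_functions: "to_L2 f = inv_fourier (to_L2 (fourier_transform f))"
    and to_L2_neg_laplacian:
      "to_L2 (neg_laplacian f) = inv_fourier (to_L2 (\<lambda>\<xi>. of_real ((norm \<xi>)\<^sup>2) * fourier_transform f \<xi>))"
proof -
  note nl = test_functions_neg_laplacian[OF assms]
  have eq: "fourier_transform (neg_laplacian f) = (\<lambda>\<xi>. of_real ((norm \<xi>)\<^sup>2) * fourier_transform f \<xi>)"
    by (simp add: fourier_transform_neg_laplacian[OF assms] fun_eq_iff)
  show "laplace_symbol (fourier_transform f)"
    unfolding laplace_symbol_def eq[symmetric] using assms nl
    by (intro conjI square_integrable_fourier_transform test_functions_integrable test_functions_square_integrable)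
  show "to_L2 f = inv_fourier (to_L2 (fourier_transform f))"
    using assms by (intro inv_fourier_fourier_transform[symmetric] test_functions_integrable test_functions_square_integrable)
  show "to_L2 (neg_laplacian f) = inv_fourier (to_L2 (\<lambda>\<xi>. of_real ((norm \<xi>)\<^sup>2) * fourier_transform f \<xi>))"
    unfolding eq[symmetric] using nl
    by (intro inv_fourier_fourier_transform[symmetric] test_functions_integrable test_functions_square_integrable)
qed

lemma test_functions_inversion:
  fixes f :: "real^'n::finite \<Rightarrow> complex"
  assumes d: "CARD('n) \<le> 3" and f: "f \<in> test_functions UNIV"
  shows "f x = fourier_integral (fourier_transform f) x / of_real (fourier_norm TYPE(real^'n))"
proof -
  have d': "DIM(real^'n) \<le> 3" using d by simp
  note h = laplace_symbol_inv_fourier[OF d' test_functions_laplace_symbol[OF f]]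
  have "AE x in lborel. f x = fourier_integral (fourier_transform f) x / of_real (fourier_norm TYPE(real^'n))"
    using h(3) to_L2_test_functions[OF f] to_L2_eq_iff[OF test_functions_square_integrable[OF f] h(2)] by simp
  from continuous_AE_eq[OF smooth_continuous[OF test_functions_smooth[OF f]] h(1) this]
  show ?thesis by (rule fun_cong)
qed

text \<open>f x - f 0 is an integral of (wave - 1) against the transform of f. Here |wave - 1| \<le>
  |x| |\<xi>| \<le> |x| (1 + |\<xi>|^2), and the factor 1 + |\<xi>|^2 is absorbed since the
  transform of f plus its negative Laplacian is integrable. This linear vanishing compensates for
  one power of the cut-off scale at the puncture.\<close>

lemma test_functions_Lipschitz_at_0:
  fixes f :: "real^'n::finite \<Rightarrow> complex"
  assumes d: "CARD('n) \<le> 3" and f: "f \<in> test_functions UNIV" and 0: "f 0 = 0"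
  obtains C where "0 \<le> C" "\<And>x. cmod (f x) \<le> C * norm x"
proof
  have d': "DIM(real^'n) \<le> 3" using d by simp
  let ?h = "fourier_transform f" and ?N = "fourier_norm TYPE(real^'n)"
  let ?C = "(LINT \<xi>|lborel. cmod (?h \<xi> + fourier_transform (neg_laplacian f) \<xi>)) / ?N"
  have ih: "integrable lborel ?h"
    by (rule laplace_symbol_integrable[OF d' test_functions_laplace_symbol[OF f]])
  have ih': "integrable lborel (fourier_transform (neg_laplacian f))"
    by (rule laplace_symbol_integrable[OF d' test_functions_laplace_symbol[OF test_functions_neg_laplacian[OF f]]])
  show "0 \<le> ?C" by (intro divide_nonneg_pos) auto
  fix x :: "real^'n"
  have "f x = f x - f 0" using 0 by simp
  also have "\<dots> = (fourier_integral ?h x - fourier_integral ?h 0) / of_real ?N"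
    unfolding test_functions_inversion[OF d f, of x] test_functions_inversion[OF d f, of 0]
    by (simp add: diff_divide_distrib)
  also have "fourier_integral ?h x - fourier_integral ?h 0 = (LINT \<xi>|lborel. (wave x \<xi> - 1) * ?h \<xi>)"
    unfolding fourier_integral_def
    by (subst Bochner_Integration.integral_diff[symmetric]) (auto simp: left_diff_distrib intro!: integrable_wave_mult ih)
  finally have fx: "cmod (f x) = cmod (LINT \<xi>|lborel. (wave x \<xi> - 1) * ?h \<xi>) / ?N"
    by (simp add: norm_divide less_imp_le)
  have "cmod (LINT \<xi>|lborel. (wave x \<xi> - 1) * ?h \<xi>) \<le> (LINT \<xi>|lborel. cmod ((wave x \<xi> - 1) * ?h \<xi>))"
    by (rule integral_norm_bound)
  also have "\<dots> \<le> (LINT \<xi>|lborel. norm x * cmod (?h \<xi> + fourier_transform (neg_laplacian f) \<xi>))"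
  proof (rule integral_mono)
    show "integrable lborel (\<lambda>\<xi>. cmod ((wave x \<xi> - 1) * ?h \<xi>))"
      unfolding left_diff_distrib
      by (intro integrable_norm Bochner_Integration.integrable_diff integrable_wave_mult) (simp_all add: ih)
    show "integrable lborel (\<lambda>\<xi>. norm x * cmod (?h \<xi> + fourier_transform (neg_laplacian f) \<xi>))"
      using ih ih' by simp
    fix \<xi> :: "real^'n"
    have "?h \<xi> + fourier_transform (neg_laplacian f) \<xi> = bessel \<xi> * ?h \<xi>"
      by (simp add: fourier_transform_neg_laplacian[OF f] bessel_def distrib_right)
    moreover have "cmod (wave x \<xi> - 1) \<le> norm x * (1 + (norm \<xi>)\<^sup>2)"
    proof -
      have "cmod (wave x \<xi> - 1) \<le> \<bar>x \<bullet> \<xi>\<bar>"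
        using iexp_approx1[of "x \<bullet> \<xi>" 0] by (simp add: wave_def)
      also have "\<dots> \<le> norm x * norm \<xi>" by (rule Cauchy_Schwarz_ineq2)
      also have "\<dots> \<le> norm x * (1 + (norm \<xi>)\<^sup>2)"
      proof (rule mult_left_mono)
        have "0 \<le> (norm \<xi> - 1)\<^sup>2 + (norm \<xi>)\<^sup>2 + 1" by simp
        then show "norm \<xi> \<le> 1 + (norm \<xi>)\<^sup>2" unfolding power2_diff power_one mult_1_right by linarith
      qed simp
      finally show ?thesis .
    qed
    ultimately show "cmod ((wave x \<xi> - 1) * ?h \<xi>) \<le> norm x * cmod (?h \<xi> + fourier_transform (neg_laplacian f) \<xi>)"
      by (simp add: norm_mult norm_bessel mult_right_mono flip: mult.assoc)
  qed
  finally have *: "cmod (LINT \<xi>|lborel. (wave x \<xi> - 1) * ?h \<xi>) \<le>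
      norm x * (LINT \<xi>|lborel. cmod (?h \<xi> + fourier_transform (neg_laplacian f) \<xi>))" by simp
  show "cmod (f x) \<le> ?C * norm x"
    unfolding fx using divide_right_mono[OF *, of ?N] by (simp add: mult.commute less_imp_le)
qed


subsection \<open>Test functions are a core for the Laplacian\<close>

text \<open>Differentiation produces polynomial factors, which are absorbed by passing to a wider
  Gaussian with half the exponent.\<close>

lemma mgauss_derivative_bounds:
  fixes \<eta> :: "real^'n::finite"
  assumes a: "0 < a"
  obtains C where "\<And>x. cmod (mgauss a \<eta> x) \<le> C * cmod (gauss (1 / (2 * a)) 0 x)"
    "\<And>i x. cmod (partial_deriv i (mgauss a \<eta>) x) \<le> C * cmod (gauss (1 / (2 * a)) 0 x)"
    "\<And>i x. cmod (partial_derivs [i, i] (mgauss a \<eta>) x) \<le> C * cmod (gauss (1 / (2 * a)) 0 x)"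
proof -
  \<comment> \<open>The logarithmic derivative of the modulated Gaussian in direction i; it is
    affine, with derivative -1/a.\<close>
  define l where "l i x = \<i> * of_real (\<eta> $ i) - of_real (x $ i / a)" for i and x :: "real^'n"
  have l: "has_partial_deriv (l i) (\<lambda>_. of_real (- 1 / a)) i" for i
  proof -
    have "has_partial_deriv (\<lambda>x. \<i> * of_real (\<eta> $ i) + of_real (- 1 / a) * of_real (x \<bullet> axis i 1))
        (\<lambda>x. 0 + (of_real (- 1 / a) * of_real (axis i 1 $ i) + 0 * of_real (x \<bullet> axis i 1))) i"
      by (intro has_partial_deriv_add has_partial_deriv_mult has_partial_deriv_const has_partial_deriv_inner)
    then show ?thesis by (simp add: l_def[abs_def] inner_axis)
  qed
  have e: "mgauss a \<eta> = (\<lambda>x. exp (\<i> * of_real (x \<bullet> \<eta>) + of_real (- (1 / (2 * a))) * (\<Sum>j\<in>UNIV. of_real (x \<bullet> axis j 1) * of_real (x \<bullet> axis j 1))))"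
  proof
    fix x :: "real^'n"
    have "(norm x)\<^sup>2 = (\<Sum>j\<in>UNIV. (x \<bullet> axis j 1) * (x \<bullet> axis j 1))"
      by (simp add: inner_axis) (simp add: power2_norm_eq_inner inner_vec_def)
    then have "of_real (- (1 / (2 * a))) * (\<Sum>j\<in>UNIV. of_real (x \<bullet> axis j 1) * of_real (x \<bullet> axis j 1)) =
        complex_of_real (- (1 / a / 2 * (norm x)\<^sup>2))"
      by (simp only: of_real_sum of_real_mult of_real_minus) simp
    then show "mgauss a \<eta> x = exp (\<i> * of_real (x \<bullet> \<eta>) + of_real (- (1 / (2 * a))) * (\<Sum>j\<in>UNIV. of_real (x \<bullet> axis j 1) * of_real (x \<bullet> axis j 1)))"
      unfolding mgauss_def wave_def gauss_def exp_add exp_of_real[symmetric] by (simp add: inner_commute)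
  qed
  have sumd: "has_partial_deriv (\<lambda>x. \<Sum>j\<in>J. complex_of_real (x \<bullet> axis j 1) * of_real (x \<bullet> axis j 1))
      (\<lambda>x. \<Sum>j\<in>J. if j = i then 2 * complex_of_real (x $ i) else 0) i" for J :: "'n set" and i
  proof (induction J rule: infinite_finite_induct)
    case (insert k J)
    have "has_partial_deriv (\<lambda>x. complex_of_real (x \<bullet> axis k 1) * of_real (x \<bullet> axis k 1))
        (\<lambda>x. of_real (x \<bullet> axis k 1) * of_real (axis k 1 $ i) + of_real (axis k 1 $ i) * of_real (x \<bullet> axis k 1)) i"
      by (intro has_partial_deriv_mult has_partial_deriv_inner)
    also have "(\<lambda>x. of_real (x \<bullet> axis k 1) * of_real (axis k 1 $ i) + of_real (axis k 1 $ i) * of_real (x \<bullet> axis k 1)) =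
        (\<lambda>x. if k = i then 2 * complex_of_real (x $ i) else 0)"
    proof -
      have "axis k (1::real) $ i = (if k = i then 1 else 0)" by (simp add: axis_def)
      then show ?thesis by (auto simp: fun_eq_iff inner_axis)
    qed
    finally have "has_partial_deriv (\<lambda>x. complex_of_real (x \<bullet> axis k 1) * of_real (x \<bullet> axis k 1))
        (\<lambda>x. if k = i then 2 * complex_of_real (x $ i) else 0) i" .
    from has_partial_deriv_add[OF this insert.IH] show ?case
      by (simp only: sum.insert[OF insert.hyps])
  qed (simp_all add: has_partial_deriv_const)
  have d1: "has_partial_deriv (mgauss a \<eta>) (\<lambda>x. l i x * mgauss a \<eta> x) i" for i
  proof -
    have "has_partial_deriv (mgauss a \<eta>)
        (\<lambda>x. ((\<i> * of_real (\<eta> $ i) + 0 * of_real (x \<bullet> \<eta>)) +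
          (of_real (- (1 / (2 * a))) * (\<Sum>j\<in>UNIV. if j = i then 2 * complex_of_real (x $ i) else 0) +
            0 * (\<Sum>j\<in>UNIV. of_real (x \<bullet> axis j 1) * of_real (x \<bullet> axis j 1)))) * mgauss a \<eta> x) i"
      unfolding e
      by (intro has_partial_deriv_chain[OF has_partial_deriv_add] has_partial_deriv_mult has_partial_deriv_const
          has_partial_deriv_inner sumd DERIV_exp)
    then show ?thesis using a by (simp add: l_def)
  qed
  have d2: "partial_derivs [i, i] (mgauss a \<eta>) x = (l i x * l i x - of_real (1 / a)) * mgauss a \<eta> x" for i x
  proof -
    have "partial_deriv i (\<lambda>x. l i x * mgauss a \<eta> x) =
        (\<lambda>x. l i x * (l i x * mgauss a \<eta> x) + of_real (- 1 / a) * mgauss a \<eta> x)"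
      by (intro has_partial_deriv_imp_eq has_partial_deriv_mult l d1)
    then show ?thesis
      by (simp add: has_partial_deriv_imp_eq[OF d1] algebra_simps)
  qed
  \<comment> \<open>The ratio of the wide Gaussian to the modulus of the narrow one, so a factor
    bounded by a multiple of \<open>E\<close> is harmless.\<close>
  define E where "E x = exp ((norm x)\<^sup>2 / (4 * a))" for x :: "real^'n"
  define B where "B = 2 * (norm \<eta>)\<^sup>2 + 8 / a"
  have B: "0 \<le> B" using a by (simp add: B_def)
  have E1: "1 \<le> E x" for x using a by (simp add: E_def)
  have lB: "(cmod (l i x))\<^sup>2 \<le> B * E x" for i x
  proof -
    have "(cmod (l i x))\<^sup>2 = (\<eta> $ i)\<^sup>2 + (x $ i / a)\<^sup>2"
      unfolding cmod_power2 l_def by simp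
    also have "\<dots> \<le> (norm \<eta>)\<^sup>2 + (norm x / a)\<^sup>2"
      using a by (intro add_mono) (auto simp: power_divide power2_le_iff_abs_le component_le_norm_cart intro!: divide_right_mono)
    also have "\<dots> = (norm \<eta>)\<^sup>2 * 1 + 4 / a * ((norm x)\<^sup>2 / (4 * a))"
      using a by (simp add: power_divide field_simps power2_eq_square)
    also have "\<dots> \<le> (norm \<eta>)\<^sup>2 * E x + 4 / a * E x"
      using a E1[of x]
      by (intro add_mono mult_left_mono) (auto simp: E_def intro: order_trans[OF _ exp_ge_add_one_self])
    also have "\<dots> \<le> B * E x"
    proof -
      have "B * E x = 2 * ((norm \<eta>)\<^sup>2 * E x) + 2 * (4 / a * E x)" by (simp add: B_def algebra_simps)
      moreover have "0 \<le> (norm \<eta>)\<^sup>2 * E x" "0 \<le> 4 / a * E x" using a E1[of x] by auto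
      ultimately show ?thesis by linarith
    qed
    finally show ?thesis .
  qed
  have G: "cmod (mgauss a \<eta> x) * E x = cmod (gauss (1 / (2 * a)) 0 x)" for x :: "real^'n"
    using a by (simp add: mgauss_def norm_mult gauss_def E_def exp_add[symmetric] field_simps)
  \<comment> \<open>Large enough for the three factors that occur: 1, then |l| \<le> 1 + |l|^2, and
    |l|^2 + 1/a.\<close>
  define C where "C = 1 + B + 1 / a"
  have C: "1 \<le> C" using B a by (simp add: C_def)
  have main: "cmod (m * mgauss a \<eta> x) \<le> C * cmod (gauss (1 / (2 * a)) 0 x)" if "cmod m \<le> C * E x" for m and x :: "real^'n"
    using mult_right_mono[OF that norm_ge_zero[of "mgauss a \<eta> x"]] by (simp add: norm_mult flip: G) (simp add: mult_ac)
  show ?thesis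
  proof
    fix i x
    show "cmod (mgauss a \<eta> x) \<le> C * cmod (gauss (1 / (2 * a)) 0 x)"
      using main[of 1 x] C E1[of x] mult_mono[of 1 C 1 "E x"] by simp
    have "0 \<le> (cmod (l i x) - 1)\<^sup>2 + (cmod (l i x))\<^sup>2 + 1" by simp
    then have "cmod (l i x) \<le> 1 + (cmod (l i x))\<^sup>2" unfolding power2_diff power_one mult_1_right by linarith
    also have "\<dots> \<le> E x + B * E x + 1 / a * E x" using lB[of i x] E1[of x] a by (simp add: add_increasing2)
    also have "\<dots> = C * E x" by (simp add: C_def distrib_right)
    finally show "cmod (partial_deriv i (mgauss a \<eta>) x) \<le> C * cmod (gauss (1 / (2 * a)) 0 x)"
      using main by (simp add: has_partial_deriv_imp_eq[OF d1])
    have "cmod (l i x * l i x - of_real (1 / a)) \<le> cmod (l i x * l i x) + cmod (of_real (1 / a))"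
      by (rule norm_triangle_ineq4)
    also have "\<dots> = (cmod (l i x))\<^sup>2 + 1 / a" using a by (simp add: norm_mult power2_eq_square norm_divide)
    also have "\<dots> \<le> E x + B * E x + 1 / a * E x"
      using lB[of i x] E1[of x] a mult_left_mono[OF E1[of x], of "1 / a"] by simp
    also have "\<dots> = C * E x" by (simp add: C_def distrib_right)
    finally show "cmod (partial_derivs [i, i] (mgauss a \<eta>) x) \<le> C * cmod (gauss (1 / (2 * a)) 0 x)"
      using main by (simp only: d2)
  qed
qed


lemma has_partial_deriv_minus_const:
  "has_partial_deriv f f' i \<Longrightarrow> has_partial_deriv (\<lambda>x. c - f x) (\<lambda>x. - f' x) i"
  using has_partial_deriv_add[OF has_partial_deriv_const[of c i]
      has_partial_deriv_mult[OF has_partial_deriv_const[of "- 1" i], of f f']] by simp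

lemma neg_laplacian_mult:
  assumes "smooth f" "smooth g"
  shows "neg_laplacian (\<lambda>x. f x * g x) x =
    f x * neg_laplacian g x - 2 * (\<Sum>i\<in>UNIV. partial_deriv i f x * partial_deriv i g x) + neg_laplacian f x * g x"
  unfolding neg_laplacian_def partial_derivs_mult_2[OF assms] sum.distrib
  by (simp add: sum_distrib_left sum_distrib_right)

lemma partial_derivs_dilate_2:
  assumes "smooth f"
  shows "partial_derivs [i, i] (\<lambda>x. f (r *\<^sub>R x)) = (\<lambda>x. of_real (r\<^sup>2) * partial_derivs [i, i] f (r *\<^sub>R x))"
  using assms
  by (simp add: partial_deriv_dilate partial_deriv_cmult smooth_partial_deriv smooth_intros(9) power2_eq_square mult.assoc)

lemma partial_derivs_minus_const_2:
  assumes "smooth f"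
  shows "partial_deriv i (\<lambda>x. c - f x) = (\<lambda>x. - partial_deriv i f x)"
    "partial_derivs [i, i] (\<lambda>x. c - f x) = (\<lambda>x. - partial_derivs [i, i] f x)"
proof -
  show 1: "partial_deriv i (\<lambda>x. c - f x) = (\<lambda>x. - partial_deriv i f x)"
    by (intro has_partial_deriv_imp_eq has_partial_deriv_minus_const smooth_has_partial_deriv assms)
  show "partial_derivs [i, i] (\<lambda>x. c - f x) = (\<lambda>x. - partial_derivs [i, i] f x)"
    using partial_deriv_cmult[OF smooth_partial_deriv[OF assms, of i], of i "- 1"] by (simp add: 1)
qed

text \<open>The Gaussian is cut off at radii tending to infinity. Dilation by \<open>r n\<close>
  \<le> 1 does not increase the derivatives of the cut-off, giving one majorant for all n, and
  around a fixed x the cut-off is eventually the constant 1.\<close>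

lemma mgauss_approximation:
  fixes \<eta> :: "real^'n::finite"
  assumes a: "0 < a"
  defines "\<Gamma> \<equiv> mgauss a \<eta>"
  obtains f :: "nat \<Rightarrow> real^'n \<Rightarrow> complex" and C where
    "\<And>n. f n \<in> test_functions UNIV"
    "\<And>x. (\<lambda>n. f n x) \<longlonglongrightarrow> \<Gamma> x" "\<And>x. (\<lambda>n. neg_laplacian (f n) x) \<longlonglongrightarrow> neg_laplacian \<Gamma> x"
    "\<And>n x. cmod (f n x) \<le> C * cmod (gauss (1 / (2 * a)) 0 x)"
    "\<And>n x. cmod (neg_laplacian (f n) x) \<le> C * cmod (gauss (1 / (2 * a)) 0 x)"
proof -
  obtain \<psi> :: "real^'n \<Rightarrow> complex" and M where \<psi>: "smooth \<psi>"
    "\<And>x. norm x \<le> 1 \<Longrightarrow> \<psi> x = 0" "\<And>x. 2 \<le> norm x \<Longrightarrow> \<psi> x = 1"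
    "\<And>x. cmod (\<psi> x) \<le> 1" "\<And>x. cmod (1 - \<psi> x) \<le> 1"
    "\<And>i x. cmod (partial_deriv i \<psi> x) \<le> M" "\<And>i x. cmod (partial_derivs [i, i] \<psi> x) \<le> M"
    "\<And>i x. norm x < 1 \<or> 2 < norm x \<Longrightarrow> partial_deriv i \<psi> x = 0"
    "\<And>i x. norm x < 1 \<or> 2 < norm x \<Longrightarrow> partial_derivs [i, i] \<psi> x = 0"
    by (rule smooth_cutoff_exists) blast
  obtain C where C: "\<And>x. cmod (\<Gamma> x) \<le> C * cmod (gauss (1 / (2 * a)) 0 x)"
    "\<And>i x. cmod (partial_deriv i \<Gamma> x) \<le> C * cmod (gauss (1 / (2 * a)) 0 x)"
    "\<And>i x. cmod (partial_derivs [i, i] \<Gamma> x) \<le> C * cmod (gauss (1 / (2 * a)) 0 x)"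
    unfolding \<Gamma>_def by (rule mgauss_derivative_bounds[OF a]) blast
  have sm\<Gamma>: "smooth \<Gamma>" unfolding \<Gamma>_def by (rule smooth_mgauss)
  \<comment> \<open>Any direction shows this, as the index type is inhabited.\<close>
  have M: "0 \<le> M" using \<psi>(6)[of undefined 0] norm_ge_zero order_trans by blast
  define r where "r n = 1 / real (Suc n)" for n
  have r: "0 < r n" "r n \<le> 1" for n by (auto simp: r_def)
  define w where "w n x = 1 - \<psi> (r n *\<^sub>R x)" for n x
  have smd: "smooth (\<lambda>x. \<psi> (r n *\<^sub>R x))" for n by (intro smooth_intros(9) \<psi>)
  have smw: "smooth (w n)" for n
    unfolding w_def[abs_def] by (intro smooth_diff smooth_intros(1) smd)
  have dw: "partial_deriv i (w n) x = - of_real (r n) * partial_deriv i \<psi> (r n *\<^sub>R x)" for i n x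
    unfolding w_def[abs_def] by (simp add: partial_derivs_minus_const_2(1)[OF smd] partial_deriv_dilate[OF \<psi>(1)])
  have ddw: "partial_derivs [i, i] (w n) x = - of_real ((r n)\<^sup>2) * partial_derivs [i, i] \<psi> (r n *\<^sub>R x)" for i n x
    unfolding w_def[abs_def] partial_derivs_minus_const_2(2)[OF smd] partial_derivs_dilate_2[OF \<psi>(1)] by simp
  have w1: "cmod (w n x) \<le> 1" for n x unfolding w_def by (rule \<psi>)
  have dwM: "cmod (partial_deriv i (w n) x) \<le> M" for i n x
    using mult_mono[OF r(2)[of n] \<psi>(6)[of i "r n *\<^sub>R x"]] r(1)[of n] by (simp add: dw norm_mult)
  have ddwM: "cmod (partial_derivs [i, i] (w n) x) \<le> M" for i n x
  proof -
    have "(r n)\<^sup>2 \<le> 1" using r[of n] by (simp add: power_le_one)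
    from mult_mono[OF this \<psi>(7)[of i "r n *\<^sub>R x"]] show ?thesis
      unfolding ddw norm_mult norm_minus_cancel norm_of_real by simp
  qed
  define f where "f n x = \<Gamma> x * w n x" for n x
  have nl: "neg_laplacian (f n) x =
      \<Gamma> x * neg_laplacian (w n) x - 2 * (\<Sum>i\<in>UNIV. partial_deriv i \<Gamma> x * partial_deriv i (w n) x) + neg_laplacian \<Gamma> x * w n x" for n x
    unfolding f_def[abs_def] by (rule neg_laplacian_mult[OF sm\<Gamma> smw])
  have ev: "\<forall>\<^sub>F n in sequentially. norm (r n *\<^sub>R x) < 1" for x :: "real^'n"
  proof -
    have "(\<lambda>n. norm (r n *\<^sub>R x)) \<longlonglongrightarrow> norm (0 *\<^sub>R x)"
      unfolding r_def by (intro tendsto_intros LIMSEQ_Suc[OF lim_const_over_n[of 1, simplified]])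
    then show ?thesis by (intro order_tendstoD) auto
  qed
  let ?g = "\<lambda>x::real^'n. C * cmod (gauss (1 / (2 * a)) 0 x)"
  have g0: "0 \<le> ?g x" for x using C(1)[of x] norm_ge_zero order_trans by blast
  define d where "d = real CARD('n)"
  \<comment> \<open>One summand per term of the Leibniz rule: the Laplacian of the cut-off, the
    mixed gradients, the Laplacian of the Gaussian; the last 1 covers the undifferentiated
    function.\<close>
  define K where "K = d * M + 2 * (d * M) + d + 1"
  have K: "0 \<le> d" "0 \<le> d * M" using M by (auto simp: d_def)
  have sum_bound: "cmod (\<Sum>i\<in>(UNIV :: 'n set). h i) \<le> d * B" if "\<And>i. cmod (h i) \<le> B" for h B
    using sum_norm_bound[of UNIV h B] that by (simp add: d_def)
  show ?thesis
  proof
    show "f n \<in> test_functions UNIV" for n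
    proof (rule test_functionsI)
      show "smooth (f n)" unfolding f_def[abs_def] by (intro smooth_intros(4) sm\<Gamma> smw)
      show "f n x = 0" if "2 / r n < norm x" for x
      proof -
        have "2 \<le> norm (r n *\<^sub>R x)" using that r(1)[of n] by (simp add: divide_less_eq mult.commute)
        then show ?thesis by (simp add: f_def w_def \<psi>(3))
      qed
    qed
    show "(\<lambda>n. f n x) \<longlonglongrightarrow> \<Gamma> x" for x
    proof (rule tendsto_eventually, use ev[of x] in eventually_elim)
      case (elim n)
      then show ?case by (simp add: f_def w_def \<psi>(2))
    qed
    show "(\<lambda>n. neg_laplacian (f n) x) \<longlonglongrightarrow> neg_laplacian \<Gamma> x" for x
    proof (rule tendsto_eventually, use ev[of x] in eventually_elim)
      case (elim n)
      then have "w n x = 1" by (simp add: w_def \<psi>(2))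
      moreover have "partial_deriv i (w n) x = 0" for i using elim by (simp add: dw \<psi>(8))
      moreover have "neg_laplacian (w n) x = 0"
      proof -
        have "partial_derivs [i, i] \<psi> (r n *\<^sub>R x) = 0" for i using elim by (intro \<psi>(9)) simp
        then show ?thesis unfolding neg_laplacian_def ddw by simp
      qed
      ultimately show ?case by (simp add: nl)
    qed
    show "cmod (f n x) \<le> (C * K) * cmod (gauss (1 / (2 * a)) 0 x)" for n x
    proof -
      have "cmod (f n x) \<le> ?g x * 1"
        unfolding f_def norm_mult by (intro mult_mono C(1) w1 g0) simp
      also have "?g x * 1 \<le> ?g x * K"
      proof (rule mult_left_mono[OF _ g0])
        show "1 \<le> K" using K unfolding K_def by linarith
      qed
      finally show ?thesis by (simp add: mult_ac)
    qed
    show "cmod (neg_laplacian (f n) x) \<le> (C * K) * cmod (gauss (1 / (2 * a)) 0 x)" for n x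
    proof -
      have "cmod (neg_laplacian (w n) x) \<le> d * M"
        unfolding neg_laplacian_def norm_minus_cancel by (rule sum_bound[OF ddwM])
      then have 1: "cmod (\<Gamma> x * neg_laplacian (w n) x) \<le> ?g x * (d * M)"
        unfolding norm_mult by (intro mult_mono C(1) g0) auto
      have "cmod (partial_deriv i \<Gamma> x * partial_deriv i (w n) x) \<le> ?g x * M" for i
        unfolding norm_mult by (intro mult_mono C(2) dwM g0) auto
      then have 2: "cmod (2 * (\<Sum>i\<in>UNIV. partial_deriv i \<Gamma> x * partial_deriv i (w n) x)) \<le> 2 * (d * (?g x * M))"
        unfolding norm_mult[of 2] norm_numeral by (intro mult_left_mono sum_bound) auto
      have "cmod (neg_laplacian \<Gamma> x) \<le> d * ?g x"
        unfolding neg_laplacian_def norm_minus_cancel by (rule sum_bound[OF C(3)])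
      then have 3: "cmod (neg_laplacian \<Gamma> x * w n x) \<le> d * ?g x * 1"
        unfolding norm_mult using K g0[of x] by (intro mult_mono w1) auto
      have "cmod (neg_laplacian (f n) x) \<le> ?g x * (d * M) + 2 * (d * (?g x * M)) + d * ?g x * 1"
        unfolding nl using 1 2 3 by (intro order_trans[OF norm_triangle_ineq] add_mono order_trans[OF norm_triangle_ineq4])
      also have "\<dots> \<le> ?g x * K" using g0[of x] by (simp add: K_def algebra_simps)
      finally show ?thesis by (simp add: mult_ac)
    qed
  qed
qed

lemma fourier_transform_mgauss:
  fixes \<eta> :: "'a::euclidean_space"
  assumes "0 < a"
  shows "fourier_transform (mgauss a \<eta>) \<xi> = gauss_const TYPE('a) (1 / a) * gauss a \<eta> \<xi>"
proof -
  have "norm (- \<xi> - (- \<eta>)) = norm (\<xi> - \<eta>)" by (metis minus_diff_minus norm_minus_cancel)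
  then show ?thesis
    using assms by (simp add: fourier_transform_def fourier_integral_mgauss gauss_def)
qed

lemma fourier_transform_tendsto:
  assumes "\<And>n. f n \<in> borel_measurable borel" "g \<in> borel_measurable borel" "integrable lborel h"
    "\<And>n x. cmod (f n x) \<le> h x" "\<And>x. (\<lambda>n. f n x) \<longlonglongrightarrow> g x"
  shows "(\<lambda>n. fourier_transform (f n) \<xi>) \<longlonglongrightarrow> fourier_transform g \<xi>"
  unfolding fourier_transform_def fourier_integral_def
proof (rule integral_dominated_convergence[OF _ _ assms(3)])
  have [measurable]: "\<And>n. f n \<in> borel_measurable borel" "g \<in> borel_measurable borel" by fact+
  show "(\<lambda>x. wave (- \<xi>) x * g x) \<in> borel_measurable lborel" by measurable
  show "(\<lambda>x. wave (- \<xi>) x * f n x) \<in> borel_measurable lborel" for n by measurable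
qed (auto simp: norm_mult intro!: AE_I2 tendsto_mult assms)

lemma continuous_neg_laplacian: "smooth f \<Longrightarrow> continuous_on UNIV (neg_laplacian f)"
  unfolding neg_laplacian_def by (intro continuous_intros smooth_continuous smooth_partial_derivs)

text \<open>
  The Fourier transforms of test functions separate, even against functions that are square
  integrable only after division by \<open>1 + |\<xi>|\<^sup>2\<close>: the cut-off Gaussians converge in the graph norm.
\<close>
lemma test_functions_separating:
  fixes K :: "real^'n::finite \<Rightarrow> complex"
  assumes K: "square_integrable (\<lambda>\<xi>. K \<xi> / bessel \<xi>)"
    and z: "\<And>f. f \<in> test_functions UNIV \<Longrightarrow> (LINT \<xi>|lborel. fourier_transform f \<xi> * K \<xi>) = 0"
  shows "AE \<xi> in lborel. K \<xi> = 0"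
proof -
  define k where "k \<xi> = K \<xi> / bessel \<xi>" for \<xi>
  have k: "square_integrable k" unfolding k_def[abs_def] by (rule K)
  have Kk: "K \<xi> = bessel \<xi> * k \<xi>" for \<xi> by (simp add: k_def)
  \<comment> \<open>By Plancherel, integrating a transform against k is an inner product with this v
    in position space, where convergence of the cut-off Gaussians is known.\<close>
  define v where "v = inv_fourier (to_L2 (\<lambda>\<xi>. cnj (k \<xi>)))"
  have key: "(LINT \<xi>|lborel. fourier_transform g \<xi> * k \<xi>) = of_real (fourier_norm TYPE(real^'n)) * cinner (to_L2 g) v"
    if "integrable lborel g" "square_integrable g" for g
    unfolding v_def inv_fourier_fourier_transform[OF that, symmetric] cinner_inv_fourier
    by (simp add: cinner_to_L2 square_integrable_fourier_transform that square_integrable_cnj k)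
  \<comment> \<open>1 minus the Laplacian: it multiplies the transform by \<open>bessel\<close> and
    thus replaces K by the square integrable k.\<close>
  define T where "T f = (\<lambda>x. f x + neg_laplacian f x)" for f :: "real^'n \<Rightarrow> complex"
  have Ttest: "T f \<in> test_functions UNIV" if "f \<in> test_functions UNIV" for f
    unfolding T_def by (intro test_functions_add test_functions_neg_laplacian that)
  have FT: "fourier_transform (T f) \<xi> = bessel \<xi> * fourier_transform f \<xi>" if "f \<in> test_functions UNIV" for f \<xi>
  proof -
    have "fourier_transform (T f) \<xi> = fourier_transform f \<xi> + fourier_transform (neg_laplacian f) \<xi>"
      unfolding T_def fourier_transform_def fourier_integral_def distrib_left
      by (intro Bochner_Integration.integral_add integrable_wave_mult test_functions_integrable
          test_functions_neg_laplacian that)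
    then show ?thesis by (simp add: fourier_transform_neg_laplacian[OF that] bessel_def distrib_right)
  qed
  have orth: "cinner (to_L2 (T f)) v = 0" if f: "f \<in> test_functions UNIV" for f
  proof -
    have "(LINT \<xi>|lborel. fourier_transform (T f) \<xi> * k \<xi>) = (LINT \<xi>|lborel. fourier_transform f \<xi> * K \<xi>)"
      by (simp add: FT[OF f] Kk mult_ac)
    then show ?thesis
      using key[of "T f"] z[OF f] Ttest[OF f] by (simp add: test_functions_integrable test_functions_square_integrable)
  qed
  have gauss: "square_integrable (\<lambda>\<xi>. bessel \<xi> * gauss a \<eta> \<xi>) \<and> (LINT \<xi>|lborel. K \<xi> * gauss a \<eta> \<xi>) = 0"
    if a: "0 < a" for a and \<eta> :: "real^'n"
  proof -
    define \<Gamma> where "\<Gamma> = mgauss a \<eta>"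
    obtain f C where f: "\<And>n. f n \<in> test_functions UNIV"
      "\<And>x. (\<lambda>n. f n x) \<longlonglongrightarrow> \<Gamma> x" "\<And>x. (\<lambda>n. neg_laplacian (f n) x) \<longlonglongrightarrow> neg_laplacian \<Gamma> x"
      "\<And>n x. cmod (f n x) \<le> C * cmod (gauss (1 / (2 * a)) 0 x)"
      "\<And>n x. cmod (neg_laplacian (f n) x) \<le> C * cmod (gauss (1 / (2 * a)) 0 x)"
      unfolding \<Gamma>_def by (rule mgauss_approximation[OF a, of \<eta>]) blast
    \<comment> \<open>\<open>T\<close> has two terms, each bounded by C times the Gaussian, whence
      the factor 2.\<close>
    define h where "h x = of_real (2 * C) * gauss (1 / (2 * a)) 0 x" for x :: "real^'n"
    have h: "integrable lborel h" "square_integrable h"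
      unfolding h_def[abs_def] using a
      by (auto intro!: integrable_gauss square_integrable_scale square_integrable_gauss)
    have C0: "0 \<le> C"
    proof (rule ccontr)
      assume "\<not> 0 \<le> C"
      then have "C * cmod (gauss (1 / (2 * a)) 0 (0::real^'n)) < 0" by (intro mult_neg_pos) auto
      then show False using f(4)[of 0 0] norm_ge_zero[of "f 0 0"] by linarith
    qed
    have Tb: "cmod (T (f n) x) \<le> cmod (h x)" for n x
      using norm_triangle_ineq[of "f n x" "neg_laplacian (f n) x"] f(4)[of n x] f(5)[of n x] C0
      by (simp add: T_def h_def norm_mult)
    have Tlim: "(\<lambda>n. T (f n) x) \<longlonglongrightarrow> T \<Gamma> x" for x
      unfolding T_def by (intro tendsto_add f)
    have mT: "T (f n) \<in> borel_measurable borel" for n by (rule test_functions_measurable[OF Ttest[OF f(1)]])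
    have mT\<Gamma>: "T \<Gamma> \<in> borel_measurable borel"
      unfolding T_def \<Gamma>_def
      by (intro borel_measurable_continuous_onI continuous_intros smooth_continuous continuous_neg_laplacian smooth_mgauss)
    note dc = L2_dominated_convergence[OF mT mT\<Gamma> h(2) AE_I2[OF Tb] AE_I2[OF Tlim]]
    have T\<Gamma>_int: "integrable lborel (T \<Gamma>)"
    proof (rule Bochner_Integration.integrable_bound[OF h(1)])
      have "cmod (T \<Gamma> x) \<le> cmod (h x)" for x
        by (rule LIMSEQ_le_const2[OF tendsto_norm[OF Tlim]]) (use Tb in auto)
      then show "AE x in lborel. cmod (T \<Gamma> x) \<le> cmod (h x)" by simp
    qed (use mT\<Gamma> in simp)
    \<comment> \<open>The Gaussian has no compact support, so the rule for the Laplacian of a test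
      function is carried over by the limit in n.\<close>
    have FT\<Gamma>: "fourier_transform (T \<Gamma>) \<xi> = bessel \<xi> * (gauss_const TYPE(real^'n) (1 / a) * gauss a \<eta> \<xi>)" for \<xi>
    proof (rule LIMSEQ_unique)
      show "(\<lambda>n. fourier_transform (T (f n)) \<xi>) \<longlonglongrightarrow> fourier_transform (T \<Gamma>) \<xi>"
        by (rule fourier_transform_tendsto[OF mT mT\<Gamma> integrable_norm[OF h(1)] Tb Tlim])
      have "(\<lambda>n. fourier_transform (f n) \<xi>) \<longlonglongrightarrow> fourier_transform \<Gamma> \<xi>"
      proof (rule fourier_transform_tendsto)
        show "integrable lborel (\<lambda>x. cmod (h x))" using h by simp
        show "cmod (f n x) \<le> cmod (h x)" for n x
        proof -
          have "0 \<le> C * cmod (gauss (1 / (2 * a)) 0 x)" using C0 by simp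
          moreover have "cmod (h x) = 2 * (C * cmod (gauss (1 / (2 * a)) 0 x))"
            using C0 by (simp add: h_def norm_mult mult.assoc)
          ultimately show ?thesis using f(4)[of n x] by linarith
        qed
      qed (use f in \<open>auto simp: \<Gamma>_def intro: test_functions_measurable\<close>)
      then have "(\<lambda>n. bessel \<xi> * fourier_transform (f n) \<xi>) \<longlonglongrightarrow> bessel \<xi> * fourier_transform \<Gamma> \<xi>"
        by (intro tendsto_mult tendsto_const)
      then show "(\<lambda>n. fourier_transform (T (f n)) \<xi>) \<longlonglongrightarrow> bessel \<xi> * (gauss_const TYPE(real^'n) (1 / a) * gauss a \<eta> \<xi>)"
        by (simp add: FT[OF f(1)] \<Gamma>_def fourier_transform_mgauss[OF a])
    qed
    have c: "gauss_const TYPE(real^'n) (1 / a) \<noteq> 0" using a by simp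
    have "square_integrable (\<lambda>\<xi>. 1 / gauss_const TYPE(real^'n) (1 / a) * fourier_transform (T \<Gamma>) \<xi>)"
      by (intro square_integrable_scale square_integrable_fourier_transform T\<Gamma>_int dc)
    then have sq: "square_integrable (\<lambda>\<xi>. bessel \<xi> * gauss a \<eta> \<xi>)"
      using c by (simp add: FT\<Gamma>)
    have "(\<lambda>n. cinner (to_L2 (T (f n))) v) \<longlonglongrightarrow> cinner (to_L2 (T \<Gamma>)) v"
      by (intro tendsto_cinner dc tendsto_const)
    then have "cinner (to_L2 (T \<Gamma>)) v = 0"
      by (simp add: orth[OF f(1)] LIMSEQ_const_iff)
    then have "(LINT \<xi>|lborel. fourier_transform (T \<Gamma>) \<xi> * k \<xi>) = 0"
      using key[OF T\<Gamma>_int dc(2)] by simp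
    moreover have "fourier_transform (T \<Gamma>) \<xi> * k \<xi> = gauss_const TYPE(real^'n) (1 / a) * (K \<xi> * gauss a \<eta> \<xi>)" for \<xi>
      by (simp add: FT\<Gamma> Kk)
    ultimately have "(LINT \<xi>|lborel. K \<xi> * gauss a \<eta> \<xi>) = 0" using c by simp
    with sq show ?thesis by simp
  qed
  show ?thesis
  proof (rule gauss_separating)
    show "integrable lborel (\<lambda>\<xi>. K \<xi> * gauss 1 0 \<xi>)"
      using square_integrable_mult[OF k, of "\<lambda>\<xi>. bessel \<xi> * gauss 1 0 \<xi>"] gauss[of 1 0] by (simp add: Kk mult_ac)
  qed (use gauss in blast)
qed


section \<open>The Sobolev space\<close>

lemma norm_derivative_symbol_le:
  assumes "length is \<le> 2"
  shows "cmod (\<Prod>i\<leftarrow>is. \<i> * of_real (\<xi> $ i)) \<le> cmod (bessel (\<xi> :: real^'n::finite))"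
proof -
  have n: "\<bar>\<xi> $ i\<bar> \<le> norm \<xi>" for i by (rule component_le_norm_cart)
  have "0 \<le> (norm \<xi> - 1)\<^sup>2 + (norm \<xi>)\<^sup>2 + 1" by simp
  then have 1: "norm \<xi> \<le> 1 + (norm \<xi>)\<^sup>2" unfolding power2_diff power_one mult_1_right by linarith
  consider "is = []" | i where "is = [i]" | i j where "is = [i, j]"
    using assms by (cases "is"; cases "tl is") (auto simp: Suc_le_eq numeral_2_eq_2)
  then show ?thesis
  proof cases
    case 2
    then show ?thesis using n[of i] 1 by (simp add: norm_mult norm_bessel)
  next
    case 3
    have "\<bar>\<xi> $ i\<bar> * \<bar>\<xi> $ j\<bar> \<le> norm \<xi> * norm \<xi>" by (intro mult_mono n) auto
    then show ?thesis using 3 by (simp add: norm_mult norm_bessel power2_eq_square)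
  qed (simp add: norm_bessel)
qed

lemma cnj_derivative_symbol:
  "cnj (\<Prod>i\<leftarrow>is. \<i> * of_real (\<xi> $ i)) = (- 1) ^ length is * (\<Prod>i\<leftarrow>is. \<i> * of_real (\<xi> $ i))"
  by (induction "is") (auto simp: mult_ac)

lemma measurable_derivative_symbol [measurable]:
  "(\<lambda>\<xi>::real^'n::finite. \<Prod>i\<leftarrow>is. \<i> * complex_of_real (\<xi> $ i)) \<in> borel_measurable borel"
proof -
  have "continuous_on UNIV (\<lambda>\<xi>::real^'n. \<Prod>i\<leftarrow>is. \<i> * complex_of_real (\<xi> $ i))"
    by (induction "is") (auto intro!: continuous_intros)
  then show ?thesis by (rule borel_measurable_continuous_onI)
qed

lemma integral_mult_test_function:
  assumes "square_integrable u" "f \<in> test_functions UNIV"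
  shows "(LINT x|lborel. u x * f x) = cinner (to_L2 u) (to_L2 (\<lambda>x. cnj (f x)))"
  using assms by (simp add: cinner_to_L2 test_functions_square_integrable test_functions_cnj)

lemma cinner_inv_fourier_test_function:
  fixes f :: "real^'n::finite \<Rightarrow> complex"
  assumes "square_integrable h" "f \<in> test_functions UNIV"
  shows "cinner (inv_fourier (to_L2 h)) (to_L2 f) =
    (LINT \<xi>|lborel. h \<xi> * cnj (fourier_transform f \<xi>)) / of_real (fourier_norm TYPE(real^'n))"
  unfolding to_L2_test_functions[OF assms(2)] cinner_inv_fourier
  using assms by (simp add: cinner_to_L2 laplace_symbol_square_integrable test_functions_laplace_symbol)

lemma square_integrable_divide_bessel:
  assumes h: "square_integrable h"
  shows "square_integrable (\<lambda>\<xi>. h \<xi> / bessel \<xi>)"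
    and "square_integrable (\<lambda>\<xi>. of_real ((norm \<xi>)\<^sup>2) * h \<xi> / bessel \<xi>)"
proof -
  have [measurable]: "h \<in> borel_measurable borel" using h by (rule square_integrable_measurable)
  have pos: "0 < 1 + (norm \<xi>)\<^sup>2" for \<xi> :: 'a
    using zero_le_power2[of "norm \<xi>"] by linarith
  show "square_integrable (\<lambda>\<xi>. h \<xi> / bessel \<xi>)"
  proof (rule square_integrable_bound[OF h])
    show "cmod (h \<xi> / bessel \<xi>) \<le> cmod (h \<xi>)" for \<xi>
      using pos[of \<xi>] unfolding norm_divide norm_bessel by (simp add: divide_le_eq distrib_left)
  qed measurable
  show "square_integrable (\<lambda>\<xi>. of_real ((norm \<xi>)\<^sup>2) * h \<xi> / bessel \<xi>)"
  proof (rule square_integrable_bound[OF h])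
    show "cmod (of_real ((norm \<xi>)\<^sup>2) * h \<xi> / bessel \<xi>) \<le> cmod (h \<xi>)" for \<xi>
      using pos[of \<xi>] unfolding norm_divide norm_mult norm_bessel norm_of_real
      by (simp add: divide_le_eq distrib_left mult.commute)
  qed measurable
qed

text \<open>Symbols of derivatives of order at most 2 are bounded by \<open>bessel\<close>, which
  yields all weak derivatives from a symbol. Conversely the pure second weak derivatives sum up to
  an L2 function whose symbol must be |\<xi>|^2 h.\<close>

lemma sobolev_2_iff:
  fixes \<phi> :: "(real^'n::finite) L2"
  shows "\<phi> \<in> sobolev 2 \<longleftrightarrow> (\<exists>h. laplace_symbol h \<and> \<phi> = inv_fourier (to_L2 h))"
proof
  assume "\<exists>h. laplace_symbol h \<and> \<phi> = inv_fourier (to_L2 h)"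
  then obtain h where h: "laplace_symbol h" "\<phi> = inv_fourier (to_L2 h)" by blast
  have [measurable]: "h \<in> borel_measurable borel"
    using h(1) by (intro square_integrable_measurable laplace_symbol_square_integrable)
  obtain u where u: "square_integrable u" "\<phi> = to_L2 u" by (rule L2_cases)
  have "\<exists>w. square_integrable w \<and> weak_deriv is u w" if len: "length is \<le> 2" for "is"
  proof -
    define m where "m \<xi> = (\<Prod>i\<leftarrow>is. \<i> * complex_of_real (\<xi> $ i))" for \<xi> :: "real^'n"
    have [measurable]: "m \<in> borel_measurable borel" unfolding m_def by measurable
    have mh: "square_integrable (\<lambda>\<xi>. m \<xi> * h \<xi>)"
      by (rule square_integrable_bound[OF laplace_symbol_bessel[OF h(1)]])
        (auto simp: norm_mult m_def intro!: mult_right_mono norm_derivative_symbol_le len)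
    obtain w where w: "square_integrable w" "inv_fourier (to_L2 (\<lambda>\<xi>. m \<xi> * h \<xi>)) = to_L2 w" by (rule L2_cases)
    have "(LINT x|lborel. u x * partial_derivs is f x) = (- 1) ^ length is * (LINT x|lborel. w x * f x)"
      if f: "f \<in> test_functions UNIV" for f
    proof -
      have cf: "(\<lambda>x. cnj (f x)) \<in> test_functions UNIV" by (rule test_functions_cnj[OF f])
      have "(LINT x|lborel. u x * partial_derivs is f x) =
          cinner (inv_fourier (to_L2 h)) (to_L2 (partial_derivs is (\<lambda>x. cnj (f x))))"
        using integral_mult_test_function[OF u(1) test_functions_partial_derivs[OF f]]
        by (simp add: partial_derivs_cnj[OF test_functions_smooth[OF f]] flip: u(2) h(2))
      also have "\<dots> = (LINT \<xi>|lborel. h \<xi> * cnj (m \<xi> * fourier_transform (\<lambda>x. cnj (f x)) \<xi>)) / of_real (fourier_norm TYPE(real^'n))"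
        unfolding cinner_inv_fourier_test_function[OF laplace_symbol_square_integrable[OF h(1)] test_functions_partial_derivs[OF cf]]
          fourier_transform_partial_derivs[OF cf] m_def ..
      also have "\<dots> = (- 1) ^ length is * ((LINT \<xi>|lborel. (m \<xi> * h \<xi>) * cnj (fourier_transform (\<lambda>x. cnj (f x)) \<xi>)) / of_real (fourier_norm TYPE(real^'n)))"
      proof -
        have "h \<xi> * cnj (m \<xi> * fourier_transform (\<lambda>x. cnj (f x)) \<xi>) =
            (- 1) ^ length is * ((m \<xi> * h \<xi>) * cnj (fourier_transform (\<lambda>x. cnj (f x)) \<xi>))" for \<xi>
          unfolding complex_cnj_mult m_def cnj_derivative_symbol by (simp add: mult_ac)
        then show ?thesis by (simp only: integral_mult_right_zero times_divide_eq_right)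
      qed
      also have "\<dots> = (- 1) ^ length is * (LINT x|lborel. w x * f x)"
        unfolding cinner_inv_fourier_test_function[OF mh cf, symmetric] integral_mult_test_function[OF w(1) f] w(2) ..
      finally show ?thesis .
    qed
    then show ?thesis using w(1) unfolding weak_deriv_def by blast
  qed
  then show "\<phi> \<in> sobolev 2" using u unfolding sobolev_def by blast
next
  assume "\<phi> \<in> sobolev 2"
  then obtain u where u: "square_integrable u" "\<phi> = to_L2 u"
    and wd: "\<And>is. length is \<le> 2 \<Longrightarrow> \<exists>w. square_integrable w \<and> weak_deriv is u w"
    unfolding sobolev_def by blast
  have "\<forall>i. \<exists>w. square_integrable w \<and> weak_deriv [i, i] u w" using wd by simp
  then obtain w where w: "\<And>i. square_integrable (w i)" "\<And>i. weak_deriv [i, i] u (w i)" by metis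
  define W where "W x = - (\<Sum>i\<in>UNIV. w i x)" for x
  have "square_integrable (\<lambda>x. \<Sum>i\<in>I. w i x)" for I
    by (induction I rule: infinite_finite_induct) (auto simp: square_integrable_zero intro: square_integrable_add w)
  then have W: "square_integrable W" unfolding W_def[abs_def] by (rule square_integrable_uminus)
  obtain h where h: "square_integrable h" "to_L2 u = inv_fourier (to_L2 h)" by (rule inv_fourier_cases)
  obtain q where q: "square_integrable q" "to_L2 W = inv_fourier (to_L2 q)" by (rule inv_fourier_cases)
  have [measurable]: "h \<in> borel_measurable borel" "q \<in> borel_measurable borel"
    using h q by (auto intro: square_integrable_measurable)
  have eq: "(LINT x|lborel. u x * neg_laplacian f x) = (LINT x|lborel. W x * f x)" if f: "f \<in> test_functions UNIV" for f
  proof -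
    have "(LINT x|lborel. u x * neg_laplacian f x) = - (\<Sum>i\<in>UNIV. LINT x|lborel. u x * partial_derivs [i, i] f x)"
      unfolding neg_laplacian_def
      by (subst Bochner_Integration.integral_sum[symmetric])
        (simp_all add: square_integrable_mult u test_functions_square_integrable test_functions_partial_derivs f
          sum_distrib_left del: partial_derivs.simps)
    also have "\<dots> = - (\<Sum>i\<in>UNIV. LINT x|lborel. w i x * f x)"
      using w(2) f unfolding weak_deriv_def by simp
    also have "\<dots> = (LINT x|lborel. W x * f x)"
      unfolding W_def
      by (subst Bochner_Integration.integral_sum[symmetric])
        (simp_all add: square_integrable_mult w test_functions_square_integrable f sum_distrib_right)
    finally show ?thesis .
  qed
  \<comment> \<open>The mismatch between |\<xi>|^2 h and q. Its first term is not yet known to be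
    square integrable, so the weighted form of separation is what applies.\<close>
  define K where "K \<xi> = cnj (of_real ((norm \<xi>)\<^sup>2) * h \<xi> - q \<xi>)" for \<xi>
  have "AE \<xi> in lborel. K \<xi> = 0"
  proof (rule test_functions_separating)
    have "square_integrable (\<lambda>\<xi>. cnj (of_real ((norm \<xi>)\<^sup>2) * h \<xi> / bessel \<xi> - q \<xi> / bessel \<xi>))"
      by (intro square_integrable_cnj square_integrable_diff square_integrable_divide_bessel h q)
    then show "square_integrable (\<lambda>\<xi>. K \<xi> / bessel \<xi>)"
      by (simp add: K_def diff_divide_distrib)
    fix f :: "real^'n \<Rightarrow> complex" assume f: "f \<in> test_functions UNIV"
    have cf: "(\<lambda>x. cnj (f x)) \<in> test_functions UNIV" by (rule test_functions_cnj[OF f])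
    have "cinner (inv_fourier (to_L2 h)) (to_L2 (neg_laplacian f)) = cinner (inv_fourier (to_L2 q)) (to_L2 f)"
      using eq[OF cf] integral_mult_test_function[OF u(1) test_functions_neg_laplacian[OF cf]]
        integral_mult_test_function[OF W cf]
      by (simp add: neg_laplacian_cnj[OF test_functions_smooth[OF f]] flip: h(2) q(2))
    then have e: "(LINT \<xi>|lborel. h \<xi> * cnj (fourier_transform (neg_laplacian f) \<xi>)) =
        (LINT \<xi>|lborel. q \<xi> * cnj (fourier_transform f \<xi>))"
      by (simp add: cinner_inv_fourier_test_function h q f test_functions_neg_laplacian)
    have "cnj (LINT \<xi>|lborel. fourier_transform f \<xi> * K \<xi>) =
        (LINT \<xi>|lborel. h \<xi> * cnj (fourier_transform (neg_laplacian f) \<xi>) - q \<xi> * cnj (fourier_transform f \<xi>))"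
      unfolding fourier_transform_neg_laplacian[OF f] Bochner_Integration.integral_cnj[symmetric]
      by (simp add: K_def algebra_simps)
    also have "\<dots> = 0"
      by (subst Bochner_Integration.integral_diff)
        (auto intro!: square_integrable_mult_cnj h q laplace_symbol_square_integrable test_functions_laplace_symbol
          test_functions_neg_laplacian f simp: e)
    finally show "(LINT \<xi>|lborel. fourier_transform f \<xi> * K \<xi>) = 0" by simp
  qed
  then have "AE \<xi> in lborel. of_real ((norm \<xi>)\<^sup>2) * h \<xi> = q \<xi>"
    unfolding K_def complex_cnj_zero_iff by simp
  then have "square_integrable (\<lambda>\<xi>. of_real ((norm \<xi>)\<^sup>2) * h \<xi>)"
    by (intro square_integrable_AE_bound[OF q(1)]) auto
  then have "laplace_symbol h" using h(1) by (simp add: laplace_symbol_def)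
  then show "\<exists>h. laplace_symbol h \<and> \<phi> = inv_fourier (to_L2 h)" using h(2) u(2) by blast
qed


section \<open>The adjoint and the closure of the punctured Laplacian\<close>

text \<open>
  The maximal domain consists of those \<open>p\<close> for which \<open>|\<xi>|\<^sup>2p\<close> is square integrable up to an additive
  constant \<open>c\<close>, that is, up to a multiple of the Dirac measure at the puncture.
\<close>
definition max_laplacian :: "(real^'n::finite) operator" where
  "max_laplacian = {(inv_fourier (to_L2 p), inv_fourier (to_L2 (\<lambda>\<xi>. of_real ((norm \<xi>)\<^sup>2) * p \<xi> - c))) | p c.
     square_integrable p \<and> square_integrable (\<lambda>\<xi>. of_real ((norm \<xi>)\<^sup>2) * p \<xi> - c)}"

definition min_laplacian :: "(real^'n::finite) operator" where
  "min_laplacian = {(inv_fourier (to_L2 p), inv_fourier (to_L2 (\<lambda>\<xi>. of_real ((norm \<xi>)\<^sup>2) * p \<xi>))) | p.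
     laplace_symbol p \<and> (LINT \<xi>|lborel. p \<xi>) = 0}"

lemma punctured_laplacian_eq:
  "punctured_laplacian = {(to_L2 f, to_L2 (neg_laplacian f)) | f. f \<in> test_functions (- {0})}"
  unfolding punctured_laplacian_def neg_laplacian_def[abs_def] ..

text \<open>Green's formula on the Fourier side: the terms with |\<xi>|^2 cancel, and the boundary
  term couples the constant c with the integral of r, a multiple of the value at the
  puncture.\<close>

lemma cinner_max_laplacian:
  fixes p r :: "'a::euclidean_space \<Rightarrow> complex"
  assumes d: "DIM('a) \<le> 3" and r: "laplace_symbol r"
    and p: "square_integrable p" "square_integrable (\<lambda>\<xi>. of_real ((norm \<xi>)\<^sup>2) * p \<xi> - c)"
  shows "cinner (inv_fourier (to_L2 p)) (inv_fourier (to_L2 (\<lambda>\<xi>. of_real ((norm \<xi>)\<^sup>2) * r \<xi>))) -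
    cinner (inv_fourier (to_L2 (\<lambda>\<xi>. of_real ((norm \<xi>)\<^sup>2) * p \<xi> - c))) (inv_fourier (to_L2 r)) =
    c * cnj (LINT \<xi>|lborel. r \<xi>) / of_real (fourier_norm TYPE('a))"
proof -
  have r': "square_integrable r" "square_integrable (\<lambda>\<xi>. of_real ((norm \<xi>)\<^sup>2) * r \<xi>)"
    using r by (auto simp: laplace_symbol_def)
  have "(LINT \<xi>|lborel. p \<xi> * cnj (of_real ((norm \<xi>)\<^sup>2) * r \<xi>)) -
      (LINT \<xi>|lborel. (of_real ((norm \<xi>)\<^sup>2) * p \<xi> - c) * cnj (r \<xi>)) = (LINT \<xi>|lborel. c * cnj (r \<xi>))"
    unfolding Bochner_Integration.integral_diff[OF square_integrable_mult_cnj[OF p(1) r'(2)]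
        square_integrable_mult_cnj[OF p(2) r'(1)], symmetric]
    by (intro Bochner_Integration.integral_cong refl) (simp add: algebra_simps)
  also have "\<dots> = c * cnj (LINT \<xi>|lborel. r \<xi>)"
    by (simp only: integral_mult_right_zero Bochner_Integration.integral_cnj)
  finally show ?thesis
    by (simp only: cinner_inv_fourier cinner_to_L2[OF p(1) r'(2)] cinner_to_L2[OF p(2) r'(1)] diff_divide_distrib[symmetric])
qed

text \<open>Only the order in r matters below, so the circumscribed cube is precise enough.\<close>

lemma measure_cball_le:
  fixes r :: real
  assumes "0 \<le> r"
  shows "measure lborel (cball (0::'a::euclidean_space) r) \<le> (2 * r) ^ DIM('a)"
proof -
  have "measure lborel (cball (0::'a) r) \<le> measure lborel (cbox (- (r *\<^sub>R One)) (r *\<^sub>R One :: 'a))"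
  proof (rule measure_mono_fmeasurable)
    show "cball 0 r \<subseteq> cbox (- (r *\<^sub>R One)) (r *\<^sub>R One :: 'a)"
    proof
      fix x :: 'a assume "x \<in> cball 0 r"
      then have "\<bar>x \<bullet> b\<bar> \<le> r" if "b \<in> Basis" for b
        using Basis_le_norm[OF that, of x] by simp
      then show "x \<in> cbox (- (r *\<^sub>R One)) (r *\<^sub>R One)"
        by (simp add: mem_box inner_sum_left_Basis) (metis abs_le_iff minus_le_iff)
    qed
  qed auto
  also have "\<dots> = (2 * r) ^ DIM('a)"
  proof -
    have "(r *\<^sub>R One - (- (r *\<^sub>R One))) \<bullet> b = 2 * r" "- (r *\<^sub>R One) \<bullet> b \<le> r *\<^sub>R One \<bullet> b"
      if "b \<in> Basis" for b :: 'a
      using that assms by (auto simp: inner_diff_left inner_add_left inner_minus_left inner_sum_left_Basis)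
    then show ?thesis by (subst measure_lborel_cbox_eq) (simp cong: prod.cong_simp)
  qed
  finally show ?thesis .
qed

text \<open>
  Cutting off near the puncture: the error terms are bounded in \<open>L\<^sup>2\<close> because the dimension is at
  least 2, and they live on shrinking balls, so they tend to \<open>0\<close> weakly.
\<close>
lemma adjoint_punctured_vanishing:
  fixes f :: "real^'n::finite \<Rightarrow> complex"
  assumes d: "2 \<le> CARD('n)" "CARD('n) \<le> 3"
    and vw: "(v, w) \<in> adjoint_op (punctured_laplacian :: (real^'n) operator)"
    and f: "f \<in> test_functions UNIV" "f 0 = 0"
  shows "cinner (to_L2 (neg_laplacian f)) v = cinner (to_L2 f) w"
proof -
  obtain \<psi> :: "real^'n \<Rightarrow> complex" and M where \<psi>: "smooth \<psi>"
    "\<And>x. norm x \<le> 1 \<Longrightarrow> \<psi> x = 0" "\<And>x. 2 \<le> norm x \<Longrightarrow> \<psi> x = 1"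
    "\<And>x. cmod (\<psi> x) \<le> 1" "\<And>x. cmod (1 - \<psi> x) \<le> 1"
    "\<And>i x. cmod (partial_deriv i \<psi> x) \<le> M" "\<And>i x. cmod (partial_derivs [i, i] \<psi> x) \<le> M"
    "\<And>i x. norm x < 1 \<or> 2 < norm x \<Longrightarrow> partial_deriv i \<psi> x = 0"
    "\<And>i x. norm x < 1 \<or> 2 < norm x \<Longrightarrow> partial_derivs [i, i] \<psi> x = 0"
    by (rule smooth_cutoff_exists) blast
  have M: "0 \<le> M" using \<psi>(6)[of undefined 0] norm_ge_zero order_trans by blast
  obtain C where C: "0 \<le> C" "\<And>x. cmod (f x) \<le> C * norm x"
    by (rule test_functions_Lipschitz_at_0[OF d(2) f]) blast
  have smf: "smooth f" by (rule test_functions_smooth[OF f(1)])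
  have "\<exists>B. \<forall>x. cmod (partial_deriv i f x) \<le> B" for i
    using test_functions_bounded[OF test_functions_partial_deriv[OF f(1)]] by metis
  then obtain B' where B': "\<And>i x. cmod (partial_deriv i f x) \<le> B' i" by metis
  define B where "B = (\<Sum>i\<in>UNIV. B' i)"
  have B'0: "0 \<le> B' i" for i using B'[of i 0] norm_ge_zero order_trans by blast
  have B: "cmod (partial_deriv i f x) \<le> B" for i x
  proof -
    have "B' i \<le> B" unfolding B_def by (rule member_le_sum) (simp_all add: B'0)
    with B'[of i x] show ?thesis by (rule order_trans)
  qed
  have B0: "0 \<le> B" unfolding B_def by (intro sum_nonneg B'0)
  define s where "s n = real (Suc n)" for n
  have s: "1 \<le> s n" "0 < s n" for n by (auto simp: s_def)
  define \<eta> where "\<eta> n x = \<psi> (s n *\<^sub>R x)" for n x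
  have sm\<eta>: "smooth (\<eta> n)" for n unfolding \<eta>_def[abs_def] by (intro smooth_intros(9) \<psi>)
  have d\<eta>: "partial_deriv i (\<eta> n) x = of_real (s n) * partial_deriv i \<psi> (s n *\<^sub>R x)" for i n x
    unfolding \<eta>_def[abs_def] by (simp add: partial_deriv_dilate[OF \<psi>(1)])
  have dd\<eta>: "partial_derivs [i, i] (\<eta> n) x = of_real ((s n)\<^sup>2) * partial_derivs [i, i] \<psi> (s n *\<^sub>R x)" for i n x
    unfolding \<eta>_def[abs_def] partial_derivs_dilate_2[OF \<psi>(1)] by simp
  \<comment> \<open>The part of the Leibniz rule in which derivatives fall on the cut-off.\<close>
  define R where "R n x = f x * neg_laplacian (\<eta> n) x - 2 * (\<Sum>i\<in>UNIV. partial_deriv i f x * partial_deriv i (\<eta> n) x)" for n x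
  define m where "m = real CARD('n)"
  have m0: "0 \<le> m" by (simp add: m_def)
  have sum_bound: "cmod (\<Sum>i\<in>(UNIV :: 'n set). h i) \<le> m * b" if "\<And>i. cmod (h i) \<le> b" for h b
    using sum_norm_bound[of UNIV h b] that by (simp add: m_def)
  \<comment> \<open>On the ball |f| \<le> 2C / s while the Laplacian of the cut-off is at most m M
    s^2, and the gradients contribute 2 m B M s: both parts grow linearly in s.\<close>
  define D where "D = 2 * (C * (m * M)) + 2 * (m * (B * M))"
  have D0: "0 \<le> D" using C(1) B0 M m0 by (simp add: D_def)
  have R0: "R n x = 0" if "x \<notin> cball 0 (2 / s n)" for n x
  proof -
    have "2 < norm (s n *\<^sub>R x)" using that s[of n] by (simp add: divide_less_eq not_le mult.commute)
    then have "partial_deriv i \<psi> (s n *\<^sub>R x) = 0" "partial_derivs [i, i] \<psi> (s n *\<^sub>R x) = 0" for i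
      by (intro \<psi>(8,9) disjI2; simp)+
    then show ?thesis unfolding R_def neg_laplacian_def d\<eta> dd\<eta> by simp
  qed
  have RD: "cmod (R n x) \<le> D * s n" if "x \<in> cball 0 (2 / s n)" for n x
  proof -
    have "norm x \<le> 2 / s n" using that by simp
    then have "cmod (f x) \<le> C * (2 / s n)" using C order_trans mult_left_mono by metis
    moreover have "cmod (neg_laplacian (\<eta> n) x) \<le> m * ((s n)\<^sup>2 * M)"
      unfolding neg_laplacian_def norm_minus_cancel
    proof (rule sum_bound)
      show "cmod (partial_derivs [i, i] (\<eta> n) x) \<le> (s n)\<^sup>2 * M" for i
        unfolding dd\<eta> norm_mult norm_of_real by (simp add: mult_left_mono \<psi>(7) del: partial_derivs.simps)
    qed
    ultimately have "cmod (f x * neg_laplacian (\<eta> n) x) \<le> (C * (2 / s n)) * (m * ((s n)\<^sup>2 * M))"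
      unfolding norm_mult using C(1) s(2)[of n] by (intro mult_mono) auto
    also have "\<dots> = 2 * (C * (m * M)) * s n" using s(2)[of n] by (simp add: power2_eq_square)
    finally have 1: "cmod (f x * neg_laplacian (\<eta> n) x) \<le> 2 * (C * (m * M)) * s n" .
    have "cmod (partial_deriv i f x * partial_deriv i (\<eta> n) x) \<le> B * (s n * M)" for i
      unfolding norm_mult d\<eta> using s(2)[of n] B0 by (intro mult_mono B) (auto intro!: mult_left_mono \<psi>(6))
    then have "cmod (2 * (\<Sum>i\<in>UNIV. partial_deriv i f x * partial_deriv i (\<eta> n) x)) \<le> 2 * (m * (B * (s n * M)))"
      unfolding norm_mult[of 2] norm_numeral by (intro mult_left_mono sum_bound) auto
    with 1 have "cmod (R n x) \<le> 2 * (C * (m * M)) * s n + 2 * (m * (B * (s n * M)))"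
      unfolding R_def by (intro order_trans[OF norm_triangle_ineq4] add_mono)
    also have "\<dots> = D * s n" by (simp add: D_def algebra_simps)
    finally show ?thesis .
  qed
  have mR: "R n \<in> borel_measurable borel" for n
    unfolding R_def[abs_def]
    by (intro borel_measurable_continuous_onI continuous_intros smooth_continuous smf sm\<eta> smooth_partial_deriv continuous_neg_laplacian)
  have Rle: "(cmod (R n x))\<^sup>2 \<le> (D * s n)\<^sup>2 * indicator (cball 0 (2 / s n)) x" for n x
  proof (cases "x \<in> cball 0 (2 / s n)")
    case True
    then show ?thesis using power_mono[OF RD[OF True], of 2] by simp
  qed (simp add: R0)
  have icb: "integrable lborel (\<lambda>x::real^'n. (D * s n)\<^sup>2 * indicator (cball 0 (2 / s n)) x)" for n
    using emeasure_lborel_cball_finite[of "0::real^'n" "2 / s n"] by (intro integrable_mult_right) auto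
  have sqR: "square_integrable (R n)" for n
    unfolding square_integrable_def
  proof
    show "integrable lborel (\<lambda>x. (cmod (R n x))\<^sup>2)"
      by (rule Bochner_Integration.integrable_bound[OF icb[of n]]) (use mR Rle in \<open>auto intro!: AE_I2\<close>)
  qed (use mR in simp)
  have normR: "norm (to_L2 (R n)) \<le> D * 4 ^ CARD('n)" for n
  proof -
    have "(norm (to_L2 (R n)))\<^sup>2 \<le> (LINT x|lborel. (D * s n)\<^sup>2 * indicator (cball (0::real^'n) (2 / s n)) x)"
      unfolding norm_to_L2[OF sqR] using sqR icb Rle by (intro integral_mono) (auto simp: square_integrable_def)
    also have "\<dots> = (D * s n)\<^sup>2 * measure lborel (cball (0::real^'n) (2 / s n))" by simp
    also have "\<dots> \<le> (D * s n)\<^sup>2 * (2 * (2 / s n)) ^ CARD('n)"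
      using measure_cball_le[of "2 / s n", where 'a="real^'n"] s(2)[of n] by (intro mult_left_mono) auto
    also have "\<dots> = D\<^sup>2 * (4 ^ CARD('n) * ((s n)\<^sup>2 / (s n) ^ CARD('n)))"
      by (simp add: power_mult_distrib power_divide)
    \<comment> \<open>The lower bound on the dimension enters here: the volume, of order s^(-d),
      compensates for the factor s^2 once d \<ge> 2.\<close>
    also have "\<dots> \<le> D\<^sup>2 * (4 ^ CARD('n) * 1)"
      using s[of n] power_increasing[OF d(1) s(1)[of n]] by (intro mult_left_mono) (auto simp: divide_le_eq)
    \<comment> \<open>The extra factor only makes the bound a perfect square.\<close>
    also have "\<dots> \<le> D\<^sup>2 * (4 ^ CARD('n) * 4 ^ CARD('n))"
      by (intro mult_left_mono) auto
    also have "\<dots> = (D * 4 ^ CARD('n))\<^sup>2" by (simp add: power2_eq_square)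
    finally show ?thesis by (rule power2_le_imp_le) (use D0 in simp)
  qed
  obtain v0 where v0: "square_integrable v0" "v = to_L2 v0" by (rule L2_cases)
  have mv0: "v0 \<in> borel_measurable borel" by (rule square_integrable_measurable[OF v0(1)])
  \<comment> \<open>\<open>R n\<close> vanishes off this ball, so its product with v sees only
    \<open>V n\<close>, whose norm tends to 0; boundedness of \<open>R n\<close> then
    suffices.\<close>
  define V where "V n = (\<lambda>x. indicator (cball 0 (2 / s n)) x * v0 x)" for n
  have sqV: "square_integrable (V n)" for n unfolding V_def by (rule square_integrable_truncate[OF v0(1)])
  have s_lim: "\<forall>\<^sub>F n in sequentially. 2 < norm (s n *\<^sub>R x)" if "x \<noteq> 0" for x :: "real^'n"
  proof -
    have "filterlim s at_top sequentially"
      unfolding s_def by (intro filterlim_compose[OF filterlim_real_sequentially filterlim_Suc])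
    then have "\<forall>\<^sub>F n in sequentially. 2 / norm x < s n" by (simp add: filterlim_at_top_dense)
    then show ?thesis
      by eventually_elim (use that s in \<open>auto simp: divide_less_eq s_def\<close>)
  qed
  have AE0: "AE x in lborel. x \<noteq> (0 :: real^'n)" by (rule AE_lborel_singleton)
  have "(\<lambda>n. to_L2 (V n)) \<longlonglongrightarrow> to_L2 (\<lambda>x. 0)"
  proof (rule L2_dominated_convergence(3)[OF _ _ v0(1)])
    show "V n \<in> borel_measurable borel" for n by (rule square_integrable_measurable[OF sqV])
    show "AE x in lborel. cmod (V n x) \<le> cmod (v0 x)" for n
      by (auto simp: V_def split: split_indicator)
    show "AE x in lborel. (\<lambda>n. V n x) \<longlonglongrightarrow> 0"
      using AE0
    proof eventually_elim
      case (elim x)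
      have "\<forall>\<^sub>F n in sequentially. V n x = 0"
        using s_lim[OF elim]
      proof eventually_elim
        case (elim n)
        then have "x \<notin> cball 0 (2 / s n)" using s(2)[of n] by (simp add: divide_less_eq not_le mult.commute)
        then show ?case by (simp add: V_def)
      qed
      then show ?case by (rule tendsto_eventually)
    qed
  qed simp
  then have normV: "(\<lambda>n. norm (to_L2 (V n))) \<longlonglongrightarrow> 0"
    unfolding to_L2_zero by (rule tendsto_norm_zero)
  obtain K where K: "\<And>x y :: (real^'n) L2. cmod (cinner x y) \<le> norm x * norm y * K" "0 < K"
    using bounded_bilinear.pos_bounded[OF bounded_bilinear_cinner] by blast
  have Rv: "(\<lambda>n. cinner (to_L2 (R n)) v) \<longlonglongrightarrow> 0"
  proof (rule Lim_null_comparison)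
    show "\<forall>\<^sub>F n in sequentially. norm (cinner (to_L2 (R n)) v) \<le> (D * 4 ^ CARD('n)) * norm (to_L2 (V n)) * K"
    proof (rule always_eventually, rule allI)
      fix n
      have "R n x * cnj (v0 x) = R n x * cnj (V n x)" for x
        using R0[of x n] by (auto simp: V_def split: split_indicator)
      then have "cinner (to_L2 (R n)) v = cinner (to_L2 (R n)) (to_L2 (V n))"
        by (simp only: v0(2) cinner_to_L2[OF sqR v0(1)] cinner_to_L2[OF sqR sqV])
      also have "norm \<dots> \<le> norm (to_L2 (R n)) * norm (to_L2 (V n)) * K" by (rule K(1))
      also have "\<dots> \<le> (D * 4 ^ CARD('n)) * norm (to_L2 (V n)) * K"
        using K(2) by (intro mult_right_mono normR) auto
      finally show "norm (cinner (to_L2 (R n)) v) \<le> (D * 4 ^ CARD('n)) * norm (to_L2 (V n)) * K" .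
    qed
    show "(\<lambda>n. (D * 4 ^ CARD('n)) * norm (to_L2 (V n)) * K) \<longlonglongrightarrow> 0"
      by (intro tendsto_mult_left_zero tendsto_mult_right_zero normV)
  qed
  have conv: "(\<lambda>n. to_L2 (\<lambda>x. \<eta> n x * g x)) \<longlonglongrightarrow> to_L2 g" if g: "g \<in> test_functions UNIV" for g
  proof (rule L2_dominated_convergence(3)[OF _ _ test_functions_square_integrable[OF g]])
    show "(\<lambda>x. \<eta> n x * g x) \<in> borel_measurable borel" for n
      by (intro test_functions_measurable test_functions_mult(2) g sm\<eta>)
    show "AE x in lborel. cmod (\<eta> n x * g x) \<le> cmod (g x)" for n
      by (intro AE_I2) (simp add: norm_mult \<eta>_def mult_left_le_one_le \<psi>(4))
    show "AE x in lborel. (\<lambda>n. \<eta> n x * g x) \<longlonglongrightarrow> g x"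
      using AE0
    proof eventually_elim
      case (elim x)
      have "\<forall>\<^sub>F n in sequentially. \<eta> n x * g x = g x"
        using s_lim[OF elim] by eventually_elim (simp add: \<eta>_def \<psi>(3))
      then show ?case by (rule tendsto_eventually)
    qed
  qed (rule test_functions_measurable[OF g])
  \<comment> \<open>The cut-off function vanishes near 0, so it is admissible in the definition of
    the adjoint.\<close>
  have zero: "cinner (to_L2 (\<lambda>x. \<eta> n x * neg_laplacian f x)) v + cinner (to_L2 (R n)) v =
      cinner (to_L2 (\<lambda>x. \<eta> n x * f x)) w" for n
  proof -
    have tf: "(\<lambda>x. \<eta> n x * f x) \<in> test_functions (- {0})"
    proof (rule test_functions_puncturedI)
      show "(\<lambda>x. \<eta> n x * f x) \<in> test_functions UNIV" by (intro test_functions_mult(2) f sm\<eta>)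
      show "0 < 1 / s n" using s(2) by simp
      show "\<eta> n x * f x = 0" if "norm x < 1 / s n" for x
      proof -
        have "norm (s n *\<^sub>R x) \<le> 1" using that s(2)[of n] by (simp add: less_divide_eq mult.commute less_imp_le)
        then show ?thesis by (simp add: \<eta>_def \<psi>(2))
      qed
    qed
    have nl: "neg_laplacian (\<lambda>x. \<eta> n x * f x) = (\<lambda>x. \<eta> n x * neg_laplacian f x + R n x)"
      unfolding R_def neg_laplacian_mult[OF sm\<eta> smf, abs_def] by (simp add: fun_eq_iff mult.commute)
    have "cinner (to_L2 (neg_laplacian (\<lambda>x. \<eta> n x * f x))) v = cinner (to_L2 (\<lambda>x. \<eta> n x * f x)) w"
      using vw tf unfolding adjoint_op_def punctured_laplacian_eq by blast
    moreover have "to_L2 (neg_laplacian (\<lambda>x. \<eta> n x * f x)) = to_L2 (\<lambda>x. \<eta> n x * neg_laplacian f x) + to_L2 (R n)"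
      unfolding nl by (intro to_L2_add sqR test_functions_square_integrable test_functions_mult(2) test_functions_neg_laplacian f sm\<eta>)
    ultimately show ?thesis by (simp add: cinner_add_left)
  qed
  have "(\<lambda>n. cinner (to_L2 (\<lambda>x. \<eta> n x * neg_laplacian f x)) v + cinner (to_L2 (R n)) v) \<longlonglongrightarrow>
      cinner (to_L2 (neg_laplacian f)) v + 0"
    by (intro tendsto_add tendsto_cinner conv test_functions_neg_laplacian f tendsto_const Rv)
  moreover have "(\<lambda>n. cinner (to_L2 (\<lambda>x. \<eta> n x * f x)) w) \<longlonglongrightarrow> cinner (to_L2 f) w"
    by (intro tendsto_cinner conv f tendsto_const)
  ultimately show ?thesis unfolding zero using LIMSEQ_unique by fastforce
qed

text \<open>For (v, w) in the adjoint the functional f \<mapsto> (-\<Delta>f, v) - (f, w) vanishes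
  when f 0 = 0, hence is a multiple of f 0. As f 0 is a multiple of the integral of the transform of
  f, this multiple becomes an additive constant in the symbol.\<close>

lemma adjoint_punctured_laplacian:
  assumes d: "2 \<le> CARD('n::finite)" "CARD('n) \<le> 3"
  shows "adjoint_op (punctured_laplacian :: (real^'n) operator) = max_laplacian"
proof
  have d': "DIM(real^'n) \<le> 3" using d by simp
  define N where "N = complex_of_real (fourier_norm TYPE(real^'n))"
  have N: "N \<noteq> 0" by (simp add: N_def)
  have int0: "(LINT \<xi>|lborel. fourier_transform f \<xi>) = N * f 0" if "f \<in> test_functions UNIV" for f :: "real^'n \<Rightarrow> complex"
    using test_functions_inversion[OF d(2) that, of 0] by (simp add: fourier_integral_def N_def)
  show "max_laplacian \<subseteq> adjoint_op (punctured_laplacian :: (real^'n) operator)"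
  proof
    fix z :: "(real^'n) L2 \<times> (real^'n) L2" assume "z \<in> max_laplacian"
    then obtain p c where z: "z = (inv_fourier (to_L2 p), inv_fourier (to_L2 (\<lambda>\<xi>. of_real ((norm \<xi>)\<^sup>2) * p \<xi> - c)))"
      and p: "square_integrable p" "square_integrable (\<lambda>\<xi>. of_real ((norm \<xi>)\<^sup>2) * p \<xi> - c)"
      unfolding max_laplacian_def by blast
    have "cinner (to_L2 (neg_laplacian f)) (fst z) = cinner (to_L2 f) (snd z)" if f: "f \<in> test_functions (- {0})" for f
    proof -
      note f' = test_functions_UNIV[OF f]
      have "cinner (fst z) (to_L2 (neg_laplacian f)) - cinner (snd z) (to_L2 f) = 0"
        unfolding to_L2_neg_laplacian[OF f'] to_L2_test_functions[OF f'] z fst_conv snd_conv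
          cinner_max_laplacian[OF d' test_functions_laplace_symbol[OF f'] p] int0[OF f'] test_functions_punctured_0[OF f]
        by simp
      then show ?thesis
        by (metis cinner_commute eq_iff_diff_eq_0)
    qed
    then show "z \<in> adjoint_op punctured_laplacian"
      unfolding adjoint_op_def punctured_laplacian_eq by (auto simp: split_beta)
  qed
  show "adjoint_op (punctured_laplacian :: (real^'n) operator) \<subseteq> max_laplacian"
  proof
    fix z :: "(real^'n) L2 \<times> (real^'n) L2" assume z: "z \<in> adjoint_op punctured_laplacian"
    obtain v w where vw: "z = (v, w)" by (cases z)
    obtain p where p: "square_integrable p" "v = inv_fourier (to_L2 p)" by (rule inv_fourier_cases)
    obtain q where q: "square_integrable q" "w = inv_fourier (to_L2 q)" by (rule inv_fourier_cases)
    have [measurable]: "p \<in> borel_measurable borel" "q \<in> borel_measurable borel"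
      using p q by (auto intro: square_integrable_measurable)
    define \<Phi> where "\<Phi> f = cinner (to_L2 (neg_laplacian f)) v - cinner (to_L2 f) w" for f
    have \<Phi>0: "\<Phi> f = 0" if "f \<in> test_functions UNIV" "f 0 = 0" for f
      using adjoint_punctured_vanishing[OF d z[unfolded vw] that] by (simp add: \<Phi>_def)
    obtain \<psi> :: "real^'n \<Rightarrow> complex" where \<psi>: "smooth \<psi>" "\<psi> 0 = 0" "\<And>x. 2 < norm x \<Longrightarrow> \<psi> x = 1"
      by (rule smooth_cutoff_exists[where 'n='n]) (metis norm_zero zero_le_one less_imp_le)
    \<comment> \<open>A test function with value 1 at the puncture; subtracting f 0 times it from f
      reduces to the case of vanishing value.\<close>
    define f0 where "f0 x = 1 - \<psi> x" for x
    have f0: "f0 \<in> test_functions UNIV" "f0 0 = 1"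
    proof -
      show "f0 \<in> test_functions UNIV"
        unfolding f0_def[abs_def] by (rule test_functionsI[of _ 2]) (auto intro: smooth_diff smooth_intros(1) simp: \<psi>)
    qed (simp add: f0_def \<psi>)
    have \<Phi>_eq: "\<Phi> f = f 0 * \<Phi> f0" if f: "f \<in> test_functions UNIV" for f
    proof -
      define h where "h x = f x + (- f 0) * f0 x" for x
      have h: "h \<in> test_functions UNIV" "h 0 = 0"
        unfolding h_def[abs_def] by (intro test_functions_add f test_functions_cmult f0) (simp add: f0)
      have th: "to_L2 h = to_L2 f + (- f 0) *\<^sub>C to_L2 f0"
        unfolding h_def
        by (simp only: to_L2_add[OF test_functions_square_integrable[OF f] test_functions_square_integrable[OF test_functions_cmult[OF f0(1)]]]
            to_L2_scale[OF test_functions_square_integrable[OF f0(1)]])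
      have "neg_laplacian h = (\<lambda>x. neg_laplacian f x + (- f 0) * neg_laplacian f0 x)"
        unfolding h_def[abs_def]
        using neg_laplacian_add[OF test_functions_smooth[OF f] test_functions_smooth[OF test_functions_cmult[OF f0(1)]]]
        by (simp only: neg_laplacian_cmult[OF test_functions_smooth[OF f0(1)]])
      then have tl: "to_L2 (neg_laplacian h) = to_L2 (neg_laplacian f) + (- f 0) *\<^sub>C to_L2 (neg_laplacian f0)"
        using to_L2_add[OF test_functions_square_integrable[OF test_functions_neg_laplacian[OF f]]
            test_functions_square_integrable[OF test_functions_cmult[OF test_functions_neg_laplacian[OF f0(1)]]]]
        by (simp only: to_L2_scale[OF test_functions_square_integrable[OF test_functions_neg_laplacian[OF f0(1)]]])
      have "\<Phi> h = \<Phi> f - f 0 * \<Phi> f0"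
        unfolding \<Phi>_def th tl by (simp add: cinner_simps algebra_simps)
      then show ?thesis using \<Phi>0[OF h] by simp
    qed
    \<comment> \<open>The conjugate appears because v and w stand in the antilinear argument. No
      power of 2 pi remains: the factor from Plancherel cancels that from inversion at 0.\<close>
    define c where "c = cnj (\<Phi> f0)"
    define K where "K \<xi> = cnj (of_real ((norm \<xi>)\<^sup>2) * p \<xi> - q \<xi> - c)" for \<xi>
    have "AE \<xi> in lborel. K \<xi> = 0"
    proof (rule test_functions_separating)
      \<comment> \<open>A constant becomes square integrable after division by
        \<open>bessel\<close>, by the bound on the dimension.\<close>
      have "square_integrable (\<lambda>\<xi>::real^'n. c * (1 / bessel \<xi>))"
        by (intro square_integrable_scale square_integrable_inverse_bessel d')
      then have "square_integrable (\<lambda>\<xi>. cnj (of_real ((norm \<xi>)\<^sup>2) * p \<xi> / bessel \<xi> - q \<xi> / bessel \<xi> - c * (1 / bessel \<xi>)))"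
        by (intro square_integrable_cnj square_integrable_diff square_integrable_divide_bessel p q)
      then show "square_integrable (\<lambda>\<xi>. K \<xi> / bessel \<xi>)"
        by (simp add: K_def diff_divide_distrib)
      fix f :: "real^'n \<Rightarrow> complex" assume f: "f \<in> test_functions UNIV"
      note ft = square_integrable_fourier_transform[OF test_functions_integrable test_functions_square_integrable]
      have ff: "square_integrable (fourier_transform f)"
          "square_integrable (\<lambda>\<xi>. of_real ((norm \<xi>)\<^sup>2) * fourier_transform f \<xi>)"
        using test_functions_laplace_symbol[OF f] by (auto simp: laplace_symbol_def)
      have i: "integrable lborel (fourier_transform f)"
        by (rule laplace_symbol_integrable[OF d' test_functions_laplace_symbol[OF f]])
      have "N * \<Phi> f = (LINT \<xi>|lborel. of_real ((norm \<xi>)\<^sup>2) * fourier_transform f \<xi> * cnj (p \<xi>)) -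
          (LINT \<xi>|lborel. fourier_transform f \<xi> * cnj (q \<xi>))"
        unfolding \<Phi>_def to_L2_neg_laplacian[OF f] to_L2_test_functions[OF f] p(2) q(2) cinner_inv_fourier
          cinner_to_L2[OF ff(2) p(1)] cinner_to_L2[OF ff(1) q(1)]
        using N by (simp add: N_def diff_divide_distrib[symmetric])
      moreover have "N * \<Phi> f = (LINT \<xi>|lborel. fourier_transform f \<xi> * \<Phi> f0)"
        using int0[OF f] by (simp add: \<Phi>_eq[OF f])
      moreover have "(LINT \<xi>|lborel. fourier_transform f \<xi> * K \<xi>) =
          (LINT \<xi>|lborel. of_real ((norm \<xi>)\<^sup>2) * fourier_transform f \<xi> * cnj (p \<xi>)) -
          (LINT \<xi>|lborel. fourier_transform f \<xi> * cnj (q \<xi>)) - (LINT \<xi>|lborel. fourier_transform f \<xi> * \<Phi> f0)"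
      proof -
        have 1: "integrable lborel (\<lambda>\<xi>. of_real ((norm \<xi>)\<^sup>2) * fourier_transform f \<xi> * cnj (p \<xi>))"
          by (intro square_integrable_mult_cnj ff p)
        have 2: "integrable lborel (\<lambda>\<xi>. fourier_transform f \<xi> * cnj (q \<xi>))"
          by (intro square_integrable_mult_cnj ff q)
        have 3: "integrable lborel (\<lambda>\<xi>. fourier_transform f \<xi> * \<Phi> f0)" using i by simp
        show ?thesis
          unfolding Bochner_Integration.integral_diff[OF 1 2, symmetric]
            Bochner_Integration.integral_diff[OF Bochner_Integration.integrable_diff[OF 1 2] 3, symmetric]
          by (intro Bochner_Integration.integral_cong refl) (simp add: K_def c_def algebra_simps)
      qed
      ultimately show "(LINT \<xi>|lborel. fourier_transform f \<xi> * K \<xi>) = 0" by simp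
    qed
    then have AE: "AE \<xi> in lborel. of_real ((norm \<xi>)\<^sup>2) * p \<xi> - c = q \<xi>"
    proof eventually_elim
      case (elim \<xi>)
      then have "of_real ((norm \<xi>)\<^sup>2) * p \<xi> - q \<xi> - c = 0" unfolding K_def complex_cnj_zero_iff .
      then show ?case by (simp add: algebra_simps)
    qed
    then have sq: "square_integrable (\<lambda>\<xi>. of_real ((norm \<xi>)\<^sup>2) * p \<xi> - c)"
      by (intro square_integrable_AE_bound[OF q(1)]) auto
    then have "to_L2 (\<lambda>\<xi>. of_real ((norm \<xi>)\<^sup>2) * p \<xi> - c) = to_L2 q"
      using AE q(1) by (simp add: to_L2_eq_iff)
    then show "z \<in> max_laplacian"
      unfolding vw p(2) q(2) max_laplacian_def using p(1) sq by force
  qed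
qed

lemma resolvent_symbol:
  fixes \<zeta> :: complex
  assumes d: "DIM('a::euclidean_space) \<le> 3" and \<zeta>: "\<zeta> = \<i> \<or> \<zeta> = - \<i>"
  shows "of_real ((norm (\<xi>::'a))\<^sup>2) - \<zeta> \<noteq> 0"
    and "square_integrable (\<lambda>\<xi>::'a. 1 / (of_real ((norm \<xi>)\<^sup>2) - \<zeta>))"
proof -
  show nz: "of_real ((norm \<xi>)\<^sup>2) - \<zeta> \<noteq> 0" for \<xi> :: 'a
    using \<zeta> by (auto simp: complex_eq_iff simp del: of_real_power)
  have "square_integrable (\<lambda>\<xi>::'a. 2 * (1 / bessel \<xi>))"
    by (intro square_integrable_scale square_integrable_inverse_bessel d)
  then show "square_integrable (\<lambda>\<xi>::'a. 1 / (of_real ((norm \<xi>)\<^sup>2) - \<zeta>))"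
  proof (rule square_integrable_bound)
    show "cmod (1 / (of_real ((norm \<xi>)\<^sup>2) - \<zeta>)) \<le> cmod (2 * (1 / bessel \<xi>))" for \<xi> :: 'a
    proof -
      define t where "t = (norm \<xi>)\<^sup>2"
      have t: "0 \<le> t" by (simp add: t_def)
      have "(cmod (of_real t - \<zeta>))\<^sup>2 = t\<^sup>2 + 1" using \<zeta> by (auto simp: cmod_power2)
      \<comment> \<open>Origin of the factor 2 in the comparison with 1 /
        \<open>bessel\<close>.\<close>
      moreover have "((1 + t) / 2)\<^sup>2 \<le> t\<^sup>2 + 1"
      proof -
        have "((1 + t) / 2)\<^sup>2 = t\<^sup>2 / 4 + t / 2 + 1 / 4" by (simp add: power_divide power2_eq_square algebra_simps)
        moreover have "2 * t \<le> t\<^sup>2 + 1" using zero_le_power2[of "t - 1"] unfolding power2_diff by simp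
        moreover have "0 \<le> t\<^sup>2" by simp
        ultimately show ?thesis by linarith
      qed
      ultimately have "((1 + t) / 2)\<^sup>2 \<le> (cmod (of_real t - \<zeta>))\<^sup>2" by simp
      then have "(1 + t) / 2 \<le> cmod (of_real t - \<zeta>)" by (rule power2_le_imp_le) simp
      then have "1 / cmod (of_real t - \<zeta>) \<le> 1 / ((1 + t) / 2)"
        using t nz[of \<xi>] by (intro divide_left_mono) (auto simp: t_def[symmetric] simp del: of_real_power)
      then show ?thesis
        unfolding norm_mult norm_divide norm_bessel t_def[symmetric] by simp
    qed
  qed measurable
qed

section \<open>The double adjoint and the closure\<close>

text \<open>Testing against transforms of test functions, with c = 0, shows that the image has
  symbol |\<xi>|^2 r. One element with c = 1 then yields the vanishing of the integral of r by
  Green's formula.\<close>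

lemma adjoint_max_laplacian:
  assumes d: "CARD('n::finite) \<le> 3"
  shows "adjoint_op (max_laplacian :: (real^'n) operator) = min_laplacian"
proof
  have d': "DIM(real^'n) \<le> 3" using d by simp
  define N where "N = complex_of_real (fourier_norm TYPE(real^'n))"
  have N: "N \<noteq> 0" by (simp add: N_def)
  show "min_laplacian \<subseteq> adjoint_op (max_laplacian :: (real^'n) operator)"
  proof
    fix z :: "(real^'n) L2 \<times> (real^'n) L2" assume "z \<in> min_laplacian"
    then obtain r where z: "z = (inv_fourier (to_L2 r), inv_fourier (to_L2 (\<lambda>\<xi>. of_real ((norm \<xi>)\<^sup>2) * r \<xi>)))"
      and r: "laplace_symbol r" "(LINT \<xi>|lborel. r \<xi>) = 0" unfolding min_laplacian_def by blast
    show "z \<in> adjoint_op max_laplacian"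
      unfolding adjoint_op_def max_laplacian_def z
      using cinner_max_laplacian[OF d' r(1)] by (auto simp: r(2) simp del: of_real_power)
  qed
  show "adjoint_op (max_laplacian :: (real^'n) operator) \<subseteq> min_laplacian"
  proof
    fix z :: "(real^'n) L2 \<times> (real^'n) L2" assume z: "z \<in> adjoint_op max_laplacian"
    obtain x y where xy: "z = (x, y)" by (cases z)
    obtain r where r: "square_integrable r" "x = inv_fourier (to_L2 r)" by (rule inv_fourier_cases)
    obtain t where t: "square_integrable t" "y = inv_fourier (to_L2 t)" by (rule inv_fourier_cases)
    have [measurable]: "r \<in> borel_measurable borel" "t \<in> borel_measurable borel"
      using r t by (auto intro: square_integrable_measurable)
    have main: "(LINT \<xi>|lborel. (of_real ((norm \<xi>)\<^sup>2) * p \<xi> - c) * cnj (r \<xi>)) = (LINT \<xi>|lborel. p \<xi> * cnj (t \<xi>))"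
      if p: "square_integrable p" "square_integrable (\<lambda>\<xi>. of_real ((norm \<xi>)\<^sup>2) * p \<xi> - c)" for p c
    proof -
      have "(inv_fourier (to_L2 p), inv_fourier (to_L2 (\<lambda>\<xi>. of_real ((norm \<xi>)\<^sup>2) * p \<xi> - c))) \<in> max_laplacian"
        using p unfolding max_laplacian_def by blast
      then have "cinner (inv_fourier (to_L2 (\<lambda>\<xi>. of_real ((norm \<xi>)\<^sup>2) * p \<xi> - c))) x = cinner (inv_fourier (to_L2 p)) y"
        using z unfolding xy adjoint_op_def by blast
      then show ?thesis
        using N by (simp add: r t p cinner_inv_fourier cinner_to_L2 N_def del: of_real_power)
    qed
    define K where "K \<xi> = cnj (of_real ((norm \<xi>)\<^sup>2) * r \<xi> - t \<xi>)" for \<xi>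
    have "AE \<xi> in lborel. K \<xi> = 0"
    proof (rule test_functions_separating)
      have "square_integrable (\<lambda>\<xi>. cnj (of_real ((norm \<xi>)\<^sup>2) * r \<xi> / bessel \<xi> - t \<xi> / bessel \<xi>))"
        by (intro square_integrable_cnj square_integrable_diff square_integrable_divide_bessel r t)
      then show "square_integrable (\<lambda>\<xi>. K \<xi> / bessel \<xi>)"
        by (simp add: K_def diff_divide_distrib)
      fix f :: "real^'n \<Rightarrow> complex" assume f: "f \<in> test_functions UNIV"
      have ff: "square_integrable (fourier_transform f)"
          "square_integrable (\<lambda>\<xi>. of_real ((norm \<xi>)\<^sup>2) * fourier_transform f \<xi>)"
        using test_functions_laplace_symbol[OF f] by (auto simp: laplace_symbol_def)
      have "(LINT \<xi>|lborel. fourier_transform f \<xi> * K \<xi>) =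
        (LINT \<xi>|lborel. of_real ((norm \<xi>)\<^sup>2) * fourier_transform f \<xi> * cnj (r \<xi>) - fourier_transform f \<xi> * cnj (t \<xi>))"
        by (intro Bochner_Integration.integral_cong refl) (simp add: K_def algebra_simps)
      also have "\<dots> = 0"
        using main[OF ff(1), of 0] ff
        by (subst Bochner_Integration.integral_diff)
          (auto intro!: square_integrable_mult_cnj ff r t simp del: of_real_power)
      finally show "(LINT \<xi>|lborel. fourier_transform f \<xi> * K \<xi>) = 0" .
    qed
    then have AE: "AE \<xi> in lborel. of_real ((norm \<xi>)\<^sup>2) * r \<xi> = t \<xi>"
      unfolding K_def complex_cnj_zero_iff by simp
    then have sq: "square_integrable (\<lambda>\<xi>. of_real ((norm \<xi>)\<^sup>2) * r \<xi>)"
      by (intro square_integrable_AE_bound[OF t(1)]) auto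
    then have ls: "laplace_symbol r" using r(1) by (simp add: laplace_symbol_def)
    have eq: "to_L2 (\<lambda>\<xi>. of_real ((norm \<xi>)\<^sup>2) * r \<xi>) = to_L2 t"
      using AE sq t(1) by (simp add: to_L2_eq_iff)
    have "(LINT \<xi>|lborel. r \<xi>) = 0"
    proof -
      \<comment> \<open>A square integrable symbol with |\<xi>|^2 p - 1 = \<i> p, hence an element
        of the maximal operator with c = 1.\<close>
      define p where "p \<xi> = 1 / (of_real ((norm \<xi>)\<^sup>2) - \<i>)" for \<xi> :: "real^'n"
      have nz: "of_real ((norm \<xi>)\<^sup>2) - \<i> \<noteq> 0" for \<xi> :: "real^'n" by (rule resolvent_symbol[OF d']) simp
      have p: "square_integrable p" unfolding p_def[abs_def] by (rule resolvent_symbol[OF d']) simp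
      have ip: "of_real ((norm \<xi>)\<^sup>2) * p \<xi> - 1 = \<i> * p \<xi>" for \<xi>
        using nz[of \<xi>] by (simp add: p_def divide_simps del: of_real_power)
      have p': "square_integrable (\<lambda>\<xi>. of_real ((norm \<xi>)\<^sup>2) * p \<xi> - 1)"
        unfolding ip by (intro square_integrable_scale p)
      have m: "(inv_fourier (to_L2 p), inv_fourier (to_L2 (\<lambda>\<xi>. of_real ((norm \<xi>)\<^sup>2) * p \<xi> - 1))) \<in> max_laplacian"
        using p p' unfolding max_laplacian_def by blast
      have "cinner (inv_fourier (to_L2 (\<lambda>\<xi>. of_real ((norm \<xi>)\<^sup>2) * p \<xi> - 1))) x = cinner (inv_fourier (to_L2 p)) y"
        using z m unfolding xy adjoint_op_def by blast
      then have "1 * cnj (LINT \<xi>|lborel. r \<xi>) / N = 0"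
        using cinner_max_laplacian[OF d' ls p p'] by (simp add: r(2) t(2) eq N_def del: of_real_power)
      then show ?thesis using N by simp
    qed
    then show "z \<in> min_laplacian"
      unfolding min_laplacian_def xy r(2) t(2) eq[symmetric] using ls by blast
  qed
qed

lemma punctured_laplacian_linear:
  shows punctured_laplacian_zero: "(0, 0) \<in> (punctured_laplacian :: (real^'n::finite) operator)"
    and punctured_laplacian_scale: "(u, v) \<in> (punctured_laplacian :: (real^'n) operator) \<Longrightarrow>
      (c *\<^sub>C u, c *\<^sub>C v) \<in> punctured_laplacian"
    and punctured_laplacian_add: "(u, v) \<in> (punctured_laplacian :: (real^'n) operator) \<Longrightarrow>
      (u', v') \<in> punctured_laplacian \<Longrightarrow> (u + u', v + v') \<in> punctured_laplacian"
proof -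
  have test_add: "(\<lambda>x. f x + g x) \<in> test_functions (- {0})"
    if "f \<in> test_functions (- {0})" "g \<in> test_functions (- {0})" for f g :: "real^'n \<Rightarrow> complex"
  proof -
    have "{x. f x + g x \<noteq> 0} \<subseteq> {x. f x \<noteq> 0} \<union> {x. g x \<noteq> 0}" by auto
    then have "closure {x. f x + g x \<noteq> 0} \<subseteq> closure {x. f x \<noteq> 0} \<union> closure {x. g x \<noteq> 0}"
      using closure_mono by (simp only: closure_Un[symmetric])
    then show ?thesis
      using that test_functions_add[OF test_functions_UNIV[OF that(1)] test_functions_UNIV[OF that(2)]]
      unfolding test_functions_def by blast
  qed
  have test_scale: "(\<lambda>x. c * f x) \<in> test_functions (- {0})" if "f \<in> test_functions (- {0})" for f :: "real^'n \<Rightarrow> complex" and c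
  proof -
    have "closure {x. c * f x \<noteq> 0} \<subseteq> closure {x. f x \<noteq> 0}" by (intro closure_mono) auto
    then show ?thesis
      using that test_functions_cmult[OF test_functions_UNIV[OF that], of c] unfolding test_functions_def by blast
  qed
  have test_zero: "(\<lambda>x. 0) \<in> test_functions (- {0 :: real^'n})"
    by (simp add: test_functions_def smooth_intros(1))
  have "neg_laplacian (\<lambda>x::real^'n. 0) = (\<lambda>x. 0)"
    using neg_laplacian_cmult[OF smooth_intros(1), of 0 0] by simp
  then show "(0, 0) \<in> (punctured_laplacian :: (real^'n) operator)"
    unfolding punctured_laplacian_eq using test_zero by (force simp: to_L2_zero)
  assume "(u, v) \<in> (punctured_laplacian :: (real^'n) operator)"
  then obtain f where f: "f \<in> test_functions (- {0})" "u = to_L2 f" "v = to_L2 (neg_laplacian f)"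
    unfolding punctured_laplacian_eq by blast
  note fU = test_functions_UNIV[OF f(1)]
  note fs = test_functions_square_integrable[OF fU] test_functions_square_integrable[OF test_functions_neg_laplacian[OF fU]]
  have "(c *\<^sub>C u, c *\<^sub>C v) = (to_L2 (\<lambda>x. c * f x), to_L2 (neg_laplacian (\<lambda>x. c * f x)))"
    by (simp add: f to_L2_scale fs neg_laplacian_cmult test_functions_smooth[OF f(1)])
  then show "(c *\<^sub>C u, c *\<^sub>C v) \<in> punctured_laplacian"
    unfolding punctured_laplacian_eq using test_scale[OF f(1)] by blast
  assume "(u', v') \<in> (punctured_laplacian :: (real^'n) operator)"
  then obtain g where g: "g \<in> test_functions (- {0})" "u' = to_L2 g" "v' = to_L2 (neg_laplacian g)"
    unfolding punctured_laplacian_eq by blast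
  note gU = test_functions_UNIV[OF g(1)]
  note gs = test_functions_square_integrable[OF gU] test_functions_square_integrable[OF test_functions_neg_laplacian[OF gU]]
  have "(u + u', v + v') = (to_L2 (\<lambda>x. f x + g x), to_L2 (neg_laplacian (\<lambda>x. f x + g x)))"
    by (simp add: f g to_L2_add fs gs neg_laplacian_add test_functions_smooth[OF f(1)] test_functions_smooth[OF g(1)])
  then show "(u + u', v + v') \<in> punctured_laplacian"
    unfolding punctured_laplacian_eq using test_add[OF f(1) g(1)] by blast
qed

lemma closure_punctured_laplacian:
  assumes d: "2 \<le> CARD('n::finite)" "CARD('n) \<le> 3"
  shows "closure (punctured_laplacian :: (real^'n) operator) = min_laplacian"
  using closure_eq_adjoint_adjoint[of "punctured_laplacian :: (real^'n) operator"]
  by (simp add: punctured_laplacian_zero punctured_laplacian_scale punctured_laplacian_add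
      adjoint_punctured_laplacian[OF d] adjoint_max_laplacian[OF d(2)])


section \<open>Self-adjoint extensions\<close>

lemma max_laplacian_add:
  fixes u v u' v' :: "(real^'n::finite) L2"
  assumes "(u, v) \<in> max_laplacian" "(u', v') \<in> max_laplacian"
  shows "(u + u', v + v') \<in> max_laplacian"
proof -
  let ?q = "\<lambda>p c \<xi>. complex_of_real ((norm (\<xi>::real^'n))\<^sup>2) * p \<xi> - c"
  obtain p c where p: "square_integrable p" "square_integrable (?q p c)" "u = inv_fourier (to_L2 p)" "v = inv_fourier (to_L2 (?q p c))"
    using assms(1) unfolding max_laplacian_def by blast
  obtain p' c' where p': "square_integrable p'" "square_integrable (?q p' c')" "u' = inv_fourier (to_L2 p')" "v' = inv_fourier (to_L2 (?q p' c'))"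
    using assms(2) unfolding max_laplacian_def by blast
  have eq: "?q (\<lambda>\<xi>. p \<xi> + p' \<xi>) (c + c') = (\<lambda>\<xi>. ?q p c \<xi> + ?q p' c' \<xi>)" by (simp add: fun_eq_iff algebra_simps)
  have "u + u' = inv_fourier (to_L2 (\<lambda>\<xi>. p \<xi> + p' \<xi>))" "v + v' = inv_fourier (to_L2 (?q (\<lambda>\<xi>. p \<xi> + p' \<xi>) (c + c')))"
    unfolding eq by (simp_all only: p p' to_L2_add[OF p(1) p'(1)] to_L2_add[OF p(2) p'(2)] inv_fourier_add)
  moreover have "square_integrable (\<lambda>\<xi>. p \<xi> + p' \<xi>)" "square_integrable (?q (\<lambda>\<xi>. p \<xi> + p' \<xi>) (c + c'))"
    unfolding eq by (intro square_integrable_add p p')+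
  ultimately show ?thesis unfolding max_laplacian_def by blast
qed

lemma max_laplacian_scale:
  fixes u v :: "(real^'n::finite) L2"
  assumes "(u, v) \<in> max_laplacian"
  shows "(b *\<^sub>C u, b *\<^sub>C v) \<in> max_laplacian"
proof -
  let ?q = "\<lambda>p c \<xi>. complex_of_real ((norm (\<xi>::real^'n))\<^sup>2) * p \<xi> - c"
  obtain p c where p: "square_integrable p" "square_integrable (?q p c)" "u = inv_fourier (to_L2 p)" "v = inv_fourier (to_L2 (?q p c))"
    using assms(1) unfolding max_laplacian_def by blast
  have eq: "?q (\<lambda>\<xi>. b * p \<xi>) (b * c) = (\<lambda>\<xi>. b * ?q p c \<xi>)" by (simp add: fun_eq_iff algebra_simps)
  have "b *\<^sub>C u = inv_fourier (to_L2 (\<lambda>\<xi>. b * p \<xi>))" "b *\<^sub>C v = inv_fourier (to_L2 (?q (\<lambda>\<xi>. b * p \<xi>) (b * c)))"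
    unfolding eq by (simp_all only: p to_L2_scale[OF p(1)] to_L2_scale[OF p(2)] inv_fourier_scaleC)
  moreover have "square_integrable (\<lambda>\<xi>. b * p \<xi>)" "square_integrable (?q (\<lambda>\<xi>. b * p \<xi>) (b * c))"
    unfolding eq by (intro square_integrable_scale p)+
  ultimately show ?thesis unfolding max_laplacian_def by blast
qed

text \<open>If p vanishes almost everywhere, the image has the constant symbol -c, which is in L2 of
  the whole space only for c = 0. This is what makes the adjoint single-valued.\<close>

lemma max_laplacian_zero:
  fixes w :: "(real^'n::finite) L2"
  assumes "(0, w) \<in> max_laplacian"
  shows "w = 0"
proof -
  let ?q = "\<lambda>p c \<xi>. complex_of_real ((norm (\<xi>::real^'n))\<^sup>2) * p \<xi> - c"
  obtain p c where p: "square_integrable p" "square_integrable (?q p c)" "0 = inv_fourier (to_L2 p)" "w = inv_fourier (to_L2 (?q p c))"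
    using assms(1) unfolding max_laplacian_def by blast
  have inv0: "inv_fourier (0 :: (real^'n) L2) = 0" using inv_fourier_scaleC[of 0 "0 :: (real^'n) L2"] by simp
  then have "to_L2 p = to_L2 (\<lambda>\<xi>. 0)" using p(3) inv_fourier_eq_iff unfolding to_L2_zero by metis
  then have AE: "AE \<xi> in lborel. p \<xi> = 0" using p(1) by (simp add: to_L2_eq_iff square_integrable_zero)
  then have AEc: "AE \<xi> in lborel. ?q p c \<xi> = - c" by eventually_elim simp
  then have "square_integrable (\<lambda>\<xi>::real^'n. - c)"
    by (intro square_integrable_AE_bound[OF p(2)]) auto
  then have i: "integrable lborel (\<lambda>\<xi>::real^'n. (cmod c)\<^sup>2)" by (simp add: square_integrable_def)
  have "c = 0"
  proof (rule ccontr)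
    assume "c \<noteq> 0"
    then have "integrable lborel (\<lambda>\<xi>::real^'n. (1 / (cmod c)\<^sup>2) * (cmod c)\<^sup>2)" using i by (intro integrable_mult_right)
    then have "integrable lborel (indicator UNIV :: real^'n \<Rightarrow> real)" using \<open>c \<noteq> 0\<close> by simp
    then show False by (simp only: integrable_indicator_iff) (simp add: emeasure_lborel_UNIV)
  qed
  then have "to_L2 (?q p c) = to_L2 (\<lambda>\<xi>. 0)"
    using AEc p(2) by (simp add: to_L2_eq_iff square_integrable_zero)
  then show ?thesis using p(4) inv0 by (simp add: to_L2_zero)
qed

lemma max_laplacian_single_valued: "single_valued (max_laplacian :: (real^'n::finite) operator)"
proof (rule single_valuedI)
  fix u v w :: "(real^'n) L2" assume uv: "(u, v) \<in> max_laplacian" and uw: "(u, w) \<in> max_laplacian"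
  have "(u + (- 1) *\<^sub>C u, v + (- 1) *\<^sub>C w) \<in> max_laplacian"
    by (intro max_laplacian_add uv max_laplacian_scale uw)
  then have "(0, v - w) \<in> max_laplacian" by (simp add: scaleC_minus_left)
  then show "v = w" using max_laplacian_zero by fastforce
qed

text \<open>A vector w orthogonal to the domain gives (0, w) in the adjoint, so w = 0 because the
  adjoint is single-valued.\<close>

lemma punctured_laplacian_densely_defined:
  assumes d: "2 \<le> CARD('n::finite)" "CARD('n) \<le> 3"
  shows "closure (Domain (punctured_laplacian :: (real^'n) operator)) = UNIV"
proof (rule dense_of_no_orthogonal)
  let ?L = "punctured_laplacian :: (real^'n) operator"
  show "subspace (Domain ?L)"
  proof (rule subspaceI)
    show "0 \<in> Domain ?L" using punctured_laplacian_zero by blast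
    show "x + y \<in> Domain ?L" if "x \<in> Domain ?L" "y \<in> Domain ?L" for x y
      using that punctured_laplacian_add by blast
    show "c *\<^sub>R x \<in> Domain ?L" if "x \<in> Domain ?L" for c x
      using that punctured_laplacian_scale unfolding scaleR_eq_scaleC by blast
  qed
  fix w assume w: "\<And>s. s \<in> Domain ?L \<Longrightarrow> inner s w = 0"
  have "cinner x w = 0" if "x \<in> Domain ?L" for x
  proof -
    have "inner (c *\<^sub>C x) w = 0" for c using that w punctured_laplacian_scale by blast
    then have "cinner w x = 0" by (rule inner_all_multiples_zero)
    then show ?thesis using cinner_commute[of x w] by simp
  qed
  then have "(0, w) \<in> adjoint_op ?L" unfolding adjoint_op_def by (auto simp: Domain_iff)
  then show "w = 0" using max_laplacian_zero adjoint_punctured_laplacian[OF d] by blast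
qed

lemma Domain_min_laplacian:
  assumes "CARD('n::finite) \<le> 3"
  shows "Domain (min_laplacian :: (real^'n) operator) = {\<phi>. \<phi> \<in> sobolev 2 \<and> point_value \<phi> 0 = 0}"
proof -
  have d': "DIM(real^'n) \<le> 3" using assms by simp
  have "\<phi> \<in> Domain min_laplacian \<longleftrightarrow> (\<exists>p. laplace_symbol p \<and> (LINT \<xi>|lborel. p \<xi>) = 0 \<and> \<phi> = inv_fourier (to_L2 p))" for \<phi> :: "(real^'n) L2"
    unfolding min_laplacian_def by blast
  also have "\<dots> \<phi> \<longleftrightarrow> \<phi> \<in> sobolev 2 \<and> point_value \<phi> 0 = 0" for \<phi> :: "(real^'n) L2"
    using point_value_inv_fourier[OF d'] by (auto simp: sobolev_2_iff)
  finally show ?thesis by blast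
qed

lemma not_AE_lborel_False: "\<not> (AE x in (lborel :: 'a::euclidean_space measure). False)"
  by (simp add: eventually_False ae_filter_eq_bot_iff emeasure_lborel_UNIV)

section \<open>Defect vectors, the boundary form and its isotropic lines\<close>

locale point_interaction =
  fixes n_type :: "'n::finite itself"
  assumes dim: "2 \<le> CARD('n)" "CARD('n) \<le> 3"
begin

abbreviation L_min :: "(real^'n) operator" where "L_min \<equiv> min_laplacian"
abbreviation L_max :: "(real^'n) operator" where "L_max \<equiv> max_laplacian"

definition e1 :: "real^'n \<Rightarrow> complex" where "e1 \<xi> = 1 / (of_real ((norm \<xi>)\<^sup>2) - \<i>)"
definition e2 :: "real^'n \<Rightarrow> complex" where "e2 \<xi> = 1 / (of_real ((norm \<xi>)\<^sup>2) + \<i>)"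
definition g1 :: "(real^'n) L2" where "g1 = inv_fourier (to_L2 e1)"
definition g2 :: "(real^'n) L2" where "g2 = inv_fourier (to_L2 e2)"

lemma dim': "DIM(real^'n) \<le> 3" using dim by simp

lemma denominators: "of_real ((norm (\<xi> :: real^'n))\<^sup>2) - \<i> \<noteq> 0" "of_real ((norm (\<xi> :: real^'n))\<^sup>2) + \<i> \<noteq> 0"
  using resolvent_symbol(1)[OF dim', of \<i> \<xi>] resolvent_symbol(1)[OF dim', of "- \<i>" \<xi>] by simp_all

lemma square_integrable_e: "square_integrable e1" "square_integrable e2"
  using resolvent_symbol(2)[OF dim', of \<i>] resolvent_symbol(2)[OF dim', of "- \<i>"]
  by (simp_all add: e1_def[abs_def] e2_def[abs_def])

text \<open>With c = 1 in both cases, g1 and g2 are eigenvectors of the adjoint for \<i> and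
  -\<i>.\<close>

lemma e_eq: "of_real ((norm \<xi>)\<^sup>2) * e1 \<xi> - 1 = \<i> * e1 \<xi>" "of_real ((norm \<xi>)\<^sup>2) * e2 \<xi> - 1 = - \<i> * e2 \<xi>"
  using denominators[of \<xi>] by (simp_all add: e1_def e2_def divide_simps del: of_real_power)

lemma g_in_max: "(g1, \<i> *\<^sub>C g1) \<in> L_max" "(g2, (- \<i>) *\<^sub>C g2) \<in> L_max"
proof -
  have "\<i> *\<^sub>C g1 = inv_fourier (to_L2 (\<lambda>\<xi>. of_real ((norm \<xi>)\<^sup>2) * e1 \<xi> - 1))"
    "square_integrable (\<lambda>\<xi>. of_real ((norm \<xi>)\<^sup>2) * e1 \<xi> - 1)"
    unfolding e_eq g1_def
    by (simp_all only: to_L2_scale[OF square_integrable_e(1)] inv_fourier_scaleC square_integrable_scale[OF square_integrable_e(1)])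
  then show "(g1, \<i> *\<^sub>C g1) \<in> L_max"
    unfolding max_laplacian_def g1_def using square_integrable_e(1) by blast
  have "(- \<i>) *\<^sub>C g2 = inv_fourier (to_L2 (\<lambda>\<xi>. of_real ((norm \<xi>)\<^sup>2) * e2 \<xi> - 1))"
    "square_integrable (\<lambda>\<xi>. of_real ((norm \<xi>)\<^sup>2) * e2 \<xi> - 1)"
    unfolding e_eq g2_def
    by (simp_all only: to_L2_scale[OF square_integrable_e(2)] inv_fourier_scaleC square_integrable_scale[OF square_integrable_e(2)])
  then show "(g2, (- \<i>) *\<^sub>C g2) \<in> L_max"
    unfolding max_laplacian_def g2_def using square_integrable_e(2) by blast
qed

text \<open>The two symbols are complex conjugates. Equality of the norms is what makes the
  parameter z range over the unit circle rather than a circle of another radius.\<close>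

lemma norm_g: "norm g2 = norm g1" "norm g1 \<noteq> 0"
proof -
  have c: "e2 \<xi> = cnj (e1 \<xi>)" for \<xi> by (simp add: e1_def e2_def)
  have n: "(norm (to_L2 e2))\<^sup>2 = (norm (to_L2 e1))\<^sup>2"
    by (simp add: norm_to_L2 square_integrable_e) (simp add: c)
  then have "(norm g2)\<^sup>2 = (norm g1)\<^sup>2" by (simp add: g1_def g2_def norm_inv_fourier)
  then show "norm g2 = norm g1" by (simp add: power2_eq_iff_nonneg)
  show "norm g1 \<noteq> 0"
  proof
    assume "norm g1 = 0"
    then have "(norm (to_L2 e1))\<^sup>2 = 0" using norm_inv_fourier[of "to_L2 e1"] by (simp add: g1_def)
    then have "to_L2 e1 = to_L2 (\<lambda>_. 0)" by (simp add: to_L2_zero)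
    then have "AE \<xi> in lborel. e1 \<xi> = 0" by (simp add: to_L2_eq_iff square_integrable_e square_integrable_zero)
    then have "AE \<xi> in (lborel :: (real^'n) measure). False"
      by eventually_elim (use denominators in \<open>simp add: e1_def del: of_real_power\<close>)
    then show False by (simp add: not_AE_lborel_False)
  qed
qed

lemma cinner_g: "cinner g1 g1 = of_real ((norm g1)\<^sup>2)" "cinner g2 g2 = of_real ((norm g1)\<^sup>2)"
  using norm_g(1) by (simp_all only: cinner_eq_norm)

lemma adjoint_L_max: "adjoint_op L_max = L_min" by (rule adjoint_max_laplacian[OF dim(2)])
lemma closure_L: "closure (punctured_laplacian :: (real^'n) operator) = L_min" by (rule closure_punctured_laplacian[OF dim])
lemma adjoint_L: "adjoint_op (punctured_laplacian :: (real^'n) operator) = L_max" by (rule adjoint_punctured_laplacian[OF dim])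

lemma L_min_sub_max: "L_min \<subseteq> L_max"
proof -
  have "(inv_fourier (to_L2 p), inv_fourier (to_L2 (\<lambda>\<xi>. of_real ((norm \<xi>)\<^sup>2) * p \<xi>))) \<in> L_max" if "laplace_symbol p" for p
    using that unfolding max_laplacian_def laplace_symbol_def
    by (intro CollectI exI[of _ p] exI[of _ 0]) simp
  then show ?thesis unfolding min_laplacian_def by blast
qed

lemma symmetric: "(\<phi>, \<psi>) \<in> L_min \<Longrightarrow> (v, w) \<in> L_max \<Longrightarrow> cinner w \<phi> = cinner v \<psi>"
  unfolding adjoint_L_max[symmetric] adjoint_op_def by blast

text \<open>Every adjoint relation is a complex subspace, and \<open>L_min\<close> is an
  adjoint.\<close>

lemma L_min_subspace:
  shows "(u, v) \<in> L_min \<Longrightarrow> (u', v') \<in> L_min \<Longrightarrow> (u + u', v + v') \<in> L_min"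
    and "(u, v) \<in> L_min \<Longrightarrow> (c *\<^sub>C u, c *\<^sub>C v) \<in> L_min" and "(0, 0) \<in> L_min"
  unfolding adjoint_L_max[symmetric] adjoint_op_def by (auto simp: cinner_simps dest!: bspec)

definition defect :: "complex \<Rightarrow> complex \<Rightarrow> (real^'n) L2" where "defect \<beta> \<gamma> = \<beta> *\<^sub>C g1 + \<gamma> *\<^sub>C g2"
definition defect_image :: "complex \<Rightarrow> complex \<Rightarrow> (real^'n) L2" where "defect_image \<beta> \<gamma> = (\<i> * \<beta>) *\<^sub>C g1 - (\<i> * \<gamma>) *\<^sub>C g2"

lemma defect_in_max: "(defect \<beta> \<gamma>, defect_image \<beta> \<gamma>) \<in> L_max"
  using max_laplacian_add[OF max_laplacian_scale[OF g_in_max(1), of \<beta>] max_laplacian_scale[OF g_in_max(2), of \<gamma>]]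
  by (simp add: defect_def defect_image_def scaleC_minus_left scaleC_minus_right mult.commute)

lemma add_in_max: "(\<phi>, \<psi>) \<in> L_min \<Longrightarrow> (\<phi> + defect \<beta> \<gamma>, \<psi> + defect_image \<beta> \<gamma>) \<in> L_max"
  using L_min_sub_max by (blast intro: max_laplacian_add defect_in_max)

lemma defect_linear: "defect \<beta> \<gamma> + defect \<beta>' \<gamma>' = defect (\<beta> + \<beta>') (\<gamma> + \<gamma>')" "c *\<^sub>C defect \<beta> \<gamma> = defect (c * \<beta>) (c * \<gamma>)"
  "defect_image \<beta> \<gamma> + defect_image \<beta>' \<gamma>' = defect_image (\<beta> + \<beta>') (\<gamma> + \<gamma>')" "c *\<^sub>C defect_image \<beta> \<gamma> = defect_image (c * \<beta>) (c * \<gamma>)"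
  by (simp_all add: defect_def defect_image_def scaleC_add_left scaleC_add_right scaleC_diff_right distrib_left mult_ac)

text \<open>
  The constant \<open>c\<close> fixes \<open>\<beta> + \<gamma>\<close>; the remaining freedom is used to make the integral of the remainder
  vanish, which is possible as \<open>e1 - e2 = 2\<i> / (|\<xi>|\<^sup>4 + 1)\<close> has non-zero integral.
\<close>
lemma max_decomposition:
  assumes "(v, w) \<in> L_max"
  obtains \<phi> \<psi> \<beta> \<gamma> where "(\<phi>, \<psi>) \<in> L_min" "v = \<phi> + defect \<beta> \<gamma>" "w = \<psi> + defect_image \<beta> \<gamma>"
proof -
  let ?n = "\<lambda>\<xi>::real^'n. complex_of_real ((norm \<xi>)\<^sup>2)"
  obtain p c where p: "square_integrable p" "square_integrable (\<lambda>\<xi>. ?n \<xi> * p \<xi> - c)"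
      "v = inv_fourier (to_L2 p)" "w = inv_fourier (to_L2 (\<lambda>\<xi>. ?n \<xi> * p \<xi> - c))"
    using assms unfolding max_laplacian_def by blast
  define D where "D \<xi> = e1 \<xi> - e2 \<xi>" for \<xi>
  have nD: "?n \<xi> * D \<xi> = \<i> * (e1 \<xi> + e2 \<xi>)" for \<xi>
  proof -
    have "?n \<xi> * D \<xi> = (?n \<xi> * e1 \<xi> - 1) - (?n \<xi> * e2 \<xi> - 1)" by (simp add: D_def right_diff_distrib)
    then show ?thesis by (simp only: e_eq) (simp add: distrib_left)
  qed
  have symD: "laplace_symbol D"
    unfolding laplace_symbol_def nD unfolding D_def[abs_def]
    by (intro conjI square_integrable_diff square_integrable_scale square_integrable_add square_integrable_e)
  have intD: "integrable lborel D" by (rule laplace_symbol_integrable[OF dim' symD])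
  have D_eq: "D \<xi> = 2 * \<i> * of_real (1 / ((norm \<xi>) ^ 4 + 1))" for \<xi>
  proof -
    have "(?n \<xi> - \<i>) * (?n \<xi> + \<i>) = of_real ((norm \<xi>) ^ 4 + 1)"
      by (simp add: algebra_simps flip: power_add)
    then show ?thesis
      using denominators[of \<xi>]
      by (simp add: D_def e1_def e2_def diff_frac_eq del: of_real_power)
  qed
  define I where "I = (LINT \<xi>|lborel. D \<xi>)"
  have I: "I \<noteq> 0"
  proof
    assume "I = 0"
    define r where "r \<xi> = 1 / ((norm (\<xi> :: real^'n)) ^ 4 + 1)" for \<xi>
    have "I = (LINT \<xi>|lborel. 2 * \<i> * of_real (r \<xi>))"
      unfolding I_def D_eq r_def ..
    also have "\<dots> = 2 * \<i> * of_real (LINT \<xi>|lborel. r \<xi>)"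
      by (simp only: integral_mult_right_zero integral_complex_of_real)
    finally have "I = 2 * \<i> * of_real (LINT \<xi>|lborel. r \<xi>)" .
    then have z: "(LINT \<xi>|lborel. r \<xi>) = 0" using \<open>I = 0\<close> by simp
    have ri: "integrable lborel r"
    proof -
      have "integrable lborel (\<lambda>\<xi>. Im (D \<xi>) / 2)" using intD by simp
      moreover have "D \<xi> = 2 * \<i> * of_real (r \<xi>)" for \<xi> unfolding D_eq r_def ..
      ultimately show ?thesis by simp
    qed
    have pos: "0 < r \<xi>" for \<xi> by (simp add: r_def add_nonneg_pos)
    have "AE \<xi> in lborel. r \<xi> = 0"
      using integral_nonneg_eq_0_iff_AE[OF ri] pos z by (simp add: less_imp_le)
    then have "AE \<xi> in (lborel :: (real^'n) measure). False"
      by eventually_elim (use pos in \<open>metis less_irrefl\<close>)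
    then show False by (simp add: not_AE_lborel_False)
  qed
  \<comment> \<open>e1 belongs to the constant 1, so subtracting c e1 leaves a symbol belonging to
    the constant 0.\<close>
  define h0 where "h0 \<xi> = p \<xi> - c * e1 \<xi>" for \<xi>
  have nh0: "?n \<xi> * h0 \<xi> = (?n \<xi> * p \<xi> - c) - c * \<i> * e1 \<xi>" for \<xi>
  proof -
    have "?n \<xi> * h0 \<xi> = (?n \<xi> * p \<xi> - c) - c * (?n \<xi> * e1 \<xi> - 1)" by (simp add: h0_def algebra_simps)
    then show ?thesis by (simp only: e_eq mult.assoc)
  qed
  have symh0: "laplace_symbol h0"
    unfolding laplace_symbol_def nh0 unfolding h0_def[abs_def]
    by (intro conjI square_integrable_diff square_integrable_scale square_integrable_e p)
  have inth0: "integrable lborel h0" by (rule laplace_symbol_integrable[OF dim' symh0])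
  define t where "t = (LINT \<xi>|lborel. h0 \<xi>) / I"
  define h where "h \<xi> = h0 \<xi> - t * D \<xi>" for \<xi>
  have sqh: "square_integrable h" and sqnh: "square_integrable (\<lambda>\<xi>. ?n \<xi> * h \<xi>)"
  proof -
    show "square_integrable h"
      unfolding h_def[abs_def] using symh0 symD
      by (intro square_integrable_diff square_integrable_scale laplace_symbol_square_integrable)
    have "(\<lambda>\<xi>. ?n \<xi> * h \<xi>) = (\<lambda>\<xi>. ?n \<xi> * h0 \<xi> - t * (?n \<xi> * D \<xi>))"
      by (simp add: h_def fun_eq_iff algebra_simps)
    then show "square_integrable (\<lambda>\<xi>. ?n \<xi> * h \<xi>)"
      using symh0 symD unfolding laplace_symbol_def
      by (simp only:) (intro square_integrable_diff square_integrable_scale, blast+)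
  qed
  have "(LINT \<xi>|lborel. h \<xi>) = (LINT \<xi>|lborel. h0 \<xi>) - t * I"
    unfolding h_def I_def using inth0 intD by simp
  also have "\<dots> = 0" using I by (simp add: t_def)
  finally have h_in: "(inv_fourier (to_L2 h), inv_fourier (to_L2 (\<lambda>\<xi>. ?n \<xi> * h \<xi>))) \<in> L_min"
    unfolding min_laplacian_def laplace_symbol_def using sqh sqnh by blast
  \<comment> \<open>Read off from p = h + c e1 + t (e1 - e2).\<close>
  define \<beta> where "\<beta> = c + t"
  define \<gamma> where "\<gamma> = - t"
  have pe: "p = (\<lambda>\<xi>. h \<xi> + (\<beta> * e1 \<xi> + \<gamma> * e2 \<xi>))"
    by (simp add: fun_eq_iff h_def h0_def D_def \<beta>_def \<gamma>_def algebra_simps)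
  have "v = inv_fourier (to_L2 h) + defect \<beta> \<gamma>"
    unfolding p(3) defect_def g1_def g2_def inv_fourier_scaleC[symmetric] inv_fourier_add[symmetric]
    by (subst pe)
      (simp only: to_L2_add[OF sqh square_integrable_add[OF square_integrable_scale square_integrable_scale]]
        to_L2_add[OF square_integrable_scale square_integrable_scale] to_L2_scale square_integrable_e)
  \<comment> \<open>As \<beta> + \<gamma> = c, the constant splits into the two constants that
    \<open>e_eq\<close> consumes.\<close>
  have we: "(\<lambda>\<xi>. ?n \<xi> * p \<xi> - c) = (\<lambda>\<xi>. ?n \<xi> * h \<xi> + ((\<i> * \<beta>) * e1 \<xi> - (\<i> * \<gamma>) * e2 \<xi>))"
  proof
    fix \<xi>
    have "?n \<xi> * p \<xi> - c = ?n \<xi> * h \<xi> + (\<beta> * (?n \<xi> * e1 \<xi> - 1) + \<gamma> * (?n \<xi> * e2 \<xi> - 1))"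
      by (subst pe) (simp add: \<beta>_def \<gamma>_def algebra_simps)
    then show "?n \<xi> * p \<xi> - c = ?n \<xi> * h \<xi> + ((\<i> * \<beta>) * e1 \<xi> - (\<i> * \<gamma>) * e2 \<xi>)"
      by (simp only: e_eq) (simp add: algebra_simps)
  qed
  have "w = inv_fourier (to_L2 (\<lambda>\<xi>. ?n \<xi> * h \<xi>)) + defect_image \<beta> \<gamma>"
    unfolding p(4) we defect_image_def g1_def g2_def inv_fourier_scaleC[symmetric] inv_fourier_add[symmetric] inv_fourier_diff[symmetric]
    by (simp only: to_L2_add[OF sqnh square_integrable_diff[OF square_integrable_scale square_integrable_scale]]
        to_L2_diff[OF square_integrable_scale square_integrable_scale] to_L2_scale square_integrable_e)
  show ?thesis by (rule that[OF h_in]) fact+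
qed

text \<open>The components in \<open>L_min\<close> drop out because \<open>L_min\<close> is the
  adjoint of \<open>L_max\<close>. On the defect vectors the mixed terms cancel, whatever the inner
  product of g1 and g2.\<close>

lemma boundary_form:
  assumes 1: "(\<phi>, \<psi>) \<in> L_min" and 2: "(\<phi>', \<psi>') \<in> L_min"
  shows "cinner (\<psi> + defect_image \<beta> \<gamma>) (\<phi>' + defect \<beta>' \<gamma>') - cinner (\<phi> + defect \<beta> \<gamma>) (\<psi>' + defect_image \<beta>' \<gamma>') =
    2 * \<i> * of_real ((norm g1)\<^sup>2) * (\<beta> * cnj \<beta>' - \<gamma> * cnj \<gamma>')"
proof -
  have a: "cinner (\<psi> + defect_image \<beta> \<gamma>) \<phi>' = cinner (\<phi> + defect \<beta> \<gamma>) \<psi>'"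
    by (rule symmetric[OF 2 add_in_max[OF 1]])
  have b: "cinner \<psi> (defect \<beta>' \<gamma>') = cinner \<phi> (defect_image \<beta>' \<gamma>')"
    using symmetric[OF 1 defect_in_max[of \<beta>' \<gamma>']] by (metis cinner_commute)
  have "cinner (defect_image \<beta> \<gamma>) (defect \<beta>' \<gamma>') - cinner (defect \<beta> \<gamma>) (defect_image \<beta>' \<gamma>') =
    2 * \<i> * of_real ((norm g1)\<^sup>2) * (\<beta> * cnj \<beta>' - \<gamma> * cnj \<gamma>')"
    unfolding defect_def defect_image_def cinner_simps cinner_g by (simp add: algebra_simps)
  then show ?thesis
    unfolding cinner_add_right a unfolding cinner_add_left b by simp
qed

text \<open>The boundary form is nondegenerate in the coordinates: if the vector is 0, so is its
  image, and the form vanishes against all (\<beta>', \<gamma>').\<close>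

lemma decomposition_unique:
  assumes "(\<phi>, \<psi>) \<in> L_min" "\<phi> + defect \<beta> \<gamma> = 0"
  shows "\<beta> = 0" "\<gamma> = 0"
proof -
  have "(0, \<psi> + defect_image \<beta> \<gamma>) \<in> L_max" using add_in_max[OF assms(1), of \<beta> \<gamma>] assms(2) by simp
  then have w: "\<psi> + defect_image \<beta> \<gamma> = 0" by (rule max_laplacian_zero)
  have "2 * \<i> * of_real ((norm g1)\<^sup>2) * (\<beta> * cnj \<beta>' - \<gamma> * cnj \<gamma>') = 0" for \<beta>' \<gamma>'
    using boundary_form[OF assms(1) L_min_subspace(3), of \<beta> \<gamma> \<beta>' \<gamma>'] assms(2) w by simp
  then have "\<beta> * cnj \<beta>' - \<gamma> * cnj \<gamma>' = 0" for \<beta>' \<gamma>' using norm_g(2) by simp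
  from this[of 1 0] this[of 0 1] show "\<beta> = 0" "\<gamma> = 0" by simp_all
qed

definition ext :: "complex \<Rightarrow> (real^'n) operator" where
  "ext z = {(\<phi> + defect \<beta> (z * \<beta>), \<psi> + defect_image \<beta> (z * \<beta>)) | \<phi> \<psi> \<beta>. (\<phi>, \<psi>) \<in> L_min}"

lemma ext_sub_max: "ext z \<subseteq> L_max"
  unfolding ext_def using add_in_max by blast

lemma L_min_sub_ext: "L_min \<subseteq> ext z"
proof -
  have "(\<phi> + defect 0 (z * 0), \<psi> + defect_image 0 (z * 0)) \<in> ext z" if "(\<phi>, \<psi>) \<in> L_min" for \<phi> \<psi>
    using that unfolding ext_def by blast
  then show ?thesis by (auto simp: defect_def defect_image_def)
qed

lemma L_sub_min: "(punctured_laplacian :: (real^'n) operator) \<subseteq> L_min"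
  using closure_subset closure_L by blast

lemma ext_unit: "(defect 1 z, defect_image 1 z) \<in> ext z"
  unfolding ext_def using L_min_subspace(3) by (intro CollectI exI[of _ 0] exI[of _ 1]) simp

lemma single_valued_sub_max: "T \<subseteq> L_max \<Longrightarrow> single_valued T"
  using max_laplacian_single_valued single_valued_subset by blast

lemma linear_ext: "linear_operator (ext z)"
  unfolding linear_operator_def
proof (intro conjI ballI allI)
  show "single_valued (ext z)" by (rule single_valued_sub_max[OF ext_sub_max])
  show "(0, 0) \<in> ext z" using L_min_sub_ext L_min_subspace(3) by blast
  show "case x of (u, v) \<Rightarrow> \<forall>(u', v')\<in>ext z. (u + u', v + v') \<in> ext z" if "x \<in> ext z" for x
  proof -
    have "(u + u', v + v') \<in> ext z" if uv: "(u, v) \<in> ext z" "(u', v') \<in> ext z" for u v u' v'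
    proof -
      obtain \<phi> \<psi> \<beta> where 1: "(\<phi>, \<psi>) \<in> L_min" "u = \<phi> + defect \<beta> (z * \<beta>)" "v = \<psi> + defect_image \<beta> (z * \<beta>)"
        using uv(1) unfolding ext_def by blast
      obtain \<phi>' \<psi>' \<beta>' where 2: "(\<phi>', \<psi>') \<in> L_min" "u' = \<phi>' + defect \<beta>' (z * \<beta>')" "v' = \<psi>' + defect_image \<beta>' (z * \<beta>')"
        using uv(2) unfolding ext_def by blast
      have "u + u' = (\<phi> + \<phi>') + defect (\<beta> + \<beta>') (z * (\<beta> + \<beta>'))" "v + v' = (\<psi> + \<psi>') + defect_image (\<beta> + \<beta>') (z * (\<beta> + \<beta>'))"
        unfolding 1 2 distrib_left defect_linear(1,3)[symmetric] by (simp_all add: algebra_simps)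
      then show ?thesis unfolding ext_def using L_min_subspace(1)[OF 1(1) 2(1)] by blast
    qed
    then show ?thesis using that by blast
  qed
  show "case x of (u, v) \<Rightarrow> (c *\<^sub>C u, c *\<^sub>C v) \<in> ext z" if "x \<in> ext z" for c x
  proof -
    obtain \<phi> \<psi> \<beta> where 1: "(\<phi>, \<psi>) \<in> L_min" "x = (\<phi> + defect \<beta> (z * \<beta>), \<psi> + defect_image \<beta> (z * \<beta>))"
      using \<open>x \<in> ext z\<close> unfolding ext_def by blast
    have "c *\<^sub>C (\<phi> + defect \<beta> (z * \<beta>)) = c *\<^sub>C \<phi> + defect (c * \<beta>) (z * (c * \<beta>))"
      "c *\<^sub>C (\<psi> + defect_image \<beta> (z * \<beta>)) = c *\<^sub>C \<psi> + defect_image (c * \<beta>) (z * (c * \<beta>))"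
      by (simp_all add: scaleC_add_right defect_linear mult.left_commute)
    then show ?thesis unfolding 1 ext_def using L_min_subspace(2)[OF 1(1)] by auto
  qed
qed

lemma unit_circle: "cmod z = 1 \<Longrightarrow> z * cnj z = 1"
  by (simp add: complex_norm_square[symmetric])

text \<open>For |z| = 1 the line \<gamma> = z \<beta> is isotropic for the boundary form, which
  gives symmetry. Conversely an element of the adjoint lies in \<open>L_max\<close>, and
  orthogonality to the generator (1, z) already forces \<gamma> = z \<beta>.\<close>

lemma adjoint_ext:
  assumes z: "cmod z = 1"
  shows "adjoint_op (ext z) = ext z"
proof
  show "ext z \<subseteq> adjoint_op (ext z)"
  proof
    fix x assume "x \<in> ext z"
    then obtain \<phi>' \<psi>' \<beta>' where x: "(\<phi>', \<psi>') \<in> L_min" "x = (\<phi>' + defect \<beta>' (z * \<beta>'), \<psi>' + defect_image \<beta>' (z * \<beta>'))"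
      unfolding ext_def by blast
    have "cinner (\<psi> + defect_image \<beta> (z * \<beta>)) (fst x) = cinner (\<phi> + defect \<beta> (z * \<beta>)) (snd x)" if "(\<phi>, \<psi>) \<in> L_min" for \<phi> \<psi> \<beta>
    proof -
      have "\<beta> * cnj \<beta>' - (z * \<beta>) * cnj (z * \<beta>') = (1 - z * cnj z) * (\<beta> * cnj \<beta>')" by (simp add: algebra_simps)
      also have "\<dots> = 0" using unit_circle[OF z] by simp
      finally have "\<beta> * cnj \<beta>' - (z * \<beta>) * cnj (z * \<beta>') = 0" .
      from boundary_form[OF that x(1), of \<beta> "z * \<beta>" \<beta>' "z * \<beta>'", unfolded this] show ?thesis by (simp add: x(2))
    qed
    then show "x \<in> adjoint_op (ext z)"
      unfolding adjoint_op_def ext_def by (cases x) auto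
  qed
  show "adjoint_op (ext z) \<subseteq> ext z"
  proof
    fix x assume x: "x \<in> adjoint_op (ext z)"
    have "adjoint_op (ext z) \<subseteq> L_max"
      unfolding adjoint_L[symmetric] by (intro adjoint_op_antimono order_trans[OF L_sub_min L_min_sub_ext])
    then obtain v w where vw: "x = (v, w)" "(v, w) \<in> L_max" using x by (cases x) blast
    obtain \<phi> \<psi> \<beta> \<gamma> where d: "(\<phi>, \<psi>) \<in> L_min" "v = \<phi> + defect \<beta> \<gamma>" "w = \<psi> + defect_image \<beta> \<gamma>"
      by (rule max_decomposition[OF vw(2)])
    have "cinner (defect_image 1 z) v = cinner (defect 1 z) w"
      using x ext_unit[of z] unfolding vw(1) adjoint_op_def by blast
    then have "2 * \<i> * of_real ((norm g1)\<^sup>2) * (1 * cnj \<beta> - z * cnj \<gamma>) = 0"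
      using boundary_form[OF L_min_subspace(3) d(1), of 1 z \<beta> \<gamma>] by (simp add: d)
    then have "cnj \<beta> = z * cnj \<gamma>" using norm_g(2) by simp
    then have "\<beta> = cnj z * \<gamma>" by (metis complex_cnj_cnj complex_cnj_mult)
    then have "z * \<beta> = (z * cnj z) * \<gamma>" by simp
    then have "\<gamma> = z * \<beta>" using unit_circle[OF z] by simp
    then show "x \<in> ext z" unfolding ext_def vw(1) d(2,3) using d(1) by blast
  qed
qed

lemma self_adjoint_ext: "cmod z = 1 \<Longrightarrow> self_adjoint (ext z)"
proof -
  assume "cmod z = 1"
  moreover have "closure (Domain (ext z)) = UNIV"
    using closure_mono[OF Domain_mono[OF order_trans[OF L_sub_min L_min_sub_ext[of z]]]]
      punctured_laplacian_densely_defined[OF dim] by blast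
  ultimately show ?thesis
    by (simp add: self_adjoint_def densely_defined_def linear_ext adjoint_ext)
qed

lemma ext_inj: "ext z = ext z' \<Longrightarrow> z = z'"
proof -
  assume "ext z = ext z'"
  then have "(defect 1 z, defect_image 1 z) \<in> ext z'" using ext_unit by blast
  then obtain \<phi> \<psi> \<beta> where e: "(\<phi>, \<psi>) \<in> L_min" "defect 1 z = \<phi> + defect \<beta> (z' * \<beta>)"
    unfolding ext_def by blast
  have "\<phi> + defect (\<beta> - 1) (z' * \<beta> - z) = \<phi> + defect \<beta> (z' * \<beta>) - defect 1 z"
    by (simp add: defect_def scaleC_diff_left)
  then have "\<phi> + defect (\<beta> - 1) (z' * \<beta> - z) = 0" using e(2) by simp
  from decomposition_unique[OF e(1) this] show "z = z'" by simp
qed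

text \<open>Taking adjoints of L \<subseteq> T gives T \<subseteq> \<open>L_max\<close>, and once
  more \<open>L_min\<close> \<subseteq> T. The coordinates of T are then isotropic: a nonzero pair
  has |\<beta>| = |\<gamma>|, fixes z, and forces all other pairs onto its line.\<close>

lemma self_adjoint_extension:
  assumes T: "self_adjoint T" "(punctured_laplacian :: (real^'n) operator) \<subseteq> T"
  obtains z where "cmod z = 1" "T = ext z"
proof -
  have adj: "adjoint_op T = T" using T(1) by (simp add: self_adjoint_def)
  have T_max: "T \<subseteq> L_max" using adjoint_op_antimono[OF T(2)] by (simp add: adj adjoint_L)
  have min_T: "L_min \<subseteq> T" using adjoint_op_antimono[OF T_max] by (simp add: adj adjoint_L_max)
  have form: "\<beta> * cnj \<beta>' - \<gamma> * cnj \<gamma>' = 0"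
    if "(\<phi>, \<psi>) \<in> L_min" "(\<phi>', \<psi>') \<in> L_min" "(\<phi> + defect \<beta> \<gamma>, \<psi> + defect_image \<beta> \<gamma>) \<in> T" "(\<phi>' + defect \<beta>' \<gamma>', \<psi>' + defect_image \<beta>' \<gamma>') \<in> T"
    for \<phi> \<psi> \<phi>' \<psi>' \<beta> \<gamma> \<beta>' \<gamma>'
  proof -
    have "(\<phi>' + defect \<beta>' \<gamma>', \<psi>' + defect_image \<beta>' \<gamma>') \<in> adjoint_op T" using that(4) adj by simp
    then have "cinner (\<psi> + defect_image \<beta> \<gamma>) (\<phi>' + defect \<beta>' \<gamma>') = cinner (\<phi> + defect \<beta> \<gamma>) (\<psi>' + defect_image \<beta>' \<gamma>')"
      using that(3) unfolding adjoint_op_def by blast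
    then show ?thesis
      using boundary_form[OF that(1,2), of \<beta> \<gamma> \<beta>' \<gamma>'] norm_g(2) by simp
  qed
  have "\<exists>\<phi> \<psi> \<beta> \<gamma>. (\<phi>, \<psi>) \<in> L_min \<and> (\<phi> + defect \<beta> \<gamma>, \<psi> + defect_image \<beta> \<gamma>) \<in> T \<and> (\<beta> \<noteq> 0 \<or> \<gamma> \<noteq> 0)"
  proof (rule ccontr)
    assume no: "\<not> ?thesis"
    have "T \<subseteq> L_min"
    proof
      fix x assume x: "x \<in> T"
      obtain v w where vw: "x = (v, w)" by (cases x)
      then have "(v, w) \<in> L_max" using x T_max by blast
      then obtain \<phi> \<psi> \<beta> \<gamma> where d: "(\<phi>, \<psi>) \<in> L_min" "v = \<phi> + defect \<beta> \<gamma>" "w = \<psi> + defect_image \<beta> \<gamma>"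
        by (rule max_decomposition)
      then have "\<beta> = 0" "\<gamma> = 0" using no x vw by blast+
      then show "x \<in> L_min" using d vw by (simp add: defect_def defect_image_def)
    qed
    \<comment> \<open>Were T contained in \<open>L_min\<close>, it would be \<open>L_min\<close>
      itself, whose adjoint contains \<open>L_max\<close> and with it g1; but the boundary
      coordinates of g1 are not 0.\<close>
    then have "adjoint_op L_min \<subseteq> L_min" using adjoint_op_antimono[of T L_min] adj \<open>T \<subseteq> L_min\<close> by blast
    then have "(g1, \<i> *\<^sub>C g1) \<in> L_min"
      using g_in_max(1) subset_adjoint_adjoint[of L_max] adjoint_L_max by auto
    from decomposition_unique(1)[OF this, of "- 1" 0] show False
      by (simp add: defect_def scaleC_minus_left)
  qed
  then obtain \<phi>0 \<psi>0 \<beta>0 \<gamma>0 where x0: "(\<phi>0, \<psi>0) \<in> L_min" "(\<phi>0 + defect \<beta>0 \<gamma>0, \<psi>0 + defect_image \<beta>0 \<gamma>0) \<in> T" "\<beta>0 \<noteq> 0 \<or> \<gamma>0 \<noteq> 0"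
    by blast
  have "complex_of_real ((cmod \<beta>0)\<^sup>2) = of_real ((cmod \<gamma>0)\<^sup>2)"
    using form[OF x0(1,1,2,2)] by (simp only: complex_norm_square right_minus_eq)
  then have "(cmod \<beta>0)\<^sup>2 = (cmod \<gamma>0)\<^sup>2" by (simp only: of_real_eq_iff)
  then have eqn: "cmod \<gamma>0 = cmod \<beta>0" by (simp add: power2_eq_iff_nonneg)
  then have b0: "\<beta>0 \<noteq> 0" "\<gamma>0 \<noteq> 0" using x0(3) by auto
  define z where "z = \<gamma>0 / \<beta>0"
  have z: "cmod z = 1" using eqn b0 by (simp add: z_def norm_divide)
  have g0: "\<gamma>0 = z * \<beta>0" using b0 by (simp add: z_def)
  have T_ext: "T \<subseteq> ext z"
  proof
    fix x assume x: "x \<in> T"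
    obtain v w where vw: "x = (v, w)" by (cases x)
    then have "(v, w) \<in> L_max" using x T_max by blast
    then obtain \<phi> \<psi> \<beta> \<gamma> where d: "(\<phi>, \<psi>) \<in> L_min" "v = \<phi> + defect \<beta> \<gamma>" "w = \<psi> + defect_image \<beta> \<gamma>"
      by (rule max_decomposition)
    have "\<beta> * cnj \<beta>0 - \<gamma> * cnj \<gamma>0 = 0" using form[OF d(1) x0(1) _ x0(2)] x vw d by blast
    then have "(\<beta> - \<gamma> * cnj z) * cnj \<beta>0 = 0" by (simp add: g0 algebra_simps)
    then have "\<beta> = \<gamma> * cnj z" using b0 by simp
    then have "z * \<beta> = \<gamma> * (z * cnj z)" by simp
    then have "\<gamma> = z * \<beta>" using unit_circle[OF z] by simp
    then show "x \<in> ext z" unfolding ext_def vw d(2,3) using d(1) by blast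
  qed
  \<comment> \<open>Both operators equal their adjoints, so the inclusion just proved also holds in
    reverse.\<close>
  have "ext z \<subseteq> T" using adjoint_op_antimono[OF T_ext] by (simp add: adj adjoint_ext[OF z])
  then show ?thesis using that[OF z] T_ext by blast
qed

lemma op_apply_eq: "T \<subseteq> L_max \<Longrightarrow> (u, v) \<in> T \<Longrightarrow> op_apply T u = v"
  unfolding op_apply_def using single_valued_sub_max[of T] by (auto dest: single_valuedD)

lemma Domain_ext:
  "Domain (ext z) = {\<phi> + \<beta> *\<^sub>C g1 + (z * \<beta>) *\<^sub>C g2 | \<phi> \<beta>. \<phi> \<in> Domain L_min}"
  unfolding ext_def defect_def add.assoc by blast

lemma op_apply_ext:
  assumes "\<phi> \<in> Domain L_min"
  shows "op_apply (ext z) (\<phi> + \<beta> *\<^sub>C g1 + (z * \<beta>) *\<^sub>C g2) =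
    op_apply L_min \<phi> + (\<i> * \<beta>) *\<^sub>C g1 - (\<i> * z * \<beta>) *\<^sub>C g2"
proof -
  obtain \<psi> where \<psi>: "(\<phi>, \<psi>) \<in> L_min" using assms by blast
  have "(\<phi> + defect \<beta> (z * \<beta>), \<psi> + defect_image \<beta> (z * \<beta>)) \<in> ext z" unfolding ext_def using \<psi> by blast
  from op_apply_eq[OF ext_sub_max this] op_apply_eq[OF L_min_sub_max \<psi>] show ?thesis
    by (simp add: defect_def defect_image_def add.assoc mult.assoc)
qed

end

section \<open>Parametrization by the angle\<close>

text \<open>\<open>Arg\<close> takes values in the interval open at -\<pi> and closed at \<pi>, so
  only the value \<pi> has to be moved to -\<pi>.\<close>

lemma bij_betw_unit_circle: "bij_betw (\<lambda>\<theta>. exp (\<i> * of_real \<theta>)) {-pi..<pi} {z. cmod z = 1}"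
proof (rule bij_betwI')
  fix x y :: real assume xy: "x \<in> {-pi..<pi}" "y \<in> {-pi..<pi}"
  show "exp (\<i> * of_real x) = exp (\<i> * of_real y) \<longleftrightarrow> x = y"
  proof
    assume "exp (\<i> * of_real x) = exp (\<i> * of_real y)"
    then obtain n :: int where "\<i> * of_real x = \<i> * of_real y + of_real (of_int (2 * n) * pi) * \<i>"
      unfolding exp_eq by blast
    then have "Im (\<i> * of_real x) = Im (\<i> * of_real y + of_real (of_int (2 * n) * pi) * \<i>)" by (rule arg_cong)
    then have "x = y + of_int (2 * n) * pi"
      by simp
    then have eq: "x - y = of_int n * (2 * pi)" by simp
    have "\<bar>x - y\<bar> < 2 * pi" using xy by auto
    then have "\<bar>of_int n :: real\<bar> < 1" using eq pi_gt_zero by (simp add: abs_mult)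
    then have "n = 0" by linarith
    then show "x = y" using eq by simp
  qed simp
next
  fix x :: real
  show "exp (\<i> * of_real x) \<in> {z. cmod z = 1}" by simp
next
  fix z assume "z \<in> {z. cmod z = 1}"
  then have "cmod z = 1" by simp
  then have "z \<noteq> 0" by auto
  then have z: "z = exp (\<i> * of_real (Arg z))" using Arg_eq[of z] \<open>cmod z = 1\<close> by simp
  show "\<exists>x\<in>{-pi..<pi}. z = exp (\<i> * of_real x)"
  proof (cases "Arg z = pi")
    case True
    then have "z = exp (\<i> * of_real (- pi))" using z by (simp add: exp_minus)
    then show ?thesis using pi_gt_zero by (intro bexI[of _ "- pi"]) auto
  next
    case False
    then have "Arg z \<in> {-pi..<pi}" using Arg_bounded[of z] by auto
    then show ?thesis using z by blast
  qed
qed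

theorem proposition2p1:
  fixes L :: "(real^'n) operator"
  assumes "CARD('n) \<in> {2, 3}"
    and "L = punctured_laplacian"
  shows
    "let g\<^sub>1 = inv_fourier (to_L2 (\<lambda>\<xi>::real^'n. 1 / (complex_of_real ((norm \<xi>)\<^sup>2) - \<i>)));
         g\<^sub>2 = inv_fourier (to_L2 (\<lambda>\<xi>::real^'n. 1 / (complex_of_real ((norm \<xi>)\<^sup>2) + \<i>)))
     in \<exists>L\<^sub>\<theta> :: real \<Rightarrow> (real^'n) operator.
          bij_betw L\<^sub>\<theta> {-pi..<pi} {A. self_adjoint A \<and> L \<subseteq> A} \<and>
          (\<forall>\<theta>\<in>{-pi..<pi}.
             Domain (L\<^sub>\<theta> \<theta>) =
               {\<phi> + \<beta> *\<^sub>C g\<^sub>1 + (exp (\<i> * of_real \<theta>) * \<beta>) *\<^sub>C g\<^sub>2 | \<phi> \<beta>.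
                  \<phi> \<in> sobolev 2 \<and> point_value \<phi> 0 = 0} \<and>
             (\<forall>\<phi> \<beta>. \<phi> \<in> sobolev 2 \<and> point_value \<phi> 0 = 0 \<longrightarrow>
                \<phi> \<in> Domain (op_closure L) \<and>
                op_apply (L\<^sub>\<theta> \<theta>) (\<phi> + \<beta> *\<^sub>C g\<^sub>1 + (exp (\<i> * of_real \<theta>) * \<beta>) *\<^sub>C g\<^sub>2) =
                  op_apply (op_closure L) \<phi> + (\<i> * \<beta>) *\<^sub>C g\<^sub>1
                    - (\<i> * exp (\<i> * of_real \<theta>) * \<beta>) *\<^sub>C g\<^sub>2))"
proof -
  interpret point_interaction "TYPE('n)" using assms(1) by unfold_locales auto
  have bij: "bij_betw (\<lambda>\<theta>. ext (exp (\<i> * of_real \<theta>))) {-pi..<pi} {A. self_adjoint A \<and> L \<subseteq> A}"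
  proof -
    have "bij_betw ext {z. cmod z = 1} {A. self_adjoint A \<and> L \<subseteq> A}"
      unfolding bij_betw_def
    proof
      show "inj_on ext {z. cmod z = 1}" using ext_inj by (auto intro: inj_onI)
      show "ext ` {z. cmod z = 1} = {A. self_adjoint A \<and> L \<subseteq> A}"
        using self_adjoint_ext order_trans[OF L_sub_min L_min_sub_ext]
        unfolding assms(2) by (auto elim: self_adjoint_extension)
    qed
    from bij_betw_trans[OF bij_betw_unit_circle this] show ?thesis by (simp add: o_def)
  qed
  have dom: "\<phi> \<in> sobolev 2 \<and> point_value \<phi> 0 = 0 \<longleftrightarrow> \<phi> \<in> Domain L_min" for \<phi> :: "(real^'n) L2"
    using Domain_min_laplacian[OF dim(2)] by blast
  have clo: "op_closure L = L_min" unfolding op_closure_def assms(2) by (rule closure_L)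
  show ?thesis
    unfolding Let_def e1_def[abs_def, symmetric] e2_def[abs_def, symmetric] g1_def[symmetric] g2_def[symmetric] dom clo
    by (intro exI[of _ "\<lambda>\<theta>. ext (exp (\<i> * of_real \<theta>))"] conjI bij ballI allI impI Domain_ext op_apply_ext)
qed

end
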